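(* Let $p=p_n$ be positive integers with $n>p+1$ for all $n\geq 3$ and $\lim_{n\to\infty}p/n=y\in(0,1]$. For each $n$, let $\mathbf{x}_1,\dots,\mathbf{x}_n$ be i.i.d. $N_p(\boldsymbol{\mu},\boldsymbol{\Sigma})$ random vectors, and put $$\bar{\mathbf{x}}=\frac1n\sum_{i=1}^n\mathbf{x}_i,\qquad \mathbf{S}=\frac1n\sum_{i=1}^n(\mathbf{x}_i-\bar{\mathbf{x}})(\mathbf{x}_i-\bar{\mathbf{x}})',\qquad V_n=|\mathbf{S}|\cdot\Big(\frac{\operatorname{tr}(\mathbf{S})}{p}\Big)^{-p}.$$ Assume the null hypothesis $H_0:\boldsymbol{\Sigma}=\lambda\mathbf{I}_p$ for some (unspecified) $\lambda>0$. Then $(\log V_n-\mu_n)/\sigma_n$ converges in distribution to $N(0,1)$ as $n\to\infty$, where $$\mu_n=-p-\Big(n-p-\frac32\Big)\log\Big(1-\frac{p}{n-1}\Big),\qquad \sigma_n^2=-2\Big[\frac{p}{n-1}+\log\Big(1-\frac{p}{n-1}\Big)\Big].$$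
   Context: $|\cdot|$ denotes the determinant, $\mathbf{I}_p$ the $p\times p$ identity matrix, and $'$ transposition. $V_n$ is the likelihood ratio (sphericity) statistic for testing $H_0:\boldsymbol{\Sigma}=\lambda\mathbf{I}_p$. *)

theory Defs
  imports "HOL-Probability.Probability" "Jordan_Normal_Form.Determinant"
begin

definition normal_rv :: "'a measure \<Rightarrow> ('a \<Rightarrow> real) \<Rightarrow> real \<Rightarrow> real \<Rightarrow> bool" where
  "normal_rv M Y m v \<longleftrightarrow>
     (if v = 0 then Y \<in> borel_measurable M \<and> (AE \<omega> in M. Y \<omega> = m)
      else 0 < v \<and> distributed M lborel Y (normal_density m (sqrt v)))"

text \<open>A random vector X (coordinates 0..p-1) with law N_p(mu, Sig), via the Cramer-Wold
  definition: every linear combination a'X is N(a'mu, a'Sig a).\<close>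
definition mvn_rv :: "'a measure \<Rightarrow> nat \<Rightarrow> ('a \<Rightarrow> nat \<Rightarrow> real) \<Rightarrow> (nat \<Rightarrow> real)
                       \<Rightarrow> (nat \<Rightarrow> nat \<Rightarrow> real) \<Rightarrow> bool" where
  "mvn_rv M p X mu Sig \<longleftrightarrow>
     (\<forall>a :: nat \<Rightarrow> real. normal_rv M (\<lambda>\<omega>. \<Sum>j<p. a j * X \<omega> j) (\<Sum>j<p. a j * mu j)
                                 (\<Sum>j<p. \<Sum>k<p. a j * Sig j k * a k))"

definition mat_trace :: "real mat \<Rightarrow> real" where
  "mat_trace A = (\<Sum>i<dim_row A. A $$ (i, i))"

definition sample_mean :: "nat \<Rightarrow> (nat \<Rightarrow> nat \<Rightarrow> real) \<Rightarrow> nat \<Rightarrow> real" where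
  "sample_mean n x j = (\<Sum>i<n. x i j) / real n"

definition sample_cov :: "nat \<Rightarrow> nat \<Rightarrow> (nat \<Rightarrow> nat \<Rightarrow> real) \<Rightarrow> real mat" where
  "sample_cov n p x = mat p p (\<lambda>(j, k).
      (\<Sum>i<n. (x i j - sample_mean n x j) * (x i k - sample_mean n x k)) / real n)"

definition sphericity_V :: "nat \<Rightarrow> nat \<Rightarrow> (nat \<Rightarrow> nat \<Rightarrow> real) \<Rightarrow> real" where
  "sphericity_V n p x = det (sample_cov n p x) * (mat_trace (sample_cov n p x) / real p) powr (- real p)"

definition sph_mu :: "nat \<Rightarrow> nat \<Rightarrow> real" where
  "sph_mu n p = - real p - (real n - real p - 3/2) * ln (1 - real p / (real n - 1))"

definition sph_sigma2 :: "nat \<Rightarrow> nat \<Rightarrow> real" where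
  "sph_sigma2 n p = - 2 * (real p / (real n - 1) + ln (1 - real p / (real n - 1)))"

end

theory Submission
  imports Defs "HOL-Complex_Analysis.Complex_Analysis" "HOL-Real_Asymp.Real_Asymp"
begin

text \<open>The proof computes the moments of \<open>V\<^sub>n\<close> exactly and shows that the moment generating functions of
  the standardised statistic converge near \<open>0\<close>.

  Gram-Schmidt applied to the all-ones vector followed by the \<open>p\<close> data columns in \<open>\<real>\<^sup>n\<close> turns the
  determinant of the scatter matrix into a product of squared residual lengths. Given the earlier columns,
  the Laplace transform of a residual is a Gaussian integral, computed by the Hubbard-Stratonovich trick.
  A nonnegative \<open>X\<close> with Laplace transform \<open>(1 + t) powr (- a)\<close> has \<open>E (X powr s) = Gamma (a + s) / Gamma a\<close>;
  this gives the moments of the determinant and, once more under the law tilted by the \<open>s\<close>-th power of the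
  determinant, the negative moments of the trace. Hence \<open>E (V powr s)\<close> is a product of quotients of Gamma
  values. Expanding \<open>ln_Gamma\<close> to second order, the sum over the degrees of freedom telescopes to
  \<open>s * \<mu> + s\<^sup>2 * \<sigma>\<^sup>2 / 2\<close> up to an error \<open>O(\<bar>s\<bar> / (n - 1 - p))\<close>, which vanishes for \<open>s = t / \<sigma>\<close> because
  \<open>\<sigma> * (n - 1 - p)\<close> tends to infinity, even if \<open>n - p\<close> stays bounded.\<close>

subsection \<open>Convergence of moment generating functions\<close>

text \<open>Tonelli-type arguments evaluate the moments for real exponents only, which is why the
  limit is reached through moment generating functions and not directly through characteristic
  functions. The determinant and the trace are dependent. The parameter \<open>\<theta>\<close>
  carries the trace through every column integral, so their joint behaviour comes out of the same
  Gaussian computation as the determinant alone. The obstacle is that \<open>p / n\<close> may tend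
  to 1: the degrees of freedom \<open>n - 1 - j\<close> can come down to 2, where Stirling-type
  errors are not small. They are still of size \<open>\<bar>s\<bar> / (n - 1 - j)\<^sup>2\<close>,
  with a sum of order \<open>\<bar>s\<bar> / (n - 1 - p)\<close>. If \<open>n - 1 - p\<close> is at
  least \<open>sqrt (n - 1)\<close>, this vanishes because \<open>\<sigma>\<close> stays away from
  0; otherwise \<open>\<sigma>\<^sup>2\<close> is at least \<open>ln (n - 1) - 2\<close>, and
  \<open>s = t / \<sigma>\<close> itself tends to 0. The floor 2 also keeps every Gamma argument
  positive for \<open>\<bar>s\<bar> \<le> 1 / 2\<close>. The 3/2 in the centering is 1 + 1/2: the 1
  from the estimated mean, the 1/2 from Stirling's formula. The trace supplies the term
  \<open>p / (n - 1)\<close> of the variance.\<close>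

text \<open>Differentiation under the integral sign with an explicit remainder: the second-order
  error of \<open>exp\<close> is at most a constant times
  \<open>(norm h)\<^sup>2 * exp (d * \<bar>x\<bar>)\<close>, which the assumed exponential moment
  integrates.\<close>

lemma holomorphic_on_complex_mgf:
  fixes M :: "real measure" and d :: real
  assumes sets_M [measurable_cong]: "sets M = sets borel"
    and int: "integrable M (\<lambda>x. exp (d * \<bar>x\<bar>))"
  shows "(\<lambda>z. \<integral>x. exp (z * complex_of_real x) \<partial>M) holomorphic_on {z. \<bar>Re z\<bar> < d}"
proof -
  define F where "F z = (\<integral>x. exp (z * complex_of_real x) \<partial>M)" for z
  have "(F has_field_derivative (\<integral>x. of_real x * exp (z * of_real x) \<partial>M)) (at z)"
    if z: "\<bar>Re z\<bar> < d" for z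
  proof -
    \<comment> \<open>Half the distance to the edge of the strip: one \<open>e\<close> absorbs the
      factor \<open>x\<^sup>2\<close>, another the increment \<open>h\<close>, and
      \<open>\<bar>Re z\<bar> + e + e = d\<close> exhausts the available moment exactly.\<close>
    define e where "e = (d - \<bar>Re z\<bar>) / 2"
    have e: "e > 0" "\<bar>Re z\<bar> + e \<le> d - e" using z by (auto simp: e_def field_simps)
    have d0: "d > 0" using z by linarith
    define C where "C = (2 / e\<^sup>2) * (\<integral>x. exp (d * \<bar>x\<bar>) \<partial>M)"
    have sq: "x\<^sup>2 \<le> (2 / e\<^sup>2) * exp (e * \<bar>x\<bar>)" for x
    proof -
      have "(e * \<bar>x\<bar>)\<^sup>2 / 2 \<le> exp (e * \<bar>x\<bar>)"
        using exp_lower_Taylor_quadratic[of "e * \<bar>x\<bar>"] e by (smt (verit) abs_ge_zero mult_nonneg_nonneg)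
      thus ?thesis using e by (simp add: field_simps power_mult_distrib)
    qed
    have int_w: "integrable M (\<lambda>x. exp (w * complex_of_real x))" if "\<bar>Re w\<bar> \<le> d" for w
    proof (rule Bochner_Integration.integrable_bound[OF int])
      show "AE x in M. norm (exp (w * complex_of_real x)) \<le> norm (exp (d * \<bar>x\<bar>))"
      proof (intro AE_I2)
        fix x :: real
        have "Re w * x \<le> \<bar>Re w\<bar> * \<bar>x\<bar>" by (metis abs_ge_self abs_mult)
        also have "\<dots> \<le> d * \<bar>x\<bar>" using that by (simp add: mult_right_mono)
        finally show "norm (exp (w * complex_of_real x)) \<le> norm (exp (d * \<bar>x\<bar>))" by simp
      qed
    qed simp
    have int_d: "integrable M (\<lambda>x. of_real x * exp (z * complex_of_real x))"
    proof (rule Bochner_Integration.integrable_bound[of _ "\<lambda>x. ((1 + 2 / e\<^sup>2) * exp (d * \<bar>x\<bar>))"])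
      show "AE x in M. norm (of_real x * exp (z * complex_of_real x)) \<le> norm ((1 + 2 / e\<^sup>2) * exp (d * \<bar>x\<bar>))"
      proof (intro AE_I2)
        fix x :: real
        have "Re z * x \<le> \<bar>Re z\<bar> * \<bar>x\<bar>" by (metis abs_ge_self abs_mult)
        hence 1: "exp (Re z * x) \<le> exp (\<bar>Re z\<bar> * \<bar>x\<bar>)" by simp
        have "\<bar>x\<bar> \<le> 1 + x\<^sup>2"
          using zero_le_power2[of "\<bar>x\<bar> - 1"] by (simp add: power2_eq_square algebra_simps; smt (verit) abs_mult_self_eq)
        also have "\<dots> \<le> exp (e * \<bar>x\<bar>) + (2 / e\<^sup>2) * exp (e * \<bar>x\<bar>)"
          using sq[of x] e by (smt (verit) one_le_exp_iff abs_ge_zero mult_nonneg_nonneg)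
        finally have 2: "\<bar>x\<bar> \<le> (1 + 2 / e\<^sup>2) * exp (e * \<bar>x\<bar>)" by (simp add: algebra_simps)
        have "norm (of_real x * exp (z * complex_of_real x)) = \<bar>x\<bar> * exp (Re z * x)"
          by (simp add: norm_mult)
        also have "\<dots> \<le> ((1 + 2 / e\<^sup>2) * exp (e * \<bar>x\<bar>)) * exp (\<bar>Re z\<bar> * \<bar>x\<bar>)"
          by (rule mult_mono[OF 2 1]) auto
        also have "\<dots> = (1 + 2 / e\<^sup>2) * exp ((\<bar>Re z\<bar> + e) * \<bar>x\<bar>)"
          by (simp add: exp_add[symmetric] algebra_simps)
        also have "\<dots> \<le> (1 + 2 / e\<^sup>2) * exp (d * \<bar>x\<bar>)"
          using e by (intro mult_left_mono) (auto intro!: mult_right_mono)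
        also have "\<dots> \<le> norm ((1 + 2 / e\<^sup>2) * exp (d * \<bar>x\<bar>))" by simp
        finally show "norm (of_real x * exp (z * complex_of_real x)) \<le> norm ((1 + 2 / e\<^sup>2) * exp (d * \<bar>x\<bar>))" .
      qed
    qed (use int in auto)
    have bound: "norm ((F (z + h) - F z) / h - (\<integral>x. of_real x * exp (z * of_real x) \<partial>M)) \<le> C * norm h"
      if h: "h \<noteq> 0" "norm h < e" for h
    proof -
      have "\<bar>Re (z + h)\<bar> \<le> d" using e h abs_Re_le_cmod[of h] by auto
      hence i1: "integrable M (\<lambda>x. exp ((z + h) * complex_of_real x))" by (rule int_w)
      have i2: "integrable M (\<lambda>x. exp (z * complex_of_real x))" using z by (intro int_w) auto
      have "F (z + h) - F z - h * (\<integral>x. of_real x * exp (z * of_real x) \<partial>M)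
          = (\<integral>x. exp ((z + h) * of_real x) - exp (z * of_real x) - h * (of_real x * exp (z * of_real x)) \<partial>M)"
        unfolding F_def using i1 i2 int_d by simp
      also have "norm \<dots> \<le> (\<integral>x. (norm h)\<^sup>2 * ((2 / e\<^sup>2) * exp (d * \<bar>x\<bar>)) \<partial>M)"
      proof (rule Bochner_Integration.integral_norm_bound_integral)
        show "integrable M (\<lambda>x. exp ((z + h) * complex_of_real x) - exp (z * of_real x) - h * (of_real x * exp (z * of_real x)))"
          using i1 i2 int_d by simp
        show "integrable M (\<lambda>x. (norm h)\<^sup>2 * ((2 / e\<^sup>2) * exp (d * \<bar>x\<bar>)))" using int by simp
        fix x
        define w where "w = h * of_real x"
        have "exp ((z + h) * complex_of_real x) - exp (z * of_real x) - h * (of_real x * exp (z * of_real x))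
            = exp (z * of_real x) * (exp w - (1 + w))"
          by (simp add: w_def exp_add algebra_simps)
        also have "norm \<dots> = exp (Re z * x) * norm (exp w - (1 + w))" by (simp add: norm_mult)
        also have "norm (exp w - (1 + w)) \<le> exp \<bar>Re w\<bar> * (norm w)\<^sup>2"
          using Taylor_exp[of w 1] by (simp add: numeral_2_eq_2)
        also have "exp \<bar>Re w\<bar> * (norm w)\<^sup>2 \<le> exp (e * \<bar>x\<bar>) * ((norm h)\<^sup>2 * x\<^sup>2)"
        proof (intro mult_mono)
          have "\<bar>Re w\<bar> \<le> norm h * \<bar>x\<bar>" using abs_Re_le_cmod[of w] by (simp add: w_def norm_mult)
          also have "\<dots> \<le> e * \<bar>x\<bar>" using h by (intro mult_right_mono) auto
          finally show "exp \<bar>Re w\<bar> \<le> exp (e * \<bar>x\<bar>)" by simp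
        qed (auto simp: w_def norm_mult power_mult_distrib)
        also have "exp (Re z * x) * (exp (e * \<bar>x\<bar>) * ((norm h)\<^sup>2 * x\<^sup>2))
            \<le> exp (\<bar>Re z\<bar> * \<bar>x\<bar>) * (exp (e * \<bar>x\<bar>) * ((norm h)\<^sup>2 * ((2 / e\<^sup>2) * exp (e * \<bar>x\<bar>))))"
        proof (intro mult_mono)
          have "Re z * x \<le> \<bar>Re z\<bar> * \<bar>x\<bar>" by (metis abs_ge_self abs_mult)
          thus "exp (Re z * x) \<le> exp (\<bar>Re z\<bar> * \<bar>x\<bar>)" by simp
        qed (use sq in auto)
        also have "\<dots> = (norm h)\<^sup>2 * ((2 / e\<^sup>2) * exp ((\<bar>Re z\<bar> + e + e) * \<bar>x\<bar>))"
          by (simp only: distrib_right exp_add) (simp only: mult_ac)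
        also have "\<bar>Re z\<bar> + e + e = d" by (simp add: e_def)
        finally show "norm (exp ((z + h) * complex_of_real x) - exp (z * of_real x) - h * (of_real x * exp (z * of_real x)))
           \<le> (norm h)\<^sup>2 * ((2 / e\<^sup>2) * exp (d * \<bar>x\<bar>))" by simp
      qed
      also have "\<dots> = C * norm h * norm h" unfolding C_def by (simp add: power2_eq_square)
      finally have "norm (F (z + h) - F z - h * (\<integral>x. of_real x * exp (z * of_real x) \<partial>M)) / norm h \<le> C * norm h"
        using h by (simp add: field_simps)
      moreover have "(F (z + h) - F z) / h - (\<integral>x. of_real x * exp (z * of_real x) \<partial>M)
         = (F (z + h) - F z - h * (\<integral>x. of_real x * exp (z * of_real x) \<partial>M)) / h"
        using h by (simp add: field_simps)
      ultimately show ?thesis by (simp add: norm_divide)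
    qed
    have "((\<lambda>h. (F (z + h) - F z) / h - (\<integral>x. of_real x * exp (z * of_real x) \<partial>M)) \<longlongrightarrow> 0) (at 0)"
    proof (rule Lim_null_comparison)
      show "\<forall>\<^sub>F h in at 0. norm ((F (z + h) - F z) / h - (\<integral>x. of_real x * exp (z * of_real x) \<partial>M)) \<le> C * norm h"
        unfolding eventually_at using bound e by (intro exI[of _ e]) auto
      show "((\<lambda>h::complex. C * norm h) \<longlongrightarrow> 0) (at 0)" by (auto intro!: tendsto_eq_intros)
    qed
    thus ?thesis unfolding DERIV_def by (rule LIM_zero_cancel)
  qed
  thus ?thesis unfolding F_def[symmetric]
    by (auto simp: holomorphic_on_def field_differentiable_def intro: has_field_derivative_at_within)
qed

text \<open>The transforms \<open>E (exp (z * X))\<close> are uniformly bounded on a strip around the imaginary axis, so by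
  Montel subsequences converge there, and the limit is determined by its values on the real segment.\<close>
lemma weak_conv_m_std_normal_if_mgf:
  fixes \<mu> :: "nat \<Rightarrow> real measure" and d :: real
  assumes rd: "\<And>n. real_distribution (\<mu> n)" and d: "d > 0"
    and mgf: "\<And>t. \<bar>t\<bar> < d \<Longrightarrow> (\<lambda>n. \<integral>\<^sup>+x. ennreal (exp (t * x)) \<partial>\<mu> n) \<longlonglongrightarrow> ennreal (exp (t\<^sup>2 / 2))"
  shows "weak_conv_m \<mu> std_normal_distribution"
proof (rule levy_continuity[OF rd real_dist_normal_dist])
  fix t0 :: real
  have sets_mu [measurable_cong]: "sets (\<mu> n) = sets borel" for n
    using rd[of n] by (simp add: real_distribution_def real_distribution_axioms_def)
  \<comment> \<open>Strictly inside the interval, so that the assumed convergence also holds at the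
    endpoints \<open>\<delta>\<close> and \<open>- \<delta>\<close>; these two values together
    control \<open>exp (\<delta> * \<bar>x\<bar>)\<close>.\<close>
  define \<delta> where "\<delta> = d / 2"
  have \<delta>: "0 < \<delta>" "\<delta> < d" using d by (auto simp: \<delta>_def)
  define B where "B = exp (\<delta>\<^sup>2 / 2) + 1"
  have ev: "\<forall>\<^sub>F n in sequentially. (\<integral>\<^sup>+x. ennreal (exp (t * x)) \<partial>\<mu> n) < ennreal B" if "\<bar>t\<bar> = \<delta>" for t
  proof (rule order_tendstoD(2)[OF mgf])
    show "\<bar>t\<bar> < d" using that \<delta> by simp
    have "t\<^sup>2 = \<delta>\<^sup>2" using that by (metis power2_abs)
    thus "ennreal (exp (t\<^sup>2 / 2)) < ennreal B" by (simp add: B_def ennreal_lessI)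
  qed
  obtain N where N: "\<And>n t. n \<ge> N \<Longrightarrow> t = \<delta> \<or> t = -\<delta> \<Longrightarrow> (\<integral>\<^sup>+x. ennreal (exp (t * x)) \<partial>\<mu> n) < ennreal B"
    using eventually_conj[OF ev[of \<delta>] ev[of "-\<delta>"]] \<delta> unfolding eventually_sequentially by fastforce
  have nn: "(\<integral>\<^sup>+x. ennreal (exp (\<delta> * \<bar>x\<bar>)) \<partial>\<mu> n) \<le> ennreal (2 * B)" if "n \<ge> N" for n
  proof -
    have "(\<integral>\<^sup>+x. ennreal (exp (\<delta> * \<bar>x\<bar>)) \<partial>\<mu> n) \<le> (\<integral>\<^sup>+x. ennreal (exp (\<delta> * x)) + ennreal (exp (-\<delta> * x)) \<partial>\<mu> n)"
      by (intro nn_integral_mono) (auto simp: abs_if)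
    also have "\<dots> = (\<integral>\<^sup>+x. ennreal (exp (\<delta> * x)) \<partial>\<mu> n) + (\<integral>\<^sup>+x. ennreal (exp (-\<delta> * x)) \<partial>\<mu> n)"
      by (intro nn_integral_add) auto
    also have "\<dots> \<le> ennreal B + ennreal B"
      using N[OF that, of \<delta>] N[OF that, of "-\<delta>"] by (intro add_mono) auto
    also have "\<dots> = ennreal (2 * B)" by (simp add: B_def ennreal_plus[symmetric] del: ennreal_plus)
    finally show ?thesis .
  qed
  have int: "integrable (\<mu> n) (\<lambda>x. exp (\<delta> * \<bar>x\<bar>))" and int_le: "(\<integral>x. exp (\<delta> * \<bar>x\<bar>) \<partial>\<mu> n) \<le> 2 * B" if "n \<ge> N" for n
  proof -
    show i: "integrable (\<mu> n) (\<lambda>x. exp (\<delta> * \<bar>x\<bar>))"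
      using nn[OF that] by (intro integrableI_bounded) (auto intro: le_less_trans)
    have "ennreal (\<integral>x. exp (\<delta> * \<bar>x\<bar>) \<partial>\<mu> n) \<le> ennreal (2 * B)"
      using nn[OF that] by (subst nn_integral_eq_integral[OF i, symmetric]) auto
    moreover have "0 \<le> 2 * B" by (simp add: B_def)
    ultimately show "(\<integral>x. exp (\<delta> * \<bar>x\<bar>) \<partial>\<mu> n) \<le> 2 * B" by (simp add: ennreal_le_iff)
  qed
  define S where "S = {z. \<bar>Re z\<bar> < \<delta>}"
  \<comment> \<open>The shift by \<open>N\<close> makes the bound \<open>2 * B\<close> valid for
    every index, as Montel's theorem asks of the whole family.\<close>
  define F where "F n z = (\<integral>x. exp (z * complex_of_real x) \<partial>\<mu> (n + N))" for n z
  have hol: "F n holomorphic_on S" for n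
    unfolding F_def S_def by (rule holomorphic_on_complex_mgf[OF sets_mu int]) auto
  have bnd: "norm (F n z) \<le> 2 * B" and int_z: "integrable (\<mu> (n + N)) (\<lambda>x. exp (z * complex_of_real x))"
    if "z \<in> S" for n z
  proof -
    have *: "norm (exp (z * complex_of_real x)) \<le> exp (\<delta> * \<bar>x\<bar>)" for x
    proof -
      have "Re z * x \<le> \<bar>Re z\<bar> * \<bar>x\<bar>" by (metis abs_ge_self abs_mult)
      also have "\<dots> \<le> \<delta> * \<bar>x\<bar>" using that by (simp add: S_def mult_right_mono)
      finally show ?thesis by simp
    qed
    show i: "integrable (\<mu> (n + N)) (\<lambda>x. exp (z * complex_of_real x))"
      by (rule Bochner_Integration.integrable_bound[OF int[of "n+N"]]) (use * in auto)
    have "norm (F n z) \<le> (\<integral>x. exp (\<delta> * \<bar>x\<bar>) \<partial>\<mu> (n + N))"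
      unfolding F_def by (rule Bochner_Integration.integral_norm_bound_integral[OF i int]) (use * in auto)
    also have "\<dots> \<le> 2 * B" by (rule int_le) simp
    finally show "norm (F n z) \<le> 2 * B" .
  qed
  have S: "open S" "connected S"
  proof -
    have eq: "S = {z. Re z < \<delta>} \<inter> {z. - \<delta> < Re z}" by (auto simp: S_def)
    show "open S" unfolding eq by (intro open_Int open_halfspace_Re_lt open_halfspace_Re_gt)
    have "convex S" unfolding eq
      by (intro convex_Int convex_halfspace_Re_lt convex_halfspace_Re_gt)
    thus "connected S" by (rule convex_connected)
  qed
  have real_conv: "(\<lambda>n. F n (of_real t)) \<longlonglongrightarrow> exp ((of_real t)\<^sup>2 / 2)" if t: "\<bar>t\<bar> < \<delta>" for t
  proof -
    have tS: "complex_of_real t \<in> S" using t by (simp add: S_def)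
    have eq: "(\<integral>\<^sup>+x. ennreal (exp (t * x)) \<partial>\<mu> (n + N)) = ennreal (\<integral>x. exp (t * x) \<partial>\<mu> (n + N))"
      and F_eq: "F n (of_real t) = of_real (\<integral>x. exp (t * x) \<partial>\<mu> (n + N))" for n
    proof -
      have "(\<lambda>x. exp (complex_of_real t * complex_of_real x)) = (\<lambda>x. complex_of_real (exp (t * x)))"
        by (simp add: exp_of_real[symmetric])
      with int_z[OF tS, of n] have i: "integrable (\<mu> (n + N)) (\<lambda>x. exp (t * x))"
        by (simp only: complex_of_real_integrable_eq)
      show "(\<integral>\<^sup>+x. ennreal (exp (t * x)) \<partial>\<mu> (n + N)) = ennreal (\<integral>x. exp (t * x) \<partial>\<mu> (n + N))"
        by (rule nn_integral_eq_integral[OF i]) auto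
      show "F n (of_real t) = of_real (\<integral>x. exp (t * x) \<partial>\<mu> (n + N))"
        unfolding F_def by (simp add: exp_of_real flip: of_real_mult)
    qed
    have "(\<lambda>n. \<integral>\<^sup>+x. ennreal (exp (t * x)) \<partial>\<mu> (n + N)) \<longlonglongrightarrow> ennreal (exp (t\<^sup>2 / 2))"
      using mgf[of t] t \<delta> by (intro LIMSEQ_ignore_initial_segment) auto
    hence "(\<lambda>n. \<integral>x. exp (t * x) \<partial>\<mu> (n + N)) \<longlonglongrightarrow> exp (t\<^sup>2 / 2)"
      unfolding eq by (subst (asm) tendsto_ennreal_iff) auto
    hence "(\<lambda>n. F n (of_real t)) \<longlonglongrightarrow> of_real (exp (t\<^sup>2 / 2))"
      unfolding F_eq by (rule tendsto_of_real)
    thus ?thesis by (simp add: exp_of_real[symmetric])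
  qed
  have conv: "(\<lambda>n. F n (\<i> * of_real t0)) \<longlonglongrightarrow> exp ((\<i> * of_real t0)\<^sup>2 / 2)" (is "_ \<longlonglongrightarrow> ?L")
  proof (rule ccontr)
    assume "\<not> ?thesis"
    then obtain e where e: "e > 0" "\<not> (\<forall>\<^sub>F n in sequentially. dist (F n (\<i> * of_real t0)) ?L < e)"
      unfolding tendsto_iff by auto
    \<comment> \<open>Along these indices the transforms stay at distance \<open>e\<close> from the
      claimed limit. Montel extracts a convergent subsequence from them, so identifying its limit is
      a contradiction.\<close>
    hence "infinite {n. \<not> dist (F n (\<i> * of_real t0)) ?L < e}"
      by (simp add: not_eventually frequently_cofinite[symmetric] cofinite_eq_sequentially)
    then obtain r0 :: "nat \<Rightarrow> nat" where r0: "strict_mono r0" "\<And>n. r0 n \<in> {n. \<not> dist (F n (\<i> * of_real t0)) ?L < e}"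
      by (meson infinite_enumerate)
    obtain g r where gr: "g holomorphic_on S" "strict_mono r"
      "\<And>x. x \<in> S \<Longrightarrow> (\<lambda>n. F (r0 (r n)) x) \<longlonglongrightarrow> g x"
    proof (rule Montel[of S "range (\<lambda>n. F (r0 n))" "\<lambda>n. F (r0 n)"])
      show "\<exists>B. \<forall>h\<in>range (\<lambda>n. F (r0 n)). \<forall>z\<in>K. norm (h z) \<le> B" if "K \<subseteq> S" for K
        using bnd that by (intro exI[of _ "2 * B"]) auto
    qed (use S hol in auto)
    have g_real: "g (of_real t) = exp ((of_real t)\<^sup>2 / 2)" if t: "\<bar>t\<bar> < \<delta>" for t
    proof (rule LIMSEQ_unique)
      show "(\<lambda>n. F (r0 (r n)) (of_real t)) \<longlonglongrightarrow> g (of_real t)"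
        using t by (intro gr) (simp add: S_def)
      show "(\<lambda>n. F (r0 (r n)) (of_real t)) \<longlonglongrightarrow> exp ((of_real t)\<^sup>2 / 2)"
        using LIMSEQ_subseq_LIMSEQ[OF real_conv[OF t] strict_mono_o[OF r0(1) gr(2)]] by (simp add: o_def)
    qed
    \<comment> \<open>The real segment accumulates at 0, a point of the strip; this is what the
      identity theorem needs to carry the equality over to the imaginary axis.\<close>
    define U where "U = complex_of_real ` {-\<delta><..<\<delta>}"
    have "g (\<i> * of_real t0) - ?L = 0"
    proof (rule analytic_continuation[of "\<lambda>z. g z - exp (z\<^sup>2 / 2)" S U 0])
      show "(\<lambda>z. g z - exp (z\<^sup>2 / 2)) holomorphic_on S" using gr(1) by (intro holomorphic_intros) auto
      show "U \<subseteq> S" by (auto simp: U_def S_def)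
      show "0 \<in> S" using \<delta> by (simp add: S_def)
      show "0 islimpt U"
      proof -
        have "(0::real) islimpt {-\<delta><..<\<delta>}" using \<delta> by (intro open_imp_islimpt) auto
        hence "of_real 0 islimpt U" unfolding U_def
          by (intro islimpt_isCont_image) (auto simp: eventually_at_filter continuous_of_real)
        thus ?thesis by simp
      qed
      show "g z - exp (z\<^sup>2 / 2) = 0" if "z \<in> U" for z
        using that g_real by (auto simp: U_def)
      show "\<i> * of_real t0 \<in> S" using \<delta> by (simp add: S_def)
    qed (use S in auto)
    hence "(\<lambda>n. F (r0 (r n)) (\<i> * of_real t0)) \<longlonglongrightarrow> ?L"
      using gr(3)[of "\<i> * of_real t0"] \<delta> by (simp add: S_def)
    hence "\<forall>\<^sub>F n in sequentially. dist (F (r0 (r n)) (\<i> * of_real t0)) ?L < e"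
      using e by (auto simp: tendsto_iff)
    thus False using r0(2) by simp
  qed
  have "char (\<mu> (n + N)) t0 = F n (\<i> * of_real t0)" for n
    by (simp add: char_def F_def mult_ac)
  moreover have "char std_normal_distribution t0 = ?L"
    by (simp add: char_std_normal_distribution power_mult_distrib exp_of_real[symmetric])
  ultimately have "(\<lambda>n. char (\<mu> (n + N)) t0) \<longlonglongrightarrow> char std_normal_distribution t0"
    using conv by simp
  thus "(\<lambda>n. char (\<mu> n) t0) \<longlonglongrightarrow> char std_normal_distribution t0"
    by (rule LIMSEQ_offset)
qed

subsection \<open>Product laws from joint characteristic functions\<close>

text \<open>Normalising \<open>R\<close> to a probability density turns the hypothesis into an
  equality of characteristic functions of \<open>Y\<close> under the tilted law and of
  \<open>D\<close>, so Levy uniqueness applies.\<close>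

lemma (in prob_space) integral_weight_indicator_if_char:
  fixes Y R :: "'a \<Rightarrow> real" and D :: "real measure" and r :: complex
  assumes Y [measurable]: "random_variable borel Y"
    and R: "integrable M R" "\<And>\<omega>. 0 \<le> R \<omega>" and D: "real_distribution D"
    and char_eq: "\<And>t. (\<integral>\<omega>. R \<omega> * iexp (t * Y \<omega>) \<partial>M) = r * char D t"
    and B [measurable]: "B \<in> sets borel"
  shows "(\<integral>\<omega>. complex_of_real (R \<omega> * indicator B (Y \<omega>)) \<partial>M) = r * measure D B"
proof -
  interpret D: real_distribution D by fact
  have [measurable]: "R \<in> borel_measurable M" using R(1) by auto
  have r: "r = of_real (\<integral>\<omega>. R \<omega> \<partial>M)" using char_eq[of 0] by (simp add: D.char_zero)
  have iRB: "integrable M (\<lambda>\<omega>. R \<omega> * indicator B (Y \<omega>))"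
    by (rule Bochner_Integration.integrable_bound[OF R(1)]) (auto simp: indicator_def)
  show ?thesis
  \<comment> \<open>A weight of total mass 0 cannot be normalised; both sides are then 0.\<close>
  proof (cases "(\<integral>\<omega>. R \<omega> \<partial>M) = 0")
    case True
    hence ae: "AE \<omega> in M. R \<omega> = 0" using R by (simp add: integral_nonneg_eq_0_iff_AE)
    have "(\<integral>\<omega>. complex_of_real (R \<omega> * indicator B (Y \<omega>)) \<partial>M) = (\<integral>\<omega>. 0 \<partial>M)"
      by (rule integral_cong_AE) (use ae in auto)
    thus ?thesis using r True by simp
  next
    case False
    define c where "c = (\<integral>\<omega>. R \<omega> \<partial>M)"
    have c: "c > 0" using False R(2) Bochner_Integration.integral_nonneg[of M R] by (auto simp: c_def less_le)
    define N where "N = density M (\<lambda>\<omega>. ennreal (R \<omega> / c))"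
    have N: "prob_space N"
    proof
      have "emeasure N (space N) = (\<integral>\<^sup>+\<omega>. ennreal (R \<omega> / c) \<partial>M)"
        by (simp add: N_def emeasure_density)
      also have "\<dots> = ennreal (\<integral>\<omega>. R \<omega> / c \<partial>M)"
        using R c by (intro nn_integral_eq_integral) auto
      also have "\<dots> = 1" using c by (simp add: c_def[symmetric])
      finally show "emeasure N (space N) = 1" .
    qed
    have [measurable_cong]: "sets N = sets M" by (simp add: N_def)
    interpret N: prob_space N by (rule N)
    have "distr N borel Y = D"
    proof (rule Levy_uniqueness)
      show "real_distribution (distr N borel Y)" by (rule N.real_distribution_distr) measurable
      show "real_distribution D" by (rule D)
      show "char (distr N borel Y) = char D"
      proof
        fix t
        have "char (distr N borel Y) t = (\<integral>\<omega>. iexp (t * Y \<omega>) \<partial>N)"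
          by (simp add: char_def integral_distr)
        also have "\<dots> = (\<integral>\<omega>. (R \<omega> / c) *\<^sub>R iexp (t * Y \<omega>) \<partial>M)"
          unfolding N_def using c R(2) by (subst integral_density) auto
        also have "\<dots> = (\<integral>\<omega>. (R \<omega> * iexp (t * Y \<omega>)) / c \<partial>M)"
          by (simp add: scaleR_conv_of_real)
        also have "\<dots> = (\<integral>\<omega>. R \<omega> * iexp (t * Y \<omega>) \<partial>M) / c" by (rule integral_divide_zero)
        also have "\<dots> = char D t" using char_eq[of t] c by (simp add: r c_def[symmetric])
        finally show "char (distr N borel Y) t = char D t" .
      qed
    qed
    hence "measure D B = measure (distr N borel Y) B" by simp
    also have "\<dots> = (\<integral>x. indicator B x \<partial>distr N borel Y)" by simp
    also have "\<dots> = (\<integral>\<omega>. indicator B (Y \<omega>) \<partial>N)" by (rule integral_distr) auto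
    also have "\<dots> = (\<integral>\<omega>. (R \<omega> / c) *\<^sub>R indicator B (Y \<omega>) \<partial>M)"
      unfolding N_def using c R(2) by (subst integral_density) auto
    also have "\<dots> = (\<integral>\<omega>. R \<omega> * indicator B (Y \<omega>) \<partial>M) / c" by simp
    finally have "(\<integral>\<omega>. R \<omega> * indicator B (Y \<omega>) \<partial>M) = c * measure D B" using c by (simp add: field_simps)
    thus ?thesis unfolding r c_def[symmetric] integral_complex_of_real by (simp only: of_real_mult)
  qed
qed

text \<open>Levy uniqueness handles nonnegative weights only. The real and imaginary parts of
  \<open>W\<close> become nonnegative after adding the dominating weight \<open>U\<close>, whose
  transform is also a multiple of \<open>char D\<close>; the contribution of \<open>U\<close> is
  subtracted afterwards.\<close>

lemma (in prob_space) integral_complex_weight_indicator_if_char: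
  fixes Y U :: "'a \<Rightarrow> real" and W :: "'a \<Rightarrow> complex" and D :: "real measure" and u c :: complex
  assumes Y [measurable]: "random_variable borel Y"
    and U: "integrable M U" and W [measurable]: "W \<in> borel_measurable M" "\<And>\<omega>. norm (W \<omega>) \<le> U \<omega>"
    and D: "real_distribution D"
    and char_U: "\<And>t. (\<integral>\<omega>. U \<omega> * iexp (t * Y \<omega>) \<partial>M) = u * char D t"
    and char_W: "\<And>t. (\<integral>\<omega>. W \<omega> * iexp (t * Y \<omega>) \<partial>M) = c * char D t"
    and B [measurable]: "B \<in> sets borel"
  shows "(\<integral>\<omega>. W \<omega> * indicator B (Y \<omega>) \<partial>M) = c * measure D B"
proof -
  interpret D: real_distribution D by fact
  have [measurable]: "U \<in> borel_measurable M" using U by auto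
  have iW: "integrable M (\<lambda>\<omega>. W \<omega> * f \<omega>)"
    if [measurable]: "f \<in> borel_measurable M" and "\<And>\<omega>. norm (f \<omega>) \<le> 1" for f :: "'a \<Rightarrow> complex"
  proof (rule Bochner_Integration.integrable_bound[OF U])
    have "norm (W \<omega> * f \<omega>) \<le> norm (W \<omega>) * 1" for \<omega>
      unfolding norm_mult using that by (intro mult_left_mono) auto
    thus "AE \<omega> in M. norm (W \<omega> * f \<omega>) \<le> norm (U \<omega>)"
      using W(2) by (intro AE_I2) (smt (verit) real_norm_def)
  qed simp
  have iU: "integrable M (\<lambda>\<omega>. U \<omega> * f \<omega>)"
    if [measurable]: "f \<in> borel_measurable M" and "\<And>\<omega>. norm (f \<omega>) \<le> 1" for f :: "'a \<Rightarrow> complex"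
  proof (rule Bochner_Integration.integrable_bound[OF U])
    have "norm (U \<omega> * f \<omega>) \<le> \<bar>U \<omega>\<bar> * 1" for \<omega>
      unfolding norm_mult norm_of_real using that by (intro mult_left_mono) auto
    thus "AE \<omega> in M. norm (U \<omega> * f \<omega>) \<le> norm (U \<omega>)" by (intro AE_I2) auto
  qed simp
  \<comment> \<open>Conjugation reverses the sign of \<open>t\<close> twice, once in the exponential
    and once in \<open>char D\<close>. It is needed because the transforms of \<open>Re W\<close>
    and \<open>Im W\<close> are combinations of those of \<open>W\<close> and its conjugate.\<close>
  have cnj_W: "(\<integral>\<omega>. cnj (W \<omega>) * iexp (t * Y \<omega>) \<partial>M) = cnj c * char D t" for t
  proof -
    have "(\<integral>\<omega>. cnj (W \<omega>) * iexp (t * Y \<omega>) \<partial>M) = (\<integral>\<omega>. cnj (W \<omega> * iexp ((-t) * Y \<omega>)) \<partial>M)"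
      by (intro Bochner_Integration.integral_cong) (auto simp: exp_cnj)
    also have "\<dots> = cnj (c * char D (-t))" by (simp only: Bochner_Integration.integral_cnj char_W)
    also have "\<dots> = cnj c * cnj (char D (-t))" by simp
    also have "cnj (char D (-t)) = char D t"
      unfolding char_def Bochner_Integration.integral_cnj[symmetric] by (simp add: exp_cnj)
    finally show ?thesis by simp
  qed
  have part: "(\<integral>\<omega>. complex_of_real (V \<omega> * indicator B (Y \<omega>)) \<partial>M) = v * measure D B"
    if [measurable]: "V \<in> borel_measurable M" and V: "\<And>\<omega>. \<bar>V \<omega>\<bar> \<le> norm (W \<omega>)"
      and char_V: "\<And>t. (\<integral>\<omega>. V \<omega> * iexp (t * Y \<omega>) \<partial>M) = v * char D t" for V :: "'a \<Rightarrow> real" and v :: complex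
  proof -
    have VU: "\<bar>V \<omega>\<bar> \<le> U \<omega>" for \<omega> using V[of \<omega>] W(2)[of \<omega>] by linarith
    have iV: "integrable M (\<lambda>\<omega>. V \<omega> * f \<omega>)"
      if [measurable]: "f \<in> borel_measurable M" and "\<And>\<omega>. norm (f \<omega>) \<le> 1" for f :: "'a \<Rightarrow> complex"
    proof (rule Bochner_Integration.integrable_bound[OF U])
      have "norm (V \<omega> * f \<omega>) \<le> \<bar>V \<omega>\<bar> * 1" for \<omega>
        unfolding norm_mult norm_of_real using that by (intro mult_left_mono) auto
      thus "AE \<omega> in M. norm (V \<omega> * f \<omega>) \<le> norm (U \<omega>)"
        using VU by (intro AE_I2) (smt (verit) real_norm_def)
    qed simp
    have U0: "0 \<le> U \<omega>" for \<omega> using VU[of \<omega>] by linarith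
    have i: "integrable M V" by (rule Bochner_Integration.integrable_bound[OF U]) (use VU U0 in auto)
    have 1: "(\<integral>\<omega>. complex_of_real ((U \<omega> + V \<omega>) * indicator B (Y \<omega>)) \<partial>M) = (u + v) * measure D B"
    proof (rule integral_weight_indicator_if_char[OF Y _ _ D])
      show "(\<integral>\<omega>. (U \<omega> + V \<omega>) * iexp (t * Y \<omega>) \<partial>M) = (u + v) * char D t" for t
        unfolding distrib_right of_real_add char_U[symmetric] char_V[symmetric]
        by (rule Bochner_Integration.integral_add[OF iU iV]) auto
      show "0 \<le> U \<omega> + V \<omega>" for \<omega> using VU[of \<omega>] by linarith
    qed (use U i in auto)
    have 2: "(\<integral>\<omega>. complex_of_real (U \<omega> * indicator B (Y \<omega>)) \<partial>M) = u * measure D B"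
      by (rule integral_weight_indicator_if_char[OF Y _ _ D]) (use U U0 char_U in auto)
    have 3: "integrable M (\<lambda>\<omega>. complex_of_real (U \<omega> * indicator B (Y \<omega>)))"
      by (rule Bochner_Integration.integrable_bound[OF U]) (auto simp: indicator_def)
    have 4: "integrable M (\<lambda>\<omega>. complex_of_real ((U \<omega> + V \<omega>) * indicator B (Y \<omega>)))"
    proof (rule Bochner_Integration.integrable_bound[of _ "\<lambda>\<omega>. U \<omega> + V \<omega>"])
    qed (use U i in \<open>auto simp: indicator_def simp flip: of_real_add\<close>)
    have "(\<integral>\<omega>. complex_of_real (V \<omega> * indicator B (Y \<omega>)) \<partial>M) =
       (\<integral>\<omega>. complex_of_real ((U \<omega> + V \<omega>) * indicator B (Y \<omega>)) - complex_of_real (U \<omega> * indicator B (Y \<omega>)) \<partial>M)"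
      by (intro Bochner_Integration.integral_cong) (auto simp: algebra_simps)
    also have "\<dots> = (u + v) * measure D B - u * measure D B"
      by (subst Bochner_Integration.integral_diff[OF 4 3]) (simp only: 1 2)
    finally show ?thesis by (simp add: algebra_simps)
  qed
  have iWexp: "integrable M (\<lambda>\<omega>. W \<omega> * iexp (t * Y \<omega>))" for t by (rule iW) auto
  have [measurable]: "(\<lambda>\<omega>. cnj (W \<omega>)) \<in> borel_measurable M"
    by (rule measurable_compose[OF W(1)]) (intro borel_measurable_continuous_onI continuous_intros)
  have icWexp: "integrable M (\<lambda>\<omega>. cnj (W \<omega>) * iexp (t * Y \<omega>))" for t
  proof (rule Bochner_Integration.integrable_bound[OF iWexp[of t]])
  qed (auto simp: norm_mult)
  have re: "(\<integral>\<omega>. complex_of_real (Re (W \<omega>) * indicator B (Y \<omega>)) \<partial>M) = ((c + cnj c) / 2) * measure D B"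
  proof (rule part[of "\<lambda>\<omega>. Re (W \<omega>)"])
    show "(\<integral>\<omega>. Re (W \<omega>) * iexp (t * Y \<omega>) \<partial>M) = ((c + cnj c) / 2) * char D t" for t
    proof -
      have "(\<integral>\<omega>. Re (W \<omega>) * iexp (t * Y \<omega>) \<partial>M) = (\<integral>\<omega>. (W \<omega> * iexp (t * Y \<omega>) + cnj (W \<omega>) * iexp (t * Y \<omega>)) / 2 \<partial>M)"
        by (intro Bochner_Integration.integral_cong) (simp_all add: complex_add_cnj flip: distrib_right)
      also have "\<dots> = (c * char D t + cnj c * char D t) / 2"
        by (simp only: integral_divide_zero Bochner_Integration.integral_add[OF iWexp icWexp] char_W cnj_W)
      finally show ?thesis by (simp add: algebra_simps add_divide_distrib)
    qed
  qed (auto simp: abs_Re_le_cmod)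
  have im: "(\<integral>\<omega>. complex_of_real (Im (W \<omega>) * indicator B (Y \<omega>)) \<partial>M) = ((c - cnj c) / (2 * \<i>)) * measure D B"
  proof (rule part[of "\<lambda>\<omega>. Im (W \<omega>)"])
    show "(\<integral>\<omega>. Im (W \<omega>) * iexp (t * Y \<omega>) \<partial>M) = ((c - cnj c) / (2 * \<i>)) * char D t" for t
    proof -
      have "(\<integral>\<omega>. Im (W \<omega>) * iexp (t * Y \<omega>) \<partial>M) = (\<integral>\<omega>. (W \<omega> * iexp (t * Y \<omega>) - cnj (W \<omega>) * iexp (t * Y \<omega>)) / (2 * \<i>) \<partial>M)"
      proof (intro Bochner_Integration.integral_cong refl)
        fix \<omega>
        have "complex_of_real (Im (W \<omega>)) = (W \<omega> - cnj (W \<omega>)) / (2 * \<i>)" by (simp add: complex_diff_cnj complex_eq_iff)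
        thus "Im (W \<omega>) * iexp (t * Y \<omega>) = (W \<omega> * iexp (t * Y \<omega>) - cnj (W \<omega>) * iexp (t * Y \<omega>)) / (2 * \<i>)"
          by (simp only: left_diff_distrib times_divide_eq_left)
      qed
      also have "\<dots> = (c * char D t - cnj c * char D t) / (2 * \<i>)"
        by (simp only: integral_divide_zero Bochner_Integration.integral_diff[OF iWexp icWexp] char_W cnj_W)
      finally show ?thesis by (simp add: algebra_simps diff_divide_distrib)
    qed
  qed (auto simp: abs_Im_le_cmod)
  have iind: "integrable M (\<lambda>\<omega>. W \<omega> * indicator B (Y \<omega>))" by (rule iW) (auto simp: indicator_def)
  have "(\<integral>\<omega>. W \<omega> * indicator B (Y \<omega>) \<partial>M) = (\<integral>\<omega>. complex_of_real (Re (W \<omega>) * indicator B (Y \<omega>)) + \<i> * complex_of_real (Im (W \<omega>) * indicator B (Y \<omega>)) \<partial>M)"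
    by (intro Bochner_Integration.integral_cong) (auto simp: indicator_def complex_eq)
  also have "\<dots> = (\<integral>\<omega>. complex_of_real (Re (W \<omega>) * indicator B (Y \<omega>)) \<partial>M) + \<i> * (\<integral>\<omega>. complex_of_real (Im (W \<omega>) * indicator B (Y \<omega>)) \<partial>M)"
  proof (subst Bochner_Integration.integral_add)
    show "integrable M (\<lambda>\<omega>. complex_of_real (Re (W \<omega>) * indicator B (Y \<omega>)))"
      by (rule Bochner_Integration.integrable_bound[OF iind]) (auto simp: indicator_def abs_Re_le_cmod)
    have "integrable M (\<lambda>\<omega>. complex_of_real (Im (W \<omega>) * indicator B (Y \<omega>)))"
      by (rule Bochner_Integration.integrable_bound[OF iind]) (auto simp: indicator_def abs_Im_le_cmod)
    thus "integrable M (\<lambda>\<omega>. \<i> * complex_of_real (Im (W \<omega>) * indicator B (Y \<omega>)))" by simp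
  qed (simp_all only: integral_mult_right_zero)
  also have "\<dots> = c * measure D B" unfolding re im by (simp add: field_simps)
  finally show ?thesis .
qed

text \<open>The exponentials \<open>iexp (a i * X i)\<close> are replaced by indicators one coordinate at a time; each
  replacement is Levy uniqueness under a weighted law.\<close>
lemma (in prob_space) distr_eq_PiM_if_char_eq_prod:
  fixes X :: "'i \<Rightarrow> 'a \<Rightarrow> real" and D :: "'i \<Rightarrow> real measure"
  assumes I: "finite I" and X: "\<And>i. i \<in> I \<Longrightarrow> random_variable borel (X i)"
    and D: "\<And>i. real_distribution (D i)"
    and char_eq: "\<And>a. (\<integral>\<omega>. iexp (\<Sum>i\<in>I. a i * X i \<omega>) \<partial>M) = (\<Prod>i\<in>I. char (D i) (a i))"
  shows "distr M (Pi\<^sub>M I D) (\<lambda>\<omega>. \<lambda>i\<in>I. X i \<omega>) = Pi\<^sub>M I D"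
proof -
  interpret D: real_distribution "D i" for i by (rule D)
  \<comment> \<open>\<open>J\<close> collects the coordinates already replaced by indicators. The
    coefficients \<open>a\<close> stay free, because replacing coordinate \<open>k\<close> uses the
    statement for all values of \<open>a k\<close>.\<close>
  have partial: "(\<integral>\<omega>. (\<Prod>i\<in>J. indicator (B i) (X i \<omega>)) * iexp (\<Sum>i\<in>I-J. a i * X i \<omega>) \<partial>M)
      = complex_of_real (\<Prod>i\<in>J. measure (D i) (B i)) * (\<Prod>i\<in>I-J. char (D i) (a i))"
    if "J \<subseteq> I" "\<And>i. B i \<in> sets borel" for J B a
    using finite_subset[OF that(1) I] that
  proof (induction J arbitrary: a rule: finite_induct)
    case empty
    show ?case using char_eq by simp
  next
    case (insert k J)
    have k: "k \<in> I" "J \<subseteq> I" "k \<notin> J" using insert by auto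
    have IJ: "I - J = insert k (I - insert k J)" using k by auto
    have [measurable]: "random_variable borel (X i)" if "i \<in> I" for i using X that .
    note [measurable] = insert.prems(2)
    have [measurable]: "random_variable borel (X k)" using X k by auto
    have XJ: "\<And>i. i \<in> J \<Longrightarrow> random_variable borel (X i)" using X k by auto
    define U where "U \<omega> = (\<Prod>i\<in>J. indicat_real (B i) (X i \<omega>))" for \<omega>
    define S where "S \<omega> = (\<Sum>i\<in>I - insert k J. a i * X i \<omega>)" for \<omega>
    have [measurable]: "S \<in> borel_measurable M"
      unfolding S_def by (intro borel_measurable_sum) auto
    have [measurable]: "U \<in> borel_measurable M"
      unfolding U_def by (intro borel_measurable_prod measurable_compose[OF XJ] borel_measurable_indicator insert.prems) auto
    have U01: "0 \<le> U \<omega>" "U \<omega> \<le> 1" for \<omega> by (auto simp: U_def intro!: prod_nonneg prod_le_1)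
    have ofU: "complex_of_real (U \<omega>) = (\<Prod>i\<in>J. indicator (B i) (X i \<omega>))" for \<omega>
      by (simp add: U_def indicator_def of_bool_def if_distrib cong: if_cong)
    have *: "(\<integral>\<omega>. U \<omega> * iexp (t * X k \<omega> + (\<Sum>i\<in>I - insert k J. b i * X i \<omega>)) \<partial>M)
        = of_real (\<Prod>i\<in>J. measure (D i) (B i)) * (char (D k) t * (\<Prod>i\<in>I-insert k J. char (D i) (b i)))" for t b
    proof -
      have 1: "(\<Sum>i\<in>I - J. (b(k := t)) i * X i \<omega>) = t * X k \<omega> + (\<Sum>i\<in>I - insert k J. b i * X i \<omega>)" for \<omega>
        unfolding IJ using I by (subst sum.insert) (auto intro!: sum.cong)
      have 2: "(\<Prod>i\<in>I - J. char (D i) ((b(k := t)) i)) = char (D k) t * (\<Prod>i\<in>I-insert k J. char (D i) (b i))"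
        unfolding IJ using I by (subst prod.insert) (auto intro!: prod.cong)
      show ?thesis using insert.IH[OF k(2) insert.prems(2), of "b(k := t)"] unfolding ofU 1 2 .
    qed
    \<comment> \<open>The weight is now complex, with \<open>U\<close> as its majorant. The two
      transforms required are the instances of \<open>*\<close> with the remaining coefficients set
      to 0 and to \<open>a\<close>.\<close>
    have "(\<integral>\<omega>. (U \<omega> * iexp (S \<omega>)) * indicator (B k) (X k \<omega>) \<partial>M)
       = (of_real (\<Prod>i\<in>J. measure (D i) (B i)) * (\<Prod>i\<in>I-insert k J. char (D i) (a i))) * measure (D k) (B k)"
    proof (rule integral_complex_weight_indicator_if_char[where U = U])
      show "integrable M U"
        by (rule integrable_const_bound[of _ 1]) (use U01 in auto)
      show "(\<integral>\<omega>. U \<omega> * iexp (t * X k \<omega>) \<partial>M) = of_real (\<Prod>i\<in>J. measure (D i) (B i)) * char (D k) t" for t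
        using *[of t "\<lambda>_. 0"] by (simp add: D.char_zero)
      show "(\<integral>\<omega>. (U \<omega> * iexp (S \<omega>)) * iexp (t * X k \<omega>) \<partial>M)
         = (of_real (\<Prod>i\<in>J. measure (D i) (B i)) * (\<Prod>i\<in>I-insert k J. char (D i) (a i))) * char (D k) t" for t
        using *[of t a] by (simp add: S_def exp_add algebra_simps)
    qed (use U01 in \<open>auto simp: norm_mult D\<close>)
    thus ?case using k insert.hyps
      by (simp add: ofU S_def mult_ac)
  qed
  interpret PD: product_prob_space D I ..
  show ?thesis
  proof (rule PD.PiM_eqI[OF I])
    fix A assume A: "\<And>i. i \<in> I \<Longrightarrow> A i \<in> sets (D i)"
    define B where "B i = (if i \<in> I then A i else {})" for i
    have B: "B i \<in> sets borel" for i using A by (auto simp: B_def)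
    have [measurable]: "(\<lambda>\<omega>. \<lambda>i\<in>I. X i \<omega>) \<in> measurable M (Pi\<^sub>M I D)"
      using X by (intro measurable_restrict) auto
    have PA: "Pi\<^sub>E I A \<in> sets (Pi\<^sub>M I D)" using A I by (intro sets_PiM_I_finite) auto
    have set: "(\<lambda>\<omega>. \<lambda>i\<in>I. X i \<omega>) -` Pi\<^sub>E I A \<inter> space M = {\<omega>\<in>space M. \<forall>i\<in>I. X i \<omega> \<in> B i}"
      by (auto simp: B_def PiE_iff)
    have E: "{\<omega>\<in>space M. \<forall>i\<in>I. X i \<omega> \<in> B i} \<in> events"
      using measurable_sets[OF \<open>(\<lambda>\<omega>. \<lambda>i\<in>I. X i \<omega>) \<in> measurable M (Pi\<^sub>M I D)\<close> PA] unfolding set .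
    have "complex_of_real (prob {\<omega>\<in>space M. \<forall>i\<in>I. X i \<omega> \<in> B i}) =
       complex_of_real (\<integral>\<omega>. indicator {\<omega>\<in>space M. \<forall>i\<in>I. X i \<omega> \<in> B i} \<omega> \<partial>M)"
      using E by simp
    also have "\<dots> = (\<integral>\<omega>. complex_of_real (indicator {\<omega>\<in>space M. \<forall>i\<in>I. X i \<omega> \<in> B i} \<omega>) \<partial>M)"
      by (rule integral_complex_of_real[symmetric])
    also have "\<dots> = (\<integral>\<omega>. (\<Prod>i\<in>I. indicator (B i) (X i \<omega>)) * iexp (\<Sum>i\<in>I-I. 0 * X i \<omega>) \<partial>M)"
    proof (intro Bochner_Integration.integral_cong refl)
      fix \<omega> assume "\<omega> \<in> space M"
      thus "complex_of_real (indicator {\<omega>\<in>space M. \<forall>i\<in>I. X i \<omega> \<in> B i} \<omega>) = (\<Prod>i\<in>I. indicator (B i) (X i \<omega>)) * iexp (\<Sum>i\<in>I-I. 0 * X i \<omega>)"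
        using I by (auto simp: indicator_def)
    qed
    also have "\<dots> = complex_of_real (\<Prod>i\<in>I. measure (D i) (B i))"
      using partial[OF subset_refl B] by simp
    finally have pr: "prob {\<omega>\<in>space M. \<forall>i\<in>I. X i \<omega> \<in> B i} = (\<Prod>i\<in>I. measure (D i) (B i))"
      by (simp only: of_real_eq_iff)
    have "emeasure (distr M (Pi\<^sub>M I D) (\<lambda>\<omega>. \<lambda>i\<in>I. X i \<omega>)) (Pi\<^sub>E I A) = emeasure M {\<omega>\<in>space M. \<forall>i\<in>I. X i \<omega> \<in> B i}"
      using PA by (subst emeasure_distr) (auto simp: set)
    also have "\<dots> = ennreal (\<Prod>i\<in>I. measure (D i) (B i))" by (simp add: emeasure_eq_measure pr)
    also have "\<dots> = (\<Prod>i\<in>I. emeasure (D i) (A i))"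
      by (subst prod_ennreal[symmetric]) (auto simp: B_def D.emeasure_eq_measure intro!: prod.cong)
    finally show "emeasure (distr M (Pi\<^sub>M I D) (\<lambda>\<omega>. \<lambda>i\<in>I. X i \<omega>)) (Pi\<^sub>E I A) = (\<Prod>i\<in>I. emeasure (D i) (A i))" .
  qed simp
qed

subsection \<open>Moments from Laplace transforms of Gamma type\<close>

lemma Gamma_scaled_nn_integral:
  fixes r x :: real
  assumes "r > 0" "x > 0"
  shows "(\<integral>\<^sup>+t. ennreal (indicator {0<..} t * t powr (r - 1) * exp (- t * x)) \<partial>lborel) = ennreal (Gamma r * x powr (-r))"
proof -
  have "ennreal (Gamma r) = (\<integral>\<^sup>+t. ennreal (indicator {0..} t * t powr (r - 1) / exp t) \<partial>lborel)"
    using Gamma_conv_nn_integral_real[OF assms(1)] by simp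
  also have "\<dots> = ennreal \<bar>x\<bar> * (\<integral>\<^sup>+t. ennreal (indicator {0..} (0 + x * t) * (0 + x * t) powr (r - 1) / exp (0 + x * t)) \<partial>lborel)"
    using assms by (intro nn_integral_real_affine) auto
  also have "(\<integral>\<^sup>+t. ennreal (indicator {0..} (0 + x * t) * (0 + x * t) powr (r - 1) / exp (0 + x * t)) \<partial>lborel)
     = (\<integral>\<^sup>+t. ennreal (x powr (r - 1)) * ennreal (indicator {0<..} t * t powr (r - 1) * exp (- t * x)) \<partial>lborel)"
  proof (intro nn_integral_cong)
    fix t :: real
    show "ennreal (indicator {0..} (0 + x * t) * (0 + x * t) powr (r - 1) / exp (0 + x * t)) = 
      ennreal (x powr (r - 1)) * ennreal (indicator {0<..} t * t powr (r - 1) * exp (- t * x))"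
      using assms by (cases "t > 0"; cases "t = 0")
       (auto simp: indicator_def powr_mult ennreal_mult'[symmetric] exp_minus field_simps zero_le_mult_iff)
  qed
  also have "ennreal \<bar>x\<bar> * \<dots> = ennreal (x powr r) * (\<integral>\<^sup>+t. ennreal (indicator {0<..} t * t powr (r - 1) * exp (- t * x)) \<partial>lborel)"
    using assms by (subst nn_integral_cmult) (auto simp: mult.assoc[symmetric] ennreal_mult'[symmetric] powr_mult_base)
  finally have *: "ennreal (Gamma r) = ennreal (x powr r) * (\<integral>\<^sup>+t. ennreal (indicator {0<..} t * t powr (r - 1) * exp (- t * x)) \<partial>lborel)" .
  have "ennreal (Gamma r * x powr (-r)) = ennreal (x powr (-r)) * ennreal (Gamma r)"
    by (subst ennreal_mult'[symmetric]) (auto simp: mult_ac)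
  also have "\<dots> = (ennreal (x powr (-r)) * ennreal (x powr r)) * (\<integral>\<^sup>+t. ennreal (indicator {0<..} t * t powr (r - 1) * exp (- t * x)) \<partial>lborel)"
    unfolding * by (simp add: mult.assoc)
  also have "ennreal (x powr (-r)) * ennreal (x powr r) = 1"
    using assms by (subst ennreal_mult'[symmetric]) (auto simp: powr_minus field_simps)
  finally show ?thesis by simp
qed

text \<open>Negative powers: the Gamma integral turns \<open>X powr (-r)\<close> into a mixture of the \<open>exp (- t * X)\<close>.\<close>
lemma nn_integral_powr_minus_Laplace:
  fixes X :: "'a \<Rightarrow> real" and r :: real
  assumes "sigma_finite_measure N" and X [measurable]: "X \<in> borel_measurable N"
    and pos: "AE x in N. 0 < X x" and r: "r > 0"
  shows "ennreal (Gamma r) * (\<integral>\<^sup>+x. ennreal (X x powr (-r)) \<partial>N)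
    = (\<integral>\<^sup>+t. ennreal (indicator {0<..} t * t powr (r - 1)) * (\<integral>\<^sup>+x. ennreal (exp (- t * X x)) \<partial>N) \<partial>lborel)"
proof -
  interpret N: sigma_finite_measure N by fact
  interpret pair_sigma_finite lborel N ..
  have "ennreal (Gamma r) * (\<integral>\<^sup>+x. ennreal (X x powr (-r)) \<partial>N) = (\<integral>\<^sup>+x. ennreal (Gamma r * X x powr (-r)) \<partial>N)"
    using r by (subst nn_integral_cmult[symmetric]) (auto simp: ennreal_mult' Gamma_real_nonneg)
  also have "\<dots> = (\<integral>\<^sup>+x. \<integral>\<^sup>+t. ennreal (indicator {0<..} t * t powr (r - 1) * exp (- t * X x)) \<partial>lborel \<partial>N)"
  proof (intro nn_integral_cong_AE)
    show "AE x in N. ennreal (Gamma r * X x powr - r) =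
       (\<integral>\<^sup>+t. ennreal (indicator {0<..} t * t powr (r - 1) * exp (- t * X x)) \<partial>lborel)"
      using pos by eventually_elim (simp only: Gamma_scaled_nn_integral[OF r])
  qed
  also have "\<dots> = (\<integral>\<^sup>+t. \<integral>\<^sup>+x. ennreal (indicator {0<..} t * t powr (r - 1) * exp (- t * X x)) \<partial>N \<partial>lborel)"
    by (rule Fubini') simp
  also have "\<dots> = (\<integral>\<^sup>+t. ennreal (indicator {0<..} t * t powr (r - 1)) * (\<integral>\<^sup>+x. ennreal (exp (- t * X x)) \<partial>N) \<partial>lborel)"
    by (intro nn_integral_cong) (auto simp: ennreal_mult' nn_integral_cmult)
  finally show ?thesis .
qed

text \<open>The integrand \<open>exp (- t * X)\<close> is 1 on the zero set of \<open>X\<close>, so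
  the mass of that set lies below the transform at every \<open>t\<close>, which tends to 0. Without
  this, the convention \<open>0 powr s = 0\<close> would silently drop an atom at 0 from the
  negative moments.\<close>

lemma AE_pos_if_Laplace:
  fixes X :: "'a \<Rightarrow> real" and a C :: real
  assumes X [measurable]: "X \<in> borel_measurable N" and X0: "\<And>x. 0 \<le> X x" and a: "a > 0"
    and lap: "\<And>t. t \<ge> 0 \<Longrightarrow> (\<integral>\<^sup>+x. ennreal (exp (- t * X x)) \<partial>N) = ennreal (C * (1 + t) powr (-a))"
  shows "AE x in N. 0 < X x"
proof -
  define E where "E = {x\<in>space N. X x = 0}"
  have [measurable]: "E \<in> sets N" unfolding E_def by measurable
  have le: "emeasure N E \<le> ennreal (C * (1 + real n) powr (-a))" for n
  proof -
    have "emeasure N E = (\<integral>\<^sup>+x. indicator E x \<partial>N)" by simp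
    also have "\<dots> \<le> (\<integral>\<^sup>+x. ennreal (exp (- real n * X x)) \<partial>N)"
      by (intro nn_integral_mono) (auto simp: E_def indicator_def)
    finally show ?thesis using lap[of "real n"] by simp
  qed
  have "(\<lambda>n. C * (1 + real n) powr (-a)) \<longlonglongrightarrow> C * 0"
    using a by (intro tendsto_mult tendsto_const tendsto_neg_powr)
       (auto intro!: filterlim_tendsto_add_at_top filterlim_real_sequentially)
  hence "(\<lambda>n. ennreal (C * (1 + real n) powr (-a))) \<longlonglongrightarrow> ennreal 0" by (intro tendsto_ennrealI) simp
  hence "emeasure N E \<le> ennreal 0" by (rule LIMSEQ_le_const) (use le in auto)
  hence "E \<in> null_sets N" by (auto simp: null_sets_def)
  hence "AE x in N. x \<notin> E" by (rule AE_not_in)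
  thus ?thesis
    using AE_space by eventually_elim (use X0 in \<open>auto simp: E_def less_le\<close>)
qed

text \<open>Weighting by \<open>X\<close> yields a transform of Gamma type again, with
  \<open>a + 1\<close> for \<open>a\<close>; this drives the induction on the exponent. The
  derivative passes under the integral by Fatou in one direction and, in the other, because by
  convexity every difference quotient of the exponential lies below its limit.\<close>

lemma Laplace_size_biased:
  fixes X :: "'a \<Rightarrow> real" and a C t :: real
  assumes X [measurable]: "X \<in> borel_measurable N" and X0: "\<And>x. 0 \<le> X x" and a: "a > 0" and C: "C \<ge> 0"
    and lap: "\<And>t. t \<ge> 0 \<Longrightarrow> (\<integral>\<^sup>+x. ennreal (exp (- t * X x)) \<partial>N) = ennreal (C * (1 + t) powr (-a))"
    and t: "t \<ge> 0"
  shows "(\<integral>\<^sup>+x. ennreal (X x * exp (- t * X x)) \<partial>N) = ennreal (C * a * (1 + t) powr (-(a + 1)))"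
proof (rule antisym)
  \<comment> \<open>Positive increments only, since at \<open>t = 0\<close> the transform is known
    on one side.\<close>
  define h where "h n = inverse (real (Suc n))" for n
  have h: "h n > 0" for n by (simp add: h_def)
  have h0: "h \<longlonglongrightarrow> 0" unfolding h_def by (rule LIMSEQ_inverse_real_of_nat)
  have hlim: "filterlim h (at 0) sequentially"
    using h0 h by (intro filterlim_atI) (auto intro!: always_eventually simp: less_imp_neq[OF h, symmetric])
  define L where "L t = C * (1 + t) powr (-a)" for t
  have L0: "L t \<ge> 0" for t using C by (simp add: L_def)
  have L': "(L has_real_derivative (- C * a * (1 + t) powr (-(a+1)))) (at t)"
    unfolding L_def using t by (auto intro!: derivative_eq_intros simp: minus_diff_commute)
  have lim: "(\<lambda>n. (L t - L (t + h n)) / h n) \<longlonglongrightarrow> C * a * (1 + t) powr (-(a+1))"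
  proof -
    have "(\<lambda>n. (L (t + h n) - L t) / h n) \<longlonglongrightarrow> - C * a * (1 + t) powr (-(a+1))"
      using L' unfolding DERIV_def by (rule filterlim_compose[OF _ hlim])
    from tendsto_minus[OF this] show ?thesis by (simp add: minus_divide_left)
  qed
  have diff: "(\<integral>\<^sup>+x. ennreal ((exp (- t * X x) - exp (- (t + h n) * X x)) / h n) \<partial>N) = ennreal ((L t - L (t + h n)) / h n)" for n
  proof -
    have le: "exp (- (t + h n) * X x) \<le> exp (- t * X x)" for x
      using h[of n] X0[of x] by (simp add: algebra_simps)
    have "(\<integral>\<^sup>+x. ennreal ((exp (- t * X x) - exp (- (t + h n) * X x)) / h n) \<partial>N)
       = (\<integral>\<^sup>+x. ennreal (1 / h n) * (ennreal (exp (- t * X x)) - ennreal (exp (- (t + h n) * X x))) \<partial>N)"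
      using h[of n] le by (intro nn_integral_cong) (auto simp: ennreal_minus ennreal_mult'[symmetric])
    also have "\<dots> = ennreal (1 / h n) * ((\<integral>\<^sup>+x. ennreal (exp (- t * X x)) \<partial>N) - (\<integral>\<^sup>+x. ennreal (exp (- (t + h n) * X x)) \<partial>N))"
      using lap[of "t + h n"] h[of n] t le
      by (subst nn_integral_cmult; (subst nn_integral_diff)?) auto
    also have "\<dots> = ennreal ((L t - L (t + h n)) / h n)"
      using h[of n] t L0 by (subst (1 2) lap) (auto simp: L_def[symmetric] ennreal_minus ennreal_mult'[symmetric])
    finally show ?thesis .
  qed
  have ptlim: "(\<lambda>n. (exp (- t * y) - exp (- (t + h n) * y)) / h n) \<longlonglongrightarrow> y * exp (- t * y)" for y
  proof -
    have "((\<lambda>u. exp (- u * y)) has_real_derivative (- y * exp (- t * y))) (at t)"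
      by (auto intro!: derivative_eq_intros)
    hence "(\<lambda>n. (exp (- (t + h n) * y) - exp (- t * y)) / h n) \<longlonglongrightarrow> - y * exp (- t * y)"
      unfolding DERIV_def by (rule filterlim_compose[OF _ hlim])
    from tendsto_minus[OF this] show ?thesis by (simp add: minus_divide_left)
  qed
  have "(\<integral>\<^sup>+x. ennreal (X x * exp (- t * X x)) \<partial>N)
     = (\<integral>\<^sup>+x. liminf (\<lambda>n. ennreal ((exp (- t * X x) - exp (- (t + h n) * X x)) / h n)) \<partial>N)"
    by (intro nn_integral_cong lim_imp_Liminf[symmetric] tendsto_ennrealI ptlim) auto
  also have "\<dots> \<le> liminf (\<lambda>n. \<integral>\<^sup>+x. ennreal ((exp (- t * X x) - exp (- (t + h n) * X x)) / h n) \<partial>N)"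
    by (rule nn_integral_liminf) auto
  also have "\<dots> = ennreal (C * a * (1 + t) powr (-(a + 1)))"
    unfolding diff by (intro lim_imp_Liminf tendsto_ennrealI lim) auto
  finally show "(\<integral>\<^sup>+x. ennreal (X x * exp (- t * X x)) \<partial>N) \<le> ennreal (C * a * (1 + t) powr (-(a + 1)))" .
  show "ennreal (C * a * (1 + t) powr (-(a + 1))) \<le> (\<integral>\<^sup>+x. ennreal (X x * exp (- t * X x)) \<partial>N)"
  proof (rule LIMSEQ_le_const2[OF tendsto_ennrealI[OF lim]], intro exI[of _ 0] allI impI)
    fix n
    have "(exp (- t * X x) - exp (- (t + h n) * X x)) / h n \<le> X x * exp (- t * X x)" for x
    proof -
      have "exp (- t * X x) - exp (- (t + h n) * X x) = exp (- t * X x) * (1 - exp (- h n * X x))"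
        by (simp add: algebra_simps flip: exp_add)
      also have "\<dots> \<le> exp (- t * X x) * (h n * X x)"
        using exp_ge_add_one_self[of "- h n * X x"] by (intro mult_left_mono) auto
      finally show ?thesis using h[of n] by (simp add: field_simps)
    qed
    thus "ennreal ((L t - L (t + h n)) / h n) \<le> (\<integral>\<^sup>+x. ennreal (X x * exp (- t * X x)) \<partial>N)"
      unfolding diff[symmetric] by (intro nn_integral_mono ennreal_leI)
  qed
qed

text \<open>A reference measure with the same transform up to a factor. Negative moments depend on
  the transform alone, so they can be read off from this measure instead of evaluating a Beta
  integral. Replacing \<open>x\<close> by 1 off the positive axis, where the density vanishes, gives
  a variable that is positive everywhere.\<close>

lemma Gamma_measure_Laplace:
  assumes "a > (0::real)" "t \<ge> 0"
  shows "(\<integral>\<^sup>+x. ennreal (exp (- t * (if 0 < x then x else 1))) \<partial>density lborel (\<lambda>x. ennreal (indicator {0<..} x * x powr (a - 1) * exp (- x))))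
    = ennreal (Gamma a * (1 + t) powr (-a))"
proof -
  have "(\<integral>\<^sup>+x. ennreal (exp (- t * (if 0 < x then x else 1))) \<partial>density lborel (\<lambda>x. ennreal (indicator {0<..} x * x powr (a - 1) * exp (- x))))
     = (\<integral>\<^sup>+x. ennreal (indicator {0<..} x * x powr (a - 1) * exp (- x * (1 + t))) \<partial>lborel)"
    by (subst nn_integral_density)
       (auto intro!: nn_integral_cong simp: indicator_def ennreal_mult'[symmetric] algebra_simps simp flip: exp_add)
  also have "\<dots> = ennreal (Gamma a * (1 + t) powr (-a))"
    using assms by (intro Gamma_scaled_nn_integral) auto
  finally show ?thesis .
qed

text \<open>Negative exponents follow by comparison with the reference Gamma measure, and
  size-biasing lowers any other exponent by 1 until it is negative. The constant \<open>C\<close>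
  makes the statement stable under size-biasing and applicable to tilted laws of arbitrary
  mass.\<close>

lemma nn_integral_powr_if_Laplace:
  fixes X :: "'a \<Rightarrow> real" and a C s :: real
  assumes X: "X \<in> borel_measurable N" and X0: "\<And>x. 0 \<le> X x"
    and a: "a > 0" and C: "C \<ge> 0" and as: "a + s > 0"
    and lap: "\<And>t. t \<ge> 0 \<Longrightarrow> (\<integral>\<^sup>+x. ennreal (exp (- t * X x)) \<partial>N) = ennreal (C * (1 + t) powr (-a))"
  shows "(\<integral>\<^sup>+x. ennreal (X x powr s) \<partial>N) = ennreal (C * Gamma (a + s) / Gamma a)"
proof -
  obtain k :: nat where "s < real k" using reals_Archimedean2 by blast
  thus ?thesis using assms
  proof (induction k arbitrary: s a C N)
    case 0
    note X [measurable] = "0.prems"(2)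
    define r where "r = -s"
    have r: "r > 0" "a - r > 0" using "0.prems" by (auto simp: r_def)
    have pos: "AE x in N. 0 < X x" by (rule AE_pos_if_Laplace) (use "0.prems" in auto)
    have "finite_measure N"
      using "0.prems"(7)[of 0] by (intro finite_measureI) auto
    then interpret N: finite_measure N .
    have sf: "sigma_finite_measure N" ..
    define G where "G = density lborel (\<lambda>x::real. ennreal (indicator {0<..} x * x powr (a - 1) * exp (- x)))"
    define Y where "Y x = (if 0 < x then x else 1 :: real)" for x
    have [measurable_cong]: "sets G = sets borel" by (simp add: G_def)
    have [measurable]: "Y \<in> borel_measurable borel" unfolding Y_def by measurable
    have YG: "Y \<in> borel_measurable G" by measurable
    have lapG: "(\<integral>\<^sup>+x. ennreal (exp (- t * Y x)) \<partial>G) = ennreal (Gamma a * (1 + t) powr (-a))" if "t \<ge> 0" for t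
      unfolding G_def Y_def using "0.prems" that by (intro Gamma_measure_Laplace) auto
    have "finite_measure G"
      using lapG[of 0] by (intro finite_measureI) auto
    then interpret G: finite_measure G .
    have sfG: "sigma_finite_measure G" ..
    have G0: "Gamma a > 0" "Gamma r > 0" using "0.prems" r by (auto intro: Gamma_real_pos)
    have eq: "(\<integral>\<^sup>+t. ennreal (indicator {0<..} t * t powr (r - 1)) * (\<integral>\<^sup>+x. ennreal (exp (- t * X x)) \<partial>N) \<partial>lborel)
      = (\<integral>\<^sup>+t. ennreal (C / Gamma a) * (ennreal (indicator {0<..} t * t powr (r - 1)) * (\<integral>\<^sup>+x. ennreal (exp (- t * Y x)) \<partial>G)) \<partial>lborel)"
    proof (intro nn_integral_cong)
      fix t :: real
      show "ennreal (indicator {0<..} t * t powr (r - 1)) * (\<integral>\<^sup>+x. ennreal (exp (- t * X x)) \<partial>N) =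
        ennreal (C / Gamma a) * (ennreal (indicator {0<..} t * t powr (r - 1)) * (\<integral>\<^sup>+x. ennreal (exp (- t * Y x)) \<partial>G))"
      proof (cases "t > 0")
        case True
        thus ?thesis using lapG[of t] "0.prems"(7)[of t] "0.prems"(5) G0
          by (simp add: ennreal_mult'[symmetric] mult_ac)
      qed auto
    qed
    have "(\<integral>\<^sup>+x. ennreal (Y x powr (-r)) \<partial>G) = (\<integral>\<^sup>+x. ennreal (indicator {0<..} x * x powr ((a - r) - 1) * exp (- x * 1)) \<partial>lborel)"
      unfolding G_def by (subst nn_integral_density)
       (auto intro!: nn_integral_cong simp: Y_def indicator_def ennreal_mult'[symmetric] algebra_simps simp flip: powr_add)
    also have "\<dots> = ennreal (Gamma (a - r))"
      using r by (subst Gamma_scaled_nn_integral) auto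
    finally have momG: "(\<integral>\<^sup>+x. ennreal (Y x powr (-r)) \<partial>G) = ennreal (Gamma (a - r))" .
    have "ennreal (Gamma r) * (\<integral>\<^sup>+x. ennreal (X x powr (-r)) \<partial>N)
       = ennreal (C / Gamma a) * (\<integral>\<^sup>+t. ennreal (indicator {0<..} t * t powr (r - 1)) * (\<integral>\<^sup>+x. ennreal (exp (- t * Y x)) \<partial>G) \<partial>lborel)"
      unfolding nn_integral_powr_minus_Laplace[OF sf X pos r(1)] eq
      by (rule nn_integral_cmult) measurable
    also have "\<dots> = ennreal (C / Gamma a) * (ennreal (Gamma r) * ennreal (Gamma (a - r)))"
      unfolding momG[symmetric] nn_integral_powr_minus_Laplace[OF sfG YG _ r(1)]
      by (subst nn_integral_powr_minus_Laplace[OF sfG YG _ r(1)]) (auto simp: Y_def)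
    also have "\<dots> = ennreal (Gamma r) * ennreal (C * Gamma (a + s) / Gamma a)"
      using G0 "0.prems"(5) r by (simp add: r_def mult_ac flip: ennreal_mult' ennreal_mult'')
    finally show ?case using G0 by (subst (asm) ennreal_mult_cancel_left) (auto simp: r_def)
  next
    case (Suc k)
    note X [measurable] = Suc.prems(2)
    show ?case
    proof (cases "s < real k")
      case True
      show ?thesis by (rule Suc.IH[OF True Suc.prems(2-)])
    next
      case False
      \<comment> \<open>Size-biasing turns \<open>s\<close> into \<open>s - 1\<close> and
        \<open>a\<close> into \<open>a + 1\<close>, so the sum \<open>a + s\<close> is unchanged,
        and \<open>Gamma (a + 1) = a * Gamma a\<close> cancels the new factor
        \<open>a\<close>.\<close>
      define N' where "N' = density N (\<lambda>x. ennreal (X x))"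
      have [measurable_cong]: "sets N' = sets N" by (simp add: N'_def)
      have "(\<integral>\<^sup>+x. ennreal (X x powr (s - 1)) \<partial>N') = ennreal ((C * a) * Gamma ((a + 1) + (s - 1)) / Gamma (a + 1))"
      proof (rule Suc.IH)
        show "(\<integral>\<^sup>+x. ennreal (exp (- t * X x)) \<partial>N') = ennreal ((C * a) * (1 + t) powr (-(a + 1)))" if "t \<ge> 0" for t
          using Laplace_size_biased[OF X Suc.prems(3,4,5,7) that] Suc.prems(3)
          by (simp add: N'_def nn_integral_density ennreal_mult'[symmetric])
      qed (use Suc.prems in auto)
      also have "(\<integral>\<^sup>+x. ennreal (X x powr (s - 1)) \<partial>N') = (\<integral>\<^sup>+x. ennreal (X x powr s) \<partial>N)"
        unfolding N'_def using Suc.prems(3)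
        by (subst nn_integral_density) (auto intro!: nn_integral_cong simp: ennreal_mult'[symmetric] powr_mult_base)
      also have "Gamma (a + 1) = a * Gamma a" using Suc.prems(4) by (intro Gamma_plus1) (auto elim!: nonpos_Ints_cases)
      finally show ?thesis using Suc.prems(4) by (simp add: field_simps)
    qed
  qed
qed

subsection \<open>Gaussian integrals\<close>

text \<open>Completing the square produces a normal density with mean \<open>c / (1 + b)\<close> and
  variance \<open>1 / (1 + b)\<close>. Negative \<open>b\<close> down to -1 is included because the
  mixing variables \<open>g\<close> below acquire such coefficients.\<close>

lemma nn_integral_std_normal_exp_quadratic:
  fixes b c :: real
  assumes b: "b > -1"
  shows "(\<integral>\<^sup>+x. ennreal (exp (- b * x\<^sup>2 / 2 + c * x)) \<partial>std_normal_distribution)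
    = ennreal ((1 + b) powr (-1/2) * exp (c\<^sup>2 / (2 * (1 + b))))"
proof -
  define \<sigma> where "\<sigma> = 1 / sqrt (1 + b)"
  define m where "m = c / (1 + b)"
  have \<sigma>: "\<sigma> > 0" "\<sigma>\<^sup>2 = 1 / (1 + b)" using b by (auto simp: \<sigma>_def power_divide)
  have \<sigma>_powr: "\<sigma> = (1 + b) powr (-1/2)"
    using b by (simp add: \<sigma>_def powr_minus powr_half_sqrt[symmetric] inverse_eq_divide)
  have eq: "std_normal_density x * exp (- b * x\<^sup>2 / 2 + c * x) = (\<sigma> * exp (c\<^sup>2 / (2 * (1 + b)))) * normal_density m \<sigma> x" for x
  proof -
    have "- (x\<^sup>2) / 2 + (- b * x\<^sup>2 / 2 + c * x) = c\<^sup>2 / (2 * (1 + b)) + - (x - m)\<^sup>2 / (2 * \<sigma>\<^sup>2)"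
    proof -
      have c: "c = (1 + b) * m" using b by (simp add: m_def)
      have 1: "c\<^sup>2 / (2 * (1 + b)) = (1 + b) * m\<^sup>2 / 2"
      proof -
        have "(d * m)\<^sup>2 / (2 * d) = d * m\<^sup>2 / 2" if "d \<noteq> 0" for d using that by (simp add: power2_eq_square)
        from this[of "1 + b"] show ?thesis using b by (simp add: c)
      qed
      have 2: "- (x - m)\<^sup>2 / (2 * \<sigma>\<^sup>2) = - ((1 + b) * (x - m)\<^sup>2) / 2" unfolding \<sigma>(2) by simp
      show ?thesis unfolding 1 2 unfolding c by (simp add: power2_eq_square field_simps)
    qed
    hence e: "exp (- (x\<^sup>2) / 2) * exp (- b * x\<^sup>2 / 2 + c * x) = exp (c\<^sup>2 / (2 * (1 + b))) * exp (- (x - m)\<^sup>2 / (2 * \<sigma>\<^sup>2))"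
      by (simp only: exp_add[symmetric])
    have "sqrt (2 * pi * \<sigma>\<^sup>2) = sqrt (2 * pi) * \<sigma>" using \<sigma>(1) by (simp add: real_sqrt_mult)
    hence k: "\<sigma> * (1 / sqrt (2 * pi * \<sigma>\<^sup>2)) = 1 / sqrt (2 * pi)" using \<sigma> by simp
    have "std_normal_density x * exp (- b * x\<^sup>2 / 2 + c * x)
        = 1 / sqrt (2 * pi) * (exp (- (x\<^sup>2) / 2) * exp (- b * x\<^sup>2 / 2 + c * x))"
      by (simp add: std_normal_density_def)
    also have "\<dots> = \<sigma> * (1 / sqrt (2 * pi * \<sigma>\<^sup>2)) * (exp (c\<^sup>2 / (2 * (1 + b))) * exp (- (x - m)\<^sup>2 / (2 * \<sigma>\<^sup>2)))"
      unfolding e k ..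
    finally show ?thesis by (simp add: normal_density_def)
  qed
  have "(\<integral>\<^sup>+x. ennreal (exp (- b * x\<^sup>2 / 2 + c * x)) \<partial>std_normal_distribution)
     = (\<integral>\<^sup>+x. ennreal (\<sigma> * exp (c\<^sup>2 / (2 * (1 + b)))) * ennreal (normal_density m \<sigma> x) \<partial>lborel)"
    by (subst nn_integral_density, simp, simp)
       (simp only: ennreal_mult''[symmetric] exp_ge_zero normal_density_nonneg eq)
  also have "\<dots> = ennreal (\<sigma> * exp (c\<^sup>2 / (2 * (1 + b)))) * (\<integral>\<^sup>+x. ennreal (normal_density m \<sigma> x) \<partial>lborel)"
    by (rule nn_integral_cmult) auto
  also have "(\<integral>\<^sup>+x. ennreal (normal_density m \<sigma> x) \<partial>lborel) = 1"
    using \<sigma> by (subst nn_integral_eq_integral) auto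
  finally show ?thesis by (simp add: \<sigma>_powr)
qed

text \<open>Hubbard-Stratonovich: \<open>exp (w * (u \<bullet> x)\<^sup>2 / 2)\<close> is the Gaussian average of \<open>exp (sqrt w * g * (u \<bullet> x))\<close>
  over \<open>g\<close>; after exchanging the integrals only one-dimensional Gaussian integrals remain.\<close>
lemma nn_integral_PiM_std_normal_exp_quadratic_form:
  fixes K :: "'i set" and L :: "'l set" and u :: "'l \<Rightarrow> 'i \<Rightarrow> real" and w :: "'l \<Rightarrow> real"
  assumes K: "finite K" and L: "finite L"
    and orth: "\<And>l l'. l \<in> L \<Longrightarrow> l' \<in> L \<Longrightarrow> (\<Sum>i\<in>K. u l i * u l' i) = (if l = l' then 1 else 0)"
    and w: "\<And>l. l \<in> L \<Longrightarrow> 0 \<le> w l \<and> w l \<le> b" and b: "0 \<le> b"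
  shows "(\<integral>\<^sup>+x. ennreal (exp (- (b * (\<Sum>i\<in>K. (x i)\<^sup>2) - (\<Sum>l\<in>L. w l * (\<Sum>i\<in>K. u l i * x i)\<^sup>2)) / 2)) \<partial>Pi\<^sub>M K (\<lambda>_. std_normal_distribution))
    = ennreal ((1 + b) powr (- real (card K) / 2) * (\<Prod>l\<in>L. (1 - w l / (1 + b)) powr (-1/2)))"
proof -
  let ?G = "std_normal_distribution"
  interpret real_distribution ?G by (rule real_dist_normal_dist)
  interpret P: product_prob_space "\<lambda>_. ?G" ..
  interpret PK: prob_space "Pi\<^sub>M K (\<lambda>_. ?G)" by (rule prob_space_PiM) (rule prob_space_axioms)
  interpret PL: prob_space "Pi\<^sub>M L (\<lambda>_. ?G)" by (rule prob_space_PiM) (rule prob_space_axioms)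
  interpret pair_sigma_finite "Pi\<^sub>M L (\<lambda>_. ?G)" "Pi\<^sub>M K (\<lambda>_. ?G)" ..
  have meas_prod: "(\<integral>\<^sup>+x. ennreal (\<Prod>i\<in>A. f i (x i)) \<partial>Pi\<^sub>M A (\<lambda>_. ?G)) = (\<Prod>i\<in>A. \<integral>\<^sup>+x. ennreal (f i x) \<partial>?G)"
    if "finite A" "\<And>i. f i \<in> borel_measurable borel" "\<And>i x. f i x \<ge> 0" for A :: "'b set" and f
    using P.product_nn_integral_prod[of A "\<lambda>i x. ennreal (f i x)"] that
    by (simp add: prod_ennreal)
  have [simp]: "0 < 1 + b" "-1 < b" using b by auto
  have HS: "ennreal (exp (- (b * (\<Sum>i\<in>K. (x i)\<^sup>2) - (\<Sum>l\<in>L. w l * (\<Sum>i\<in>K. u l i * x i)\<^sup>2)) / 2)) =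
     (\<integral>\<^sup>+g. ennreal (\<Prod>i\<in>K. exp (- b * (x i)\<^sup>2 / 2 + (\<Sum>l\<in>L. sqrt (w l) * g l * u l i) * x i)) \<partial>Pi\<^sub>M L (\<lambda>_. ?G))" for x
  proof -
    \<comment> \<open>The vanishing quadratic term is kept so that each factor is literally the
      one-dimensional integrand with coefficient 0.\<close>
    have "(\<integral>\<^sup>+g. ennreal (\<Prod>l\<in>L. exp (- 0 * (g l)\<^sup>2 / 2 + (sqrt (w l) * (\<Sum>i\<in>K. u l i * x i)) * g l)) \<partial>Pi\<^sub>M L (\<lambda>_. ?G))
       = (\<Prod>l\<in>L. ennreal (exp (w l * (\<Sum>i\<in>K. u l i * x i)\<^sup>2 / 2)))"
      using L w by (subst meas_prod, simp, simp, simp, subst nn_integral_std_normal_exp_quadratic)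
         (auto simp: power_mult_distrib intro!: prod.cong)
    also have "\<dots> = ennreal (exp (\<Sum>l\<in>L. w l * (\<Sum>i\<in>K. u l i * x i)\<^sup>2 / 2))"
      using L by (simp add: prod_ennreal exp_sum)
    finally have 1: "(\<integral>\<^sup>+g. ennreal (\<Prod>l\<in>L. exp (- 0 * (g l)\<^sup>2 / 2 + (sqrt (w l) * (\<Sum>i\<in>K. u l i * x i)) * g l)) \<partial>Pi\<^sub>M L (\<lambda>_. ?G))
      = ennreal (exp (\<Sum>l\<in>L. w l * (\<Sum>i\<in>K. u l i * x i)\<^sup>2 / 2))" .
    have 2: "(\<Prod>i\<in>K. exp (- b * (x i)\<^sup>2 / 2 + (\<Sum>l\<in>L. sqrt (w l) * g l * u l i) * x i))
       = exp (- b * (\<Sum>i\<in>K. (x i)\<^sup>2) / 2) * (\<Prod>l\<in>L. exp (- 0 * (g l)\<^sup>2 / 2 + (sqrt (w l) * (\<Sum>i\<in>K. u l i * x i)) * g l))" for g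
    proof -
      have "(\<Sum>i\<in>K. (\<Sum>l\<in>L. sqrt (w l) * g l * u l i) * x i) = (\<Sum>l\<in>L. sqrt (w l) * (\<Sum>i\<in>K. u l i * x i) * g l)"
        unfolding sum_distrib_left sum_distrib_right by (subst sum.swap) (simp add: mult_ac)
      moreover have "(\<Sum>i\<in>K. - b * (x i)\<^sup>2 / 2 + (\<Sum>l\<in>L. sqrt (w l) * g l * u l i) * x i)
          = - b * (\<Sum>i\<in>K. (x i)\<^sup>2) / 2 + (\<Sum>i\<in>K. (\<Sum>l\<in>L. sqrt (w l) * g l * u l i) * x i)"
        by (simp only: sum.distrib sum_distrib_left sum_divide_distrib)
      ultimately show ?thesis using K L
        by (simp add: exp_sum[symmetric] exp_add[symmetric])
    qed
    have "(\<integral>\<^sup>+g. ennreal (\<Prod>i\<in>K. exp (- b * (x i)\<^sup>2 / 2 + (\<Sum>l\<in>L. sqrt (w l) * g l * u l i) * x i)) \<partial>Pi\<^sub>M L (\<lambda>_. ?G))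
      = ennreal (exp (- b * (\<Sum>i\<in>K. (x i)\<^sup>2) / 2)) * ennreal (exp (\<Sum>l\<in>L. w l * (\<Sum>i\<in>K. u l i * x i)\<^sup>2 / 2))"
      unfolding 2 1[symmetric] by (subst nn_integral_cmult[symmetric]) (auto simp: ennreal_mult')
    also have "\<dots> = ennreal (exp (- b * (\<Sum>i\<in>K. (x i)\<^sup>2) / 2 + (\<Sum>l\<in>L. w l * (\<Sum>i\<in>K. u l i * x i)\<^sup>2 / 2)))"
      by (simp only: ennreal_mult'[symmetric] exp_ge_zero exp_add)
    also have "- b * (\<Sum>i\<in>K. (x i)\<^sup>2) / 2 + (\<Sum>l\<in>L. w l * (\<Sum>i\<in>K. u l i * x i)\<^sup>2 / 2)
      = - (b * (\<Sum>i\<in>K. (x i)\<^sup>2) - (\<Sum>l\<in>L. w l * (\<Sum>i\<in>K. u l i * x i)\<^sup>2)) / 2"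
      by (simp add: sum_divide_distrib[symmetric] diff_divide_distrib)
    finally show ?thesis by simp
  qed
  have inner: "(\<integral>\<^sup>+x. ennreal (\<Prod>i\<in>K. exp (- b * (x i)\<^sup>2 / 2 + (\<Sum>l\<in>L. sqrt (w l) * g l * u l i) * x i)) \<partial>Pi\<^sub>M K (\<lambda>_. ?G))
     = ennreal ((1 + b) powr (- real (card K) / 2)) * ennreal (\<Prod>l\<in>L. exp (- (- w l / (1 + b)) * (g l)\<^sup>2 / 2 + 0 * g l))" for g
  proof -
    \<comment> \<open>Orthonormality of the \<open>u l\<close> removes the cross terms; only then
      does the remaining integral over \<open>g\<close> split into one-dimensional ones.\<close>
    have sq: "(\<Sum>i\<in>K. (\<Sum>l\<in>L. sqrt (w l) * g l * u l i)\<^sup>2) = (\<Sum>l\<in>L. w l * (g l)\<^sup>2)"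
    proof -
      have "(\<Sum>i\<in>K. (\<Sum>l\<in>L. sqrt (w l) * g l * u l i)\<^sup>2)
         = (\<Sum>i\<in>K. \<Sum>l\<in>L. \<Sum>l'\<in>L. (sqrt (w l) * g l * u l i) * (sqrt (w l') * g l' * u l' i))"
        by (simp add: power2_eq_square sum_product)
      also have "\<dots> = (\<Sum>l\<in>L. \<Sum>l'\<in>L. (sqrt (w l) * g l) * (sqrt (w l') * g l') * (\<Sum>i\<in>K. u l i * u l' i))"
        unfolding sum_distrib_left
        by (subst sum.swap, rule sum.cong[OF refl], subst sum.swap, simp add: mult_ac)
      also have "\<dots> = (\<Sum>l\<in>L. \<Sum>l'\<in>L. if l = l' then (sqrt (w l) * g l) * (sqrt (w l') * g l') else 0)"
        using orth by (intro sum.cong) auto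
      also have "\<dots> = (\<Sum>l\<in>L. w l * (g l)\<^sup>2)"
        using L w by (intro sum.cong) (auto simp: power2_eq_square abs_of_nonneg mult_ac)
      finally show ?thesis .
    qed
    have pw: "((1 + b) powr (- 1 / 2)) ^ card K = (1 + b) powr (- real (card K) / 2)"
      using b by (subst powr_power) auto
    have "(\<integral>\<^sup>+x. ennreal (\<Prod>i\<in>K. exp (- b * (x i)\<^sup>2 / 2 + (\<Sum>l\<in>L. sqrt (w l) * g l * u l i) * x i)) \<partial>Pi\<^sub>M K (\<lambda>_. ?G))
      = (\<Prod>i\<in>K. ennreal ((1 + b) powr (-1/2) * exp ((\<Sum>l\<in>L. sqrt (w l) * g l * u l i)\<^sup>2 / (2 * (1 + b)))))"
      using K by (subst meas_prod, simp, simp, simp, subst nn_integral_std_normal_exp_quadratic) auto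
    also have "\<dots> = ennreal (\<Prod>i\<in>K. (1 + b) powr (-1/2) * exp ((\<Sum>l\<in>L. sqrt (w l) * g l * u l i)\<^sup>2 / (2 * (1 + b))))"
      by (rule prod_ennreal) auto
    also have "(\<Prod>i\<in>K. (1 + b) powr (-1/2) * exp ((\<Sum>l\<in>L. sqrt (w l) * g l * u l i)\<^sup>2 / (2 * (1 + b))))
      = (1 + b) powr (- real (card K) / 2) * exp ((\<Sum>l\<in>L. w l * (g l)\<^sup>2) / (2 * (1 + b)))"
      unfolding sq[symmetric] using K
      by (simp only: prod.distrib prod_constant pw exp_sum[symmetric] sum_divide_distrib)
    also have "exp ((\<Sum>l\<in>L. w l * (g l)\<^sup>2) / (2 * (1 + b))) = (\<Prod>l\<in>L. exp (- (- w l / (1 + b)) * (g l)\<^sup>2 / 2 + 0 * g l))"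
      using L by (simp add: exp_sum[symmetric] sum_divide_distrib mult_ac)
    finally show ?thesis by (simp add: ennreal_mult')
  qed
  have "(\<integral>\<^sup>+x. ennreal (exp (- (b * (\<Sum>i\<in>K. (x i)\<^sup>2) - (\<Sum>l\<in>L. w l * (\<Sum>i\<in>K. u l i * x i)\<^sup>2)) / 2)) \<partial>Pi\<^sub>M K (\<lambda>_. ?G))
    = (\<integral>\<^sup>+g. \<integral>\<^sup>+x. ennreal (\<Prod>i\<in>K. exp (- b * (x i)\<^sup>2 / 2 + (\<Sum>l\<in>L. sqrt (w l) * g l * u l i) * x i)) \<partial>Pi\<^sub>M K (\<lambda>_. ?G) \<partial>Pi\<^sub>M L (\<lambda>_. ?G))"
    unfolding HS by (rule Fubini') measurable
  also have "\<dots> = ennreal ((1 + b) powr (- real (card K) / 2)) * 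
      (\<integral>\<^sup>+g. ennreal (\<Prod>l\<in>L. exp (- (- w l / (1 + b)) * (g l)\<^sup>2 / 2 + 0 * g l)) \<partial>Pi\<^sub>M L (\<lambda>_. ?G))"
    unfolding inner by (rule nn_integral_cmult) measurable
  also have "(\<integral>\<^sup>+g. ennreal (\<Prod>l\<in>L. exp (- (- w l / (1 + b)) * (g l)\<^sup>2 / 2 + 0 * g l)) \<partial>Pi\<^sub>M L (\<lambda>_. ?G))
     = (\<Prod>l\<in>L. \<integral>\<^sup>+x. ennreal (exp (- (- w l / (1 + b)) * x\<^sup>2 / 2 + 0 * x)) \<partial>?G)"
    using L by (intro meas_prod) auto
  also have "\<dots> = (\<Prod>l\<in>L. ennreal ((1 - w l / (1 + b)) powr (-1/2)))"
  proof (intro prod.cong refl)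
    fix l assume "l \<in> L"
    \<comment> \<open>Here \<open>w l \<le> b\<close> enters: it keeps the coefficient above -1, the
      range in which the Gaussian integral is finite.\<close>
    hence "- w l / (1 + b) > -1" using w[of l] by (simp add: field_simps)
    from nn_integral_std_normal_exp_quadratic[OF this, of 0]
    show "(\<integral>\<^sup>+x. ennreal (exp (- (- w l / (1 + b)) * x\<^sup>2 / 2 + 0 * x)) \<partial>?G) = ennreal ((1 - w l / (1 + b)) powr (-1/2))"
      by simp
  qed
  also have "\<dots> = ennreal (\<Prod>l\<in>L. (1 - w l / (1 + b)) powr (-1/2))" by (rule prod_ennreal) auto
  finally show ?thesis by (simp add: ennreal_mult')
qed

subsection \<open>Gram-Schmidt and the sphericity statistic\<close>

definition dot :: "nat \<Rightarrow> (nat \<Rightarrow> real) \<Rightarrow> (nat \<Rightarrow> real) \<Rightarrow> real" where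
  "dot n a b = (\<Sum>i<n. a i * b i)"

lemma dot_commute: "dot n a b = dot n b a"
  by (simp add: dot_def mult.commute)

lemma dot_diff_left: "dot n (\<lambda>i. a i - b i) c = dot n a c - dot n b c"
  by (simp add: dot_def left_diff_distrib sum_subtractf)

lemma dot_sum_left: "dot n (\<lambda>i. \<Sum>l\<in>L. c l * f l i) b = (\<Sum>l\<in>L. c l * dot n (f l) b)"
proof -
  have "dot n (\<lambda>i. \<Sum>l\<in>L. c l * f l i) b = (\<Sum>i<n. \<Sum>l\<in>L. c l * f l i * b i)"
    by (simp add: dot_def sum_distrib_right)
  also have "\<dots> = (\<Sum>l\<in>L. \<Sum>i<n. c l * f l i * b i)" by (rule sum.swap)
  finally show ?thesis by (simp add: dot_def sum_distrib_left mult.assoc)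
qed

lemma dot_self_nonneg: "0 \<le> dot n a a"
  by (simp add: dot_def sum_nonneg)

lemma dot_zero_right_if_self_zero: "dot n b b = 0 \<Longrightarrow> dot n a b = 0"
  by (auto simp: dot_def sum_nonneg_eq_0_iff intro!: sum.neutral)

lemma dot_cong: "(\<And>i. i < n \<Longrightarrow> a i = a' i) \<Longrightarrow> (\<And>i. i < n \<Longrightarrow> b i = b' i) \<Longrightarrow> dot n a b = dot n a' b'"
  by (simp add: dot_def)

text \<open>The vectors are not normalised. One that vanishes causes no trouble, because its coefficient
  is then \<open>0 / 0 = 0\<close>.\<close>
fun gram_schmidt :: "nat \<Rightarrow> (nat \<Rightarrow> nat \<Rightarrow> real) \<Rightarrow> nat \<Rightarrow> nat \<Rightarrow> real" where
  "gram_schmidt n v k = (\<lambda>i. v k i - (\<Sum>l<k. dot n (v k) (gram_schmidt n v l) /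
      dot n (gram_schmidt n v l) (gram_schmidt n v l) * gram_schmidt n v l i))"

declare gram_schmidt.simps [simp del]

lemma gram_schmidt_cong:
  "(\<And>l i. l \<le> k \<Longrightarrow> i < n \<Longrightarrow> v l i = w l i) \<Longrightarrow> i < n \<Longrightarrow> gram_schmidt n v k i = gram_schmidt n w k i"
proof (induction k arbitrary: i rule: less_induct)
  case (less k)
  have e: "gram_schmidt n v l i = gram_schmidt n w l i" if "l < k" "i < n" for l i
    using less that by auto
  have d: "dot n (v k) (gram_schmidt n v l) = dot n (w k) (gram_schmidt n w l)"
    "dot n (gram_schmidt n v l) (gram_schmidt n v l) = dot n (gram_schmidt n w l) (gram_schmidt n w l)" if "l < k" for l
    using less.prems e that by (auto intro!: dot_cong)
  show ?case
    unfolding gram_schmidt.simps[of n v k] gram_schmidt.simps[of n w k]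
    using less.prems d e by (auto intro!: arg_cong2[where f = "(-)"] sum.cong)
qed

lemma dot_gram_schmidt_less:
  "l < k \<Longrightarrow> dot n (gram_schmidt n v k) (gram_schmidt n v l) = 0"
proof (induction k arbitrary: l rule: less_induct)
  case (less k)
  let ?e = "gram_schmidt n v"
  have orth: "dot n (?e l) (?e m) = 0" if "l < k" "m < k" "l \<noteq> m" for l m
    using less.IH[of l m] less.IH[of m l] that by (cases "l < m") (auto simp: dot_commute)
  have "dot n (?e k) (?e l) = dot n (v k) (?e l) - (\<Sum>m<k. dot n (v k) (?e m) / dot n (?e m) (?e m) * dot n (?e m) (?e l))"
    by (subst gram_schmidt.simps) (simp only: dot_diff_left dot_sum_left)
  also have "(\<Sum>m<k. dot n (v k) (?e m) / dot n (?e m) (?e m) * dot n (?e m) (?e l))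
      = (\<Sum>m<k. if m = l then dot n (v k) (?e l) / dot n (?e l) (?e l) * dot n (?e l) (?e l) else 0)"
    using orth less.prems by (intro sum.cong) auto
  \<comment> \<open>If \<open>?e l\<close> vanishes, the coefficient \<open>0 / 0 = 0\<close> kills
    the left side, and the right side is a product with the zero vector.\<close>
  also have "\<dots> = dot n (v k) (?e l)"
    using less.prems dot_zero_right_if_self_zero[of n "?e l" "v k"] by auto
  finally show ?case by simp
qed

lemma dot_gram_schmidt:
  "l \<noteq> k \<Longrightarrow> dot n (gram_schmidt n v k) (gram_schmidt n v l) = 0"
  by (metis dot_commute dot_gram_schmidt_less nat_neq_iff)

text \<open>Pythagoras. Since the earlier \<open>gram_schmidt\<close> vectors do not involve
  \<open>v k\<close>, the squared residual is a quadratic form in \<open>v k\<close> once the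
  earlier columns are fixed.\<close>

lemma dot_gram_schmidt_self:
  "dot n (gram_schmidt n v k) (gram_schmidt n v k) =
    dot n (v k) (v k) - (\<Sum>l<k. (dot n (v k) (gram_schmidt n v l))\<^sup>2 / dot n (gram_schmidt n v l) (gram_schmidt n v l))"
proof -
  let ?e = "gram_schmidt n v"
  have left: "dot n (?e k) b = dot n (v k) b - (\<Sum>m<k. dot n (v k) (?e m) / dot n (?e m) (?e m) * dot n (?e m) b)" for b
    by (subst gram_schmidt.simps) (simp only: dot_diff_left dot_sum_left)
  have "dot n (?e k) (?e k) = dot n (v k) (?e k)"
    by (subst left) (auto simp: dot_gram_schmidt intro!: sum.neutral)
  also have "\<dots> = dot n (?e k) (v k)" by (rule dot_commute)
  also have "\<dots> = dot n (v k) (v k) - (\<Sum>m<k. dot n (v k) (?e m) / dot n (?e m) (?e m) * dot n (?e m) (v k))"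
    by (rule left)
  finally show ?thesis by (simp add: power2_eq_square dot_commute[of n "?e _" "v k"])
qed

text \<open>Column \<open>0\<close> is the all-ones vector, so that the first Gram-Schmidt step centers the data;
  \<open>y (j, i)\<close> is coordinate \<open>j\<close> of observation \<open>i\<close>.\<close>
definition data_columns :: "(nat \<times> nat \<Rightarrow> real) \<Rightarrow> nat \<Rightarrow> nat \<Rightarrow> real" where
  "data_columns y k i = (if k = 0 then 1 else y (k - 1, i))"

definition resid :: "nat \<Rightarrow> (nat \<times> nat \<Rightarrow> real) \<Rightarrow> nat \<Rightarrow> real" where
  "resid n y j = dot n (gram_schmidt n (data_columns y) (Suc j)) (gram_schmidt n (data_columns y) (Suc j))"

definition centered :: "nat \<Rightarrow> (nat \<times> nat \<Rightarrow> real) \<Rightarrow> nat \<Rightarrow> nat \<Rightarrow> real" where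
  "centered n y j i = y (j, i) - (\<Sum>i<n. y (j, i)) / real n"

definition total_var :: "nat \<Rightarrow> (nat \<times> nat \<Rightarrow> real) \<Rightarrow> nat \<Rightarrow> real" where
  "total_var n y j = dot n (centered n y j) (centered n y j)"

lemma gram_schmidt_data_columns_0: "gram_schmidt n (data_columns y) 0 = (\<lambda>_. 1)"
  by (subst gram_schmidt.simps) (simp add: data_columns_def)

text \<open>The term of the recursion belonging to the all-ones vector is exactly the sample mean;
  it moves to the left side and the remaining terms are shifted by one index.\<close>

lemma centered_eq_gram_schmidt:
  "centered n y j i = gram_schmidt n (data_columns y) (Suc j) i + 
     (\<Sum>l<j. dot n (data_columns y (Suc j)) (gram_schmidt n (data_columns y) (Suc l)) / resid n y l * gram_schmidt n (data_columns y) (Suc l) i)"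
  unfolding gram_schmidt.simps[of n "data_columns y" "Suc j"] sum.lessThan_Suc_shift
  by (simp add: gram_schmidt_data_columns_0 resid_def centered_def data_columns_def dot_def)

lemma total_var_eq: "total_var n y j = (\<Sum>i<n. (y (j, i))\<^sup>2) - (\<Sum>i<n. y (j, i))\<^sup>2 / real n"
proof (cases "n = 0")
  case False
  define s where "s = (\<Sum>i<n. y (j, i))"
  have "total_var n y j = (\<Sum>i<n. (y (j, i))\<^sup>2 - 2 * (s / real n) * y (j, i) + (s / real n)\<^sup>2)"
    by (simp add: total_var_def dot_def centered_def s_def power2_eq_square algebra_simps)
  also have "\<dots> = (\<Sum>i<n. (y (j, i))\<^sup>2) - 2 * (s / real n) * s + real n * (s / real n)\<^sup>2"
  proof -
    have "(\<Sum>i<n. 2 * (s / real n) * y (j, i)) = 2 * (s / real n) * s"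
      unfolding sum_distrib_left[symmetric] s_def ..
    thus ?thesis by (simp add: sum.distrib sum_subtractf)
  qed
  finally show ?thesis using False by (simp add: s_def field_simps power2_eq_square)
qed (simp add: total_var_def dot_def)

lemma resid_nonneg: "0 \<le> resid n y j"
  by (simp add: resid_def dot_self_nonneg)

lemma total_var_nonneg: "0 \<le> total_var n y j"
  by (simp add: total_var_def dot_self_nonneg)

text \<open>The Gram matrix of the centered columns is factored into a unit lower triangular matrix,
  the diagonal of residuals and the transposed triangular matrix; \<open>C\<close> holds the
  Gram-Schmidt coefficients.\<close>

lemma dot_centered:
  fixes y :: "nat \<times> nat \<Rightarrow> real" and n :: nat
  assumes "j < p" "k < p"
  defines "C \<equiv> \<lambda>j l. if l = j then 1 else if l < j then dot n (data_columns y (Suc j)) (gram_schmidt n (data_columns y) (Suc l)) / resid n y l else 0"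
  shows "dot n (centered n y j) (centered n y k) = (\<Sum>l<p. C j l * (resid n y l * C k l))"
proof -
  let ?f = "\<lambda>l. gram_schmidt n (data_columns y) (Suc l)"
  have expand: "centered n y j = (\<lambda>i. \<Sum>l<p. C j l * ?f l i)" if "j < p" for j
  proof
    fix i
    have "(\<Sum>l<p. C j l * ?f l i) = (\<Sum>l\<in>insert j {..<j}. C j l * ?f l i)"
      using that by (intro sum.mono_neutral_right) (auto simp: C_def)
    also have "\<dots> = ?f j i + (\<Sum>l<j. C j l * ?f l i)" by (subst sum.insert) (auto simp: C_def)
    also have "\<dots> = centered n y j i"
      unfolding centered_eq_gram_schmidt[of n y j i] by (auto simp: C_def intro!: sum.cong)
    finally show "centered n y j i = (\<Sum>l<p. C j l * ?f l i)" by simp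
  qed
  have "dot n (centered n y j) (centered n y k) = (\<Sum>l<p. C j l * dot n (?f l) (centered n y k))"
    unfolding expand[OF assms(1)] by (rule dot_sum_left)
  also have "\<dots> = (\<Sum>l<p. C j l * (\<Sum>m<p. C k m * dot n (?f m) (?f l)))"
    unfolding expand[OF assms(2)] by (subst dot_commute, subst dot_sum_left) simp
  also have "\<dots> = (\<Sum>l<p. C j l * (resid n y l * C k l))"
  proof (intro sum.cong refl)
    fix l assume "l \<in> {..<p}"
    have "(\<Sum>m<p. C k m * dot n (?f m) (?f l)) = (\<Sum>m<p. if m = l then C k l * resid n y l else 0)"
      by (intro sum.cong) (auto simp: resid_def dot_gram_schmidt)
    thus "C j l * (\<Sum>m<p. C k m * dot n (?f m) (?f l)) = C j l * (resid n y l * C k l)"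
      using \<open>l \<in> {..<p}\<close> by simp
  qed
  finally show ?thesis .
qed

text \<open>The residual is one of the nonnegative terms of the orthogonal expansion. It transfers
  positivity from the determinant to the trace.\<close>

lemma resid_le_total_var: "resid n y j \<le> total_var n y j"
proof -
  define C where "C l = (if l = j then 1 else if l < j then dot n (data_columns y (Suc j)) (gram_schmidt n (data_columns y) (Suc l)) / resid n y l else 0)" for l
  have "total_var n y j = (\<Sum>l<Suc j. C l * (resid n y l * C l))"
    unfolding total_var_def C_def by (rule dot_centered) auto
  also have "\<dots> = (\<Sum>l<Suc j. resid n y l * (C l)\<^sup>2)"
    by (simp only: power2_eq_square mult_ac)
  finally have eq: "total_var n y j = (\<Sum>l<Suc j. resid n y l * (C l)\<^sup>2)" .
  have "resid n y j * (C j)\<^sup>2 \<le> (\<Sum>l<Suc j. resid n y l * (C l)\<^sup>2)"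
    by (rule member_le_sum) (auto simp: resid_nonneg)
  thus ?thesis unfolding eq by (simp add: C_def)
qed

text \<open>The triangular factorization has unit diagonal on one side, so only the residuals
  survive in the determinant.\<close>

lemma det_centered:
  "det (mat p p (\<lambda>(j, k). dot n (centered n y j) (centered n y k))) = (\<Prod>j<p. resid n y j)"
proof -
  define C where "C = (\<lambda>j l. if l = j then 1 else if l < j then dot n (data_columns y (Suc j)) (gram_schmidt n (data_columns y) (Suc l)) / resid n y l else (0::real))"
  define A where "A = mat p p (\<lambda>(j, l). C j l)"
  define B where "B = mat p p (\<lambda>(l, k). resid n y l * C k l)"
  have car: "A \<in> carrier_mat p p" "B \<in> carrier_mat p p" by (auto simp: A_def B_def)
  have "mat p p (\<lambda>(j, k). dot n (centered n y j) (centered n y k)) = A * B"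
    using dot_centered[of _ p _ n y]
    by (intro eq_matI) (auto simp: A_def B_def scalar_prod_def C_def lessThan_atLeast0)
  hence "det (mat p p (\<lambda>(j, k). dot n (centered n y j) (centered n y k))) = det A * det B"
    using det_mult[OF car] by simp
  also have "det A = prod_list (diag_mat A)"
    by (rule det_lower_triangular[OF _ car(1)]) (auto simp: A_def C_def)
  also have "\<dots> = 1" by (simp add: prod_list_diag_prod A_def C_def)
  also have "det B = prod_list (diag_mat B)"
    by (rule det_upper_triangular[OF _ car(2)]) (auto simp: B_def C_def upper_triangular_def)
  also have "\<dots> = (\<Prod>j<p. resid n y j)"
    by (simp add: prod_list_diag_prod B_def C_def lessThan_atLeast0)
  finally show ?thesis by simp
qed

text \<open>Centering removes the location \<open>m\<close>, and the determinant is homogeneous of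
  degree \<open>p\<close> in the scale while the trace enters to the power \<open>-p\<close>. Hence
  the unknown parameters and the normalisation by \<open>n\<close> disappear.\<close>

lemma sphericity_V_affine:
  assumes n: "n > 0" and c: "c > 0" and x: "\<And>i j. i < n \<Longrightarrow> j < p \<Longrightarrow> x i j = m j + c * y (j, i)"
  shows "sphericity_V n p x = (\<Prod>j<p. resid n y j) * ((\<Sum>j<p. total_var n y j) / real p) powr (- real p)"
proof -
  have cen: "x i j - sample_mean n x j = c * centered n y j i" if "i < n" "j < p" for i j
  proof -
    have "sample_mean n x j = (\<Sum>i<n. m j + c * y (j, i)) / real n"
      using that by (simp add: sample_mean_def x)
    also have "\<dots> = m j + c * ((\<Sum>i<n. y (j, i)) / real n)"
      using n by (simp add: sum.distrib sum_distrib_left[symmetric] field_simps)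
    finally show ?thesis using that by (simp add: x centered_def algebra_simps)
  qed
  \<comment> \<open>The squared scale and the divisor of the sample covariance form one factor,
    which cancels in \<open>a ^ p * a powr (- real p) = 1\<close>.\<close>
  define a where "a = c\<^sup>2 / real n"
  have a: "a > 0" using n c by (simp add: a_def)
  let ?A = "mat p p (\<lambda>(j, k). dot n (centered n y j) (centered n y k))"
  have cov: "sample_cov n p x = a \<cdot>\<^sub>m ?A"
    unfolding sample_cov_def
    by (intro eq_matI) (auto simp: cen a_def dot_def sum_distrib_left sum_divide_distrib power2_eq_square mult_ac)
  have det: "det (sample_cov n p x) = a ^ p * (\<Prod>j<p. resid n y j)"
    unfolding cov by (simp add: det_centered)
  have tr: "mat_trace (sample_cov n p x) = a * (\<Sum>j<p. total_var n y j)"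
    unfolding cov by (simp add: mat_trace_def total_var_def sum_distrib_left lessThan_atLeast0)
  have "(a * (\<Sum>j<p. total_var n y j) / real p) powr (- real p)
     = a powr (- real p) * ((\<Sum>j<p. total_var n y j) / real p) powr (- real p)"
    using a by (subst powr_mult[symmetric]) (auto simp: sum_nonneg total_var_nonneg)
  moreover have "a ^ p * a powr (- real p) = 1"
    using a by (simp add: powr_minus powr_realpow)
  moreover have "a ^ p * R * (a powr (- real p) * W) = (a ^ p * a powr (- real p)) * (R * W)" for R W
    by (simp only: mult_ac)
  ultimately show ?thesis unfolding sphericity_V_def det tr by simp
qed

subsection \<open>Moments of the determinant and of the statistic\<close>

abbreviation gauss_PiM :: "'i set \<Rightarrow> ('i \<Rightarrow> real) measure" where
  "gauss_PiM I \<equiv> Pi\<^sub>M I (\<lambda>_. std_normal_distribution)"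

lemma measurable_gauss_PiM_component:
  "i \<in> I \<Longrightarrow> (\<lambda>y. y i) \<in> borel_measurable (gauss_PiM I)"
  using measurable_component_singleton[of i I "\<lambda>_. std_normal_distribution"] by simp

lemma borel_measurable_gram_schmidt:
  assumes "\<And>l i. l \<le> k \<Longrightarrow> i < n \<Longrightarrow> (\<lambda>x. v x l i) \<in> borel_measurable M" "i < n"
  shows "(\<lambda>x. gram_schmidt n (v x) k i) \<in> borel_measurable M"
  using assms
proof (induction k arbitrary: i rule: less_induct)
  case (less k)
  have [measurable]: "(\<lambda>x. gram_schmidt n (v x) l i) \<in> borel_measurable M" if "l < k" "i < n" for l i
    using less.IH[OF that(1)] less.prems that by auto
  have [measurable]: "(\<lambda>x. v x k i) \<in> borel_measurable M" if "i < n" for i using less.prems that by auto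
  have *: "(\<lambda>x. dot n (v x k) (gram_schmidt n (v x) l)) \<in> borel_measurable M"
    "(\<lambda>x. dot n (gram_schmidt n (v x) l) (gram_schmidt n (v x) l)) \<in> borel_measurable M" if "l < k" for l
    using that unfolding dot_def by (auto intro!: borel_measurable_sum borel_measurable_times)
  show ?case
    using less.prems(2) * unfolding gram_schmidt.simps[of n _ k]
    by (auto intro!: borel_measurable_diff borel_measurable_sum borel_measurable_times borel_measurable_divide)
qed

lemma borel_measurable_resid:
  assumes "{..k} \<times> {..<n} \<subseteq> I"
  shows "(\<lambda>y. resid n y k) \<in> borel_measurable (gauss_PiM I)"
proof -
  have "(\<lambda>y. gram_schmidt n (data_columns y) (Suc k) i) \<in> borel_measurable (gauss_PiM I)" if "i < n" for i
  proof (rule borel_measurable_gram_schmidt[OF _ that])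
    show "(\<lambda>y. data_columns y l i) \<in> borel_measurable (gauss_PiM I)" if "l \<le> Suc k" "i < n" for l i
      using that assms by (cases "l = 0") (auto simp: data_columns_def intro!: measurable_gauss_PiM_component)
  qed
  thus ?thesis unfolding resid_def dot_def by (intro borel_measurable_sum borel_measurable_times) auto
qed

lemma borel_measurable_total_var:
  assumes "{..k} \<times> {..<n} \<subseteq> I"
  shows "(\<lambda>y. total_var n y k) \<in> borel_measurable (gauss_PiM I)"
proof -
  have [measurable]: "(\<lambda>y. y (k, i)) \<in> borel_measurable (gauss_PiM I)" if "i < n" for i
    using that assms by (intro measurable_gauss_PiM_component) auto
  show ?thesis unfolding total_var_eq
    by (intro borel_measurable_diff borel_measurable_sum borel_measurable_divide borel_measurable_power borel_measurable_const) auto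
qed

lemma resid_cong:
  assumes "\<And>l i. l \<le> k \<Longrightarrow> i < n \<Longrightarrow> x (l, i) = y (l, i)"
  shows "resid n x k = resid n y k"
  unfolding resid_def using assms by (intro dot_cong gram_schmidt_cong) (auto simp: data_columns_def)

lemma total_var_cong:
  assumes "\<And>i. i < n \<Longrightarrow> x (k, i) = y (k, i)"
  shows "total_var n x k = total_var n y k"
  unfolding total_var_eq using assms by simp

text \<open>Given the earlier columns, the exponent is a multiple of the squared length of the new
  column minus weighted squared projections onto orthonormal directions. The value does not depend
  on \<open>x\<close>: this is how the columns decouple.\<close>

lemma column_Laplace:
  fixes x :: "nat \<times> nat \<Rightarrow> real" and n k :: nat and \<phi> \<theta> :: real
  defines "I \<equiv> {..<k} \<times> {..<n}" and "J \<equiv> {k} \<times> {..<n}"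
  assumes n: "n > 0" and pos: "\<And>l. l < k \<Longrightarrow> resid n x l > 0" and nonneg: "0 \<le> \<phi>" "0 \<le> \<theta>"
  shows "(\<integral>\<^sup>+y. ennreal (exp (- (\<phi> * resid n (merge I J (x, y)) k + \<theta> * total_var n (merge I J (x, y)) k) / 2)) \<partial>gauss_PiM J)
    = ennreal ((1 + \<phi> + \<theta>) powr (- (real n - 1 - real k) / 2) * (1 + \<theta>) powr (- real k / 2))"
proof -
  define e where "e = gram_schmidt n (data_columns x)"
  define N where "N l = dot n (e l) (e l)" for l
  \<comment> \<open>Index 0 is the all-ones vector, of squared length \<open>n\<close>; index
    \<open>l > 0\<close> belongs to the data column \<open>l - 1\<close>.\<close>
  have N: "N l > 0" if "l \<le> k" for l
    using that pos[of "l - 1"] n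
    by (cases l) (auto simp: N_def e_def gram_schmidt_data_columns_0 dot_def resid_def)
  define u where "u l = (\<lambda>(j::nat, i). e l i / sqrt (N l))" for l
  \<comment> \<open>The direction of the ones is removed from both the residual and the total
    variation, the other \<open>k\<close> directions from the residual only.\<close>
  define w where "w l = (if l = 0 then \<phi> + \<theta> else \<phi>)" for l :: nat
  define \<kappa> where "\<kappa> = 1 + \<phi> + \<theta>"
  have \<kappa>: "\<kappa> > 0" "\<kappa> = 1 + (\<phi> + \<theta>)" using nonneg by (auto simp: \<kappa>_def)
  have sumJ: "(\<Sum>i\<in>J. f i) = (\<Sum>i<n. f (k, i))" for f :: "nat \<times> nat \<Rightarrow> real"
  proof -
    have "J = Pair k ` {..<n}" by (auto simp: J_def)
    thus ?thesis by (simp add: sum.reindex inj_on_def)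
  qed
  have mrg: "merge I J (x, y) (k, i) = y (k, i)" "l < k \<Longrightarrow> merge I J (x, y) (l, i) = x (l, i)" if "i < n" for y i l
    using that by (auto simp: merge_def I_def J_def)
  have e_eq: "gram_schmidt n (data_columns (merge I J (x, y))) l i = e l i" if "l \<le> k" "i < n" for y l i
    unfolding e_def using that by (intro gram_schmidt_cong) (auto simp: data_columns_def mrg)
  have proj: "(\<Sum>i\<in>J. u l i * y i) = dot n (\<lambda>i. y (k, i)) (e l) / sqrt (N l)" for l y
    by (simp add: sumJ u_def dot_def sum_divide_distrib mult_ac)
  have proj2: "(\<Sum>i\<in>J. u l i * y i)\<^sup>2 = (dot n (\<lambda>i. y (k, i)) (e l))\<^sup>2 / N l" if "l \<le> k" for l y
    unfolding proj using N[OF that] by (simp add: power_divide)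
  have r: "resid n (merge I J (x, y)) k = (\<Sum>i\<in>J. (y i)\<^sup>2) - (\<Sum>l\<le>k. (\<Sum>i\<in>J. u l i * y i)\<^sup>2)" for y
  proof -
    let ?z = "merge I J (x, y)"
    have "resid n ?z k = dot n (data_columns ?z (Suc k)) (data_columns ?z (Suc k)) -
      (\<Sum>l<Suc k. (dot n (data_columns ?z (Suc k)) (gram_schmidt n (data_columns ?z) l))\<^sup>2 / dot n (gram_schmidt n (data_columns ?z) l) (gram_schmidt n (data_columns ?z) l))"
      unfolding resid_def by (rule dot_gram_schmidt_self)
    also have "dot n (data_columns ?z (Suc k)) (data_columns ?z (Suc k)) = (\<Sum>i\<in>J. (y i)\<^sup>2)"
      by (simp add: sumJ dot_def data_columns_def mrg power2_eq_square)
    also have "(\<Sum>l<Suc k. (dot n (data_columns ?z (Suc k)) (gram_schmidt n (data_columns ?z) l))\<^sup>2 / dot n (gram_schmidt n (data_columns ?z) l) (gram_schmidt n (data_columns ?z) l))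
      = (\<Sum>l\<le>k. (\<Sum>i\<in>J. u l i * y i)\<^sup>2)"
    proof (rule sum.cong)
      fix l assume "l \<in> {..k}"
      hence l: "l \<le> k" by simp
      have "dot n (data_columns ?z (Suc k)) (gram_schmidt n (data_columns ?z) l) = dot n (\<lambda>i. y (k, i)) (e l)"
        by (rule dot_cong) (auto simp: data_columns_def mrg e_eq l)
      moreover have "dot n (gram_schmidt n (data_columns ?z) l) (gram_schmidt n (data_columns ?z) l) = N l"
        unfolding N_def by (rule dot_cong) (auto simp: e_eq l)
      ultimately show "(dot n (data_columns ?z (Suc k)) (gram_schmidt n (data_columns ?z) l))\<^sup>2 / dot n (gram_schmidt n (data_columns ?z) l) (gram_schmidt n (data_columns ?z) l)
        = (\<Sum>i\<in>J. u l i * y i)\<^sup>2" unfolding proj2[OF l] by simp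
    qed auto
    finally show ?thesis .
  qed
  have t: "total_var n (merge I J (x, y)) k = (\<Sum>i\<in>J. (y i)\<^sup>2) - (\<Sum>i\<in>J. u 0 i * y i)\<^sup>2" for y
    unfolding total_var_eq proj2[of 0, simplified]
    by (simp add: sumJ mrg e_def N_def gram_schmidt_data_columns_0 dot_def)
  have ws: "(\<Sum>l\<le>k. w l * f l) = \<phi> * (\<Sum>l\<le>k. f l) + \<theta> * f 0" for f :: "nat \<Rightarrow> real"
  proof -
    have ws: "(\<Sum>l\<le>k. w l * f l) = (\<Sum>l\<le>k. \<phi> * f l + (if l = 0 then \<theta> * f 0 else 0))"
      by (intro sum.cong) (auto simp: w_def algebra_simps)
    thus ?thesis by (simp add: sum.distrib sum_distrib_left)
  qed
  have form: "\<phi> * resid n (merge I J (x, y)) k + \<theta> * total_var n (merge I J (x, y)) k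
     = (\<phi> + \<theta>) * (\<Sum>i\<in>J. (y i)\<^sup>2) - (\<Sum>l\<le>k. w l * (\<Sum>i\<in>J. u l i * y i)\<^sup>2)" for y
    unfolding ws r t by (simp only: algebra_simps)
  have "(\<integral>\<^sup>+y. ennreal (exp (- (\<phi> * resid n (merge I J (x, y)) k + \<theta> * total_var n (merge I J (x, y)) k) / 2)) \<partial>gauss_PiM J)
    = ennreal ((1 + (\<phi> + \<theta>)) powr (- real (card J) / 2) * (\<Prod>l\<le>k. (1 - w l / (1 + (\<phi> + \<theta>))) powr (-1/2)))"
    unfolding form
  proof (rule nn_integral_PiM_std_normal_exp_quadratic_form)
    show "(\<Sum>i\<in>J. u l i * u l' i) = (if l = l' then 1 else 0)" if "l \<in> {..k}" "l' \<in> {..k}" for l l'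
    proof -
      have "(\<Sum>i\<in>J. u l i * u l' i) = dot n (e l) (e l') / (sqrt (N l) * sqrt (N l'))"
        by (simp add: sumJ u_def dot_def sum_divide_distrib)
      also have "\<dots> = (if l = l' then 1 else 0)"
      proof -
        have "dot n (e l) (e l') = (if l = l' then N l else 0)" by (auto simp: N_def e_def dot_gram_schmidt)
        thus ?thesis using N[of l] that by auto
      qed
      finally show ?thesis .
    qed
  qed (use nonneg in \<open>auto simp: J_def w_def\<close>)
  also have "(\<Prod>l\<le>k. (1 - w l / (1 + (\<phi> + \<theta>))) powr (-1/2)) = (1 / \<kappa>) powr (-1/2) * ((1 + \<theta>) / \<kappa>) powr (- real k / 2)"
  proof -
    have "(\<Prod>l\<le>k. (1 - w l / \<kappa>) powr (-1/2)) = (1 - w 0 / \<kappa>) powr (-1/2) * (\<Prod>l=1..k. (1 - w l / \<kappa>) powr (-1/2))"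
      by (simp add: atMost_atLeast0 prod.atLeast_Suc_atMost)
    also have "1 - w 0 / \<kappa> = 1 / \<kappa>" using \<kappa> by (simp add: w_def field_simps)
    also have "(\<Prod>l=1..k. (1 - w l / \<kappa>) powr (-1/2)) = (\<Prod>l=1..k. ((1 + \<theta>) / \<kappa>) powr (-1/2))"
      using \<kappa> by (intro prod.cong) (auto simp: w_def field_simps)
    also have "\<dots> = ((1 + \<theta>) / \<kappa>) powr (- real k / 2)"
      using \<kappa> nonneg by (simp only: prod_constant card_atLeastAtMost, subst powr_power) auto
    finally show ?thesis unfolding \<kappa>(2) .
  qed
  also have "(1 + (\<phi> + \<theta>)) powr (- real (card J) / 2) * ((1 / \<kappa>) powr (-1/2) * ((1 + \<theta>) / \<kappa>) powr (- real k / 2))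
    = \<kappa> powr (- (real n - 1 - real k) / 2) * (1 + \<theta>) powr (- real k / 2)"
  proof -
    have "(1 / \<kappa>) powr (-1/2) = \<kappa> powr (1/2)" using \<kappa> by (simp add: powr_divide powr_minus field_simps)
    moreover have "((1 + \<theta>) / \<kappa>) powr (- real k / 2) = (1 + \<theta>) powr (- real k / 2) * \<kappa> powr (real k / 2)"
      using \<kappa> nonneg by (simp add: powr_divide powr_minus field_simps)
    moreover have "- real n / 2 + 1 / 2 + real k / 2 = - (real n - 1 - real k) / 2" by (simp add: field_simps)
    hence "\<kappa> powr (- (real n - 1 - real k) / 2) = \<kappa> powr (- real n / 2) * \<kappa> powr (1/2) * \<kappa> powr (real k / 2)"
      by (metis powr_add)
    ultimately show ?thesis by (simp add: J_def \<kappa>(2)[symmetric] mult_ac)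
  qed
  finally show ?thesis by (simp add: \<kappa>_def)
qed

text \<open>Under the law tilted by the \<open>\<theta>\<close>-factor, the residual has a transform
  of Gamma type whose shape is half of its \<open>n - 1 - k\<close> degrees of freedom.\<close>

lemma column_moment:
  fixes x :: "nat \<times> nat \<Rightarrow> real" and n k :: nat and s \<theta> :: real
  defines "I \<equiv> {..<k} \<times> {..<n}" and "J \<equiv> {k} \<times> {..<n}"
  assumes x: "x \<in> space (gauss_PiM I)" and n: "real k < real n - 1" and s: "(real n - 1 - real k) / 2 + s > 0"
    and pos: "\<And>l. l < k \<Longrightarrow> resid n x l > 0" and \<theta>: "0 \<le> \<theta>"
  shows "(\<integral>\<^sup>+y. ennreal (resid n (merge I J (x, y)) k powr s * exp (- \<theta> * total_var n (merge I J (x, y)) k / 2)) \<partial>gauss_PiM J)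
    = ennreal ((1 + \<theta>) powr (- (real n - 1) / 2 - s) * 2 powr s * Gamma ((real n - 1 - real k) / 2 + s) / Gamma ((real n - 1 - real k) / 2))"
proof -
  define R where "R y = resid n (merge I J (x, y)) k" for y
  define T where "T y = total_var n (merge I J (x, y)) k" for y
  have IJ: "I \<union> J = {..k} \<times> {..<n}" by (auto simp: I_def J_def)
  have m [measurable]: "(\<lambda>y. merge I J (x, y)) \<in> measurable (gauss_PiM J) (gauss_PiM (I \<union> J))"
    by (rule measurable_compose[OF measurable_Pair1'[OF x] measurable_merge])
  have [measurable]: "R \<in> borel_measurable (gauss_PiM J)" unfolding R_def
    by (rule measurable_compose[OF m borel_measurable_resid]) (simp add: IJ)
  have [measurable]: "T \<in> borel_measurable (gauss_PiM J)" unfolding T_def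
    by (rule measurable_compose[OF m borel_measurable_total_var]) (simp add: IJ)
  have R0: "R y \<ge> 0" for y by (simp add: R_def resid_nonneg)
  define d where "d = (real n - 1 - real k) / 2"
  have d: "d > 0" "d + s > 0" using n s by (auto simp: d_def)
  define N where "N = density (gauss_PiM J) (\<lambda>y. ennreal (exp (- \<theta> * T y / 2)))"
  have [measurable_cong]: "sets N = sets (gauss_PiM J)" by (simp add: N_def)
  define C where "C = (1 + \<theta>) powr (- (real n - 1) / 2)"
  have mom: "(\<integral>\<^sup>+y. ennreal ((R y * ((1 + \<theta>) / 2)) powr s) \<partial>N) = ennreal (C * Gamma (d + s) / Gamma d)"
  proof (rule nn_integral_powr_if_Laplace)
    fix t :: real assume t: "t \<ge> 0"
    have "(\<integral>\<^sup>+y. ennreal (exp (- t * (R y * ((1 + \<theta>) / 2)))) \<partial>N) =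
       (\<integral>\<^sup>+y. ennreal (exp (- (t * (1 + \<theta>) * R y + \<theta> * T y) / 2)) \<partial>gauss_PiM J)"
      unfolding N_def
      by (subst nn_integral_density) (auto simp: ennreal_mult'[symmetric] field_simps simp flip: exp_add intro!: nn_integral_cong)
    also have "\<dots> = ennreal ((1 + t * (1 + \<theta>) + \<theta>) powr (- (real n - 1 - real k) / 2) * (1 + \<theta>) powr (- real k / 2))"
      unfolding R_def T_def I_def J_def using n pos t \<theta> by (intro column_Laplace) auto
    \<comment> \<open>The rescaling of \<open>R\<close> by \<open>(1 + \<theta>) / 2\<close> is
      chosen for this factorization, which isolates \<open>1 + t\<close>.\<close>
    also have "1 + t * (1 + \<theta>) + \<theta> = (1 + \<theta>) * (1 + t)" by (simp add: algebra_simps)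
    also have "((1 + \<theta>) * (1 + t)) powr (- (real n - 1 - real k) / 2) * (1 + \<theta>) powr (- real k / 2)
      = ((1 + \<theta>) powr (- (real n - 1 - real k) / 2) * (1 + \<theta>) powr (- real k / 2)) * (1 + t) powr (- d)"
    proof -
      have "- (real n - 1 - real k) / 2 = - d" by (simp only: d_def minus_divide_left)
      thus ?thesis using t \<theta> by (simp only: powr_mult mult_ac)
    qed
    also have "(1 + \<theta>) powr (- (real n - 1 - real k) / 2) * (1 + \<theta>) powr (- real k / 2) = C"
      unfolding C_def powr_add[symmetric] by (rule arg_cong[where f = "(powr) (1 + \<theta>)"]) (simp add: field_simps)
    finally show "(\<integral>\<^sup>+y. ennreal (exp (- t * (R y * ((1 + \<theta>) / 2)))) \<partial>N) = ennreal (C * (1 + t) powr (- d))" .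
  qed (use d R0 \<theta> in \<open>auto simp: C_def\<close>)
  have "(\<integral>\<^sup>+y. ennreal (R y powr s * exp (- \<theta> * T y / 2)) \<partial>gauss_PiM J)
     = (\<integral>\<^sup>+y. ennreal (((1 + \<theta>) / 2) powr (-s)) * ennreal ((R y * ((1 + \<theta>) / 2)) powr s) \<partial>N)"
    unfolding N_def
  proof (subst nn_integral_density)
    have *: "((1 + \<theta>) / 2) powr (-s) * (R y * ((1 + \<theta>) / 2)) powr s = R y powr s" for y
      using \<theta> R0[of y] by (subst powr_mult) (auto simp: powr_minus field_simps)
    show "(\<integral>\<^sup>+y. ennreal (R y powr s * exp (- \<theta> * T y / 2)) \<partial>gauss_PiM J) =
      (\<integral>\<^sup>+y. ennreal (exp (- \<theta> * T y / 2)) * (ennreal (((1 + \<theta>) / 2) powr (-s)) * ennreal ((R y * ((1 + \<theta>) / 2)) powr s)) \<partial>gauss_PiM J)"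
      by (intro nn_integral_cong) (simp only: ennreal_mult''[symmetric] powr_ge_zero exp_ge_zero * mult.commute)
  qed auto
  also have "\<dots> = ennreal (((1 + \<theta>) / 2) powr (-s)) * ennreal (C * Gamma (d + s) / Gamma d)"
    unfolding mom[symmetric] by (rule nn_integral_cmult) measurable
  also have "\<dots> = ennreal (((1 + \<theta>) / 2) powr (-s) * (C * Gamma (d + s) / Gamma d))"
    by (rule ennreal_mult'[symmetric]) simp
  also have "((1 + \<theta>) / 2) powr (-s) = (1 + \<theta>) powr (-s) * 2 powr s"
    using \<theta> by (simp add: powr_divide powr_minus field_simps)
  also have "(1 + \<theta>) powr (-s) * 2 powr s * (C * Gamma (d + s) / Gamma d) = ((1 + \<theta>) powr (-s) * C) * 2 powr s * Gamma (d + s) / Gamma d"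
    by simp
  also have "(1 + \<theta>) powr (-s) * C = (1 + \<theta>) powr (- (real n - 1) / 2 - s)"
    unfolding C_def powr_add[symmetric] by (simp add: algebra_simps)
  finally show ?thesis unfolding R_def T_def d_def .
qed

text \<open>Degenerate earlier columns need no separate treatment: \<open>0 powr s = 0\<close> for every \<open>s\<close>, including
  \<open>s = 0\<close>, so they make the integrand vanish.\<close>
lemma det_moment_Laplace:
  fixes n p :: nat and s \<theta> :: real
  assumes p: "p < n" and s: "\<And>j. j < p \<Longrightarrow> (real n - 1 - real j) / 2 + s > 0" and \<theta>: "0 \<le> \<theta>"
  shows "(\<integral>\<^sup>+z. ennreal (\<Prod>j<p. resid n z j powr s * exp (- \<theta> * total_var n z j / 2)) \<partial>gauss_PiM ({..<p} \<times> {..<n}))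
    = ennreal (\<Prod>j<p. (1 + \<theta>) powr (- (real n - 1) / 2 - s) * 2 powr s * Gamma ((real n - 1 - real j) / 2 + s) / Gamma ((real n - 1 - real j) / 2))"
  using p s
proof (induction p)
  case 0
  interpret prob_space "gauss_PiM ({} :: (nat \<times> nat) set)"
    by (rule prob_space_PiM) (use real_dist_normal_dist in \<open>simp add: real_distribution_def\<close>)
  show ?case by (simp add: emeasure_space_1)
next
  case (Suc p)
  interpret G: real_distribution std_normal_distribution by (rule real_dist_normal_dist)
  interpret P: product_sigma_finite "\<lambda>_::nat \<times> nat. std_normal_distribution" ..
  define I where "I = {..<p} \<times> {..<n}"
  define J where "J = {p} \<times> {..<n}"
  have IJ: "I \<inter> J = {}" "finite I" "finite J" "{..<Suc p} \<times> {..<n} = I \<union> J"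
    by (auto simp: I_def J_def)
  define h where "h z j = resid n z j powr s * exp (- \<theta> * total_var n z j / 2)" for z j
  define c where "c j = (1 + \<theta>) powr (- (real n - 1) / 2 - s) * 2 powr s * Gamma ((real n - 1 - real j) / 2 + s) / Gamma ((real n - 1 - real j) / 2)" for j :: nat
  have h_meas: "(\<lambda>z. h z j) \<in> borel_measurable (gauss_PiM A)" if "{..j} \<times> {..<n} \<subseteq> A" for A j
    unfolding h_def using borel_measurable_resid[OF that] borel_measurable_total_var[OF that] by measurable
  have h0: "h z j \<ge> 0" for z j by (simp add: h_def)
  have c0: "c j \<ge> 0" if "j < Suc p" for j
    using Suc.prems(1) Suc.prems(2)[OF that] that
    by (auto simp: c_def intro!: divide_nonneg_nonneg mult_nonneg_nonneg Gamma_real_nonneg)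
  have "(\<integral>\<^sup>+z. ennreal (\<Prod>j<Suc p. h z j) \<partial>gauss_PiM ({..<Suc p} \<times> {..<n}))
    = (\<integral>\<^sup>+x. \<integral>\<^sup>+y. ennreal (\<Prod>j<Suc p. h (merge I J (x, y)) j) \<partial>gauss_PiM J \<partial>gauss_PiM I)"
    unfolding IJ(4)
  proof (rule P.product_nn_integral_fold[OF IJ(1-3)])
    show "(\<lambda>z. ennreal (\<Prod>j<Suc p. h z j)) \<in> borel_measurable (gauss_PiM (I \<union> J))"
      by (intro measurable_compose[OF _ measurable_ennreal] borel_measurable_prod h_meas) (auto simp: I_def J_def)
  qed
  \<comment> \<open>The newest column is integrated first; its contribution is the constant
    \<open>c p\<close>, and the older factors are untouched by \<open>merge\<close>.\<close>
  also have "\<dots> = (\<integral>\<^sup>+x. ennreal (\<Prod>j<p. h x j) * ennreal (c p) \<partial>gauss_PiM I)"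
  proof (rule nn_integral_cong)
    fix x assume x: "x \<in> space (gauss_PiM I)"
    have h_old: "h (merge I J (x, y)) j = h x j" if "j < p" for y j
    proof -
      have "merge I J (x, y) (l, i) = x (l, i)" if "l \<le> j" "i < n" for l i
        using that \<open>j < p\<close> by (auto simp: merge_def I_def)
      thus ?thesis unfolding h_def
        using resid_cong[of j n "merge I J (x, y)" x] total_var_cong[of n "merge I J (x, y)" j x] by auto
    qed
    have hp: "(\<lambda>y. h (merge I J (x, y)) p) \<in> borel_measurable (gauss_PiM J)"
      by (rule measurable_compose[OF measurable_compose[OF measurable_Pair1'[OF x] measurable_merge] h_meas]) (auto simp: I_def J_def)
    have "(\<integral>\<^sup>+y. ennreal (\<Prod>j<Suc p. h (merge I J (x, y)) j) \<partial>gauss_PiM J)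
      = (\<integral>\<^sup>+y. ennreal (\<Prod>j<p. h x j) * ennreal (h (merge I J (x, y)) p) \<partial>gauss_PiM J)"
      by (simp add: h_old ennreal_mult'' h0)
    also have "\<dots> = ennreal (\<Prod>j<p. h x j) * (\<integral>\<^sup>+y. ennreal (h (merge I J (x, y)) p) \<partial>gauss_PiM J)"
      by (rule nn_integral_cmult) (use hp in measurable)
    also have "\<dots> = ennreal (\<Prod>j<p. h x j) * ennreal (c p)"
    proof (cases "\<forall>j<p. resid n x j > 0")
      case True
      have "(\<integral>\<^sup>+y. ennreal (h (merge I J (x, y)) p) \<partial>gauss_PiM J) = ennreal (c p)"
        unfolding h_def c_def I_def J_def using x True Suc.prems \<theta> by (intro column_moment) (auto simp: I_def)
      thus ?thesis by simp
    next
      case False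
      then obtain j where "j < p" "resid n x j = 0" using resid_nonneg[of n x] by (metis order_le_less)
      hence "(\<Prod>j<p. h x j) = 0" by (auto simp: h_def prod_zero_iff)
      thus ?thesis by (simp only: ennreal_0 mult_zero_left)
    qed
    finally show "(\<integral>\<^sup>+y. ennreal (\<Prod>j<Suc p. h (merge I J (x, y)) j) \<partial>gauss_PiM J) = ennreal (\<Prod>j<p. h x j) * ennreal (c p)" .
  qed
  also have "\<dots> = (\<integral>\<^sup>+x. ennreal (\<Prod>j<p. h x j) \<partial>gauss_PiM I) * ennreal (c p)"
    by (rule nn_integral_multc) (intro measurable_compose[OF _ measurable_ennreal] borel_measurable_prod h_meas, auto simp: I_def)
  also have "(\<integral>\<^sup>+x. ennreal (\<Prod>j<p. h x j) \<partial>gauss_PiM I) = ennreal (\<Prod>j<p. c j)"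
    unfolding h_def c_def I_def by (rule Suc.IH) (use Suc.prems in auto)
  also have "\<dots> * ennreal (c p) = ennreal (\<Prod>j<Suc p. c j)"
    using c0 by (simp add: ennreal_mult'')
  finally show ?case unfolding h_def c_def .
qed

section \<open>Moments and positivity of the statistic under standard normal data\<close>

definition lr_stat :: "nat \<Rightarrow> nat \<Rightarrow> (nat \<times> nat \<Rightarrow> real) \<Rightarrow> real" where
  "lr_stat n p z = (\<Prod>j<p. resid n z j) * ((\<Sum>j<p. total_var n z j) / real p) powr (- real p)"

text \<open>The product belongs to the residuals, with \<open>n - 1 - j\<close> degrees of freedom
  each, and the last quotient to the trace, with \<open>p * (n - 1)\<close>. Powers of 2 from the
  two sources have cancelled.\<close>

definition lr_moment :: "nat \<Rightarrow> nat \<Rightarrow> real \<Rightarrow> real" where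
  "lr_moment n p s = real p powr (real p * s) *
     (\<Prod>j<p. Gamma ((real n - 1 - real j) / 2 + s) / Gamma ((real n - 1 - real j) / 2)) *
     (Gamma (real p * (real n - 1) / 2) / Gamma (real p * (real n - 1) / 2 + real p * s))"

lemma borel_measurable_lr_stat: "lr_stat n p \<in> borel_measurable (gauss_PiM ({..<p} \<times> {..<n}))"
proof -
  have "{..j} \<times> {..<n} \<subseteq> {..<p} \<times> {..<n}" if "j < p" for j using that by auto
  note [measurable] = borel_measurable_resid[OF this] borel_measurable_total_var[OF this]
  have [measurable]: "(\<lambda>z. \<Prod>j<p. resid n z j) \<in> borel_measurable (gauss_PiM ({..<p} \<times> {..<n}))"
    "(\<lambda>z. \<Sum>j<p. total_var n z j) \<in> borel_measurable (gauss_PiM ({..<p} \<times> {..<n}))"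
    by (intro borel_measurable_prod borel_measurable_sum; simp)+
  show ?thesis unfolding lr_stat_def by measurable
qed

text \<open>This is the determinant moment at \<open>s = 0\<close> and \<open>\<theta> = 0\<close>:
  because \<open>0 powr 0 = 0\<close>, the integrand is the indicator of the event that no residual
  vanishes, and the moment formula evaluates to 1.\<close>

lemma AE_lr_stat_pos:
  assumes p: "0 < p" "p < n"
  shows "AE z in gauss_PiM ({..<p} \<times> {..<n}). lr_stat n p z > 0"
proof -
  let ?P = "gauss_PiM ({..<p} \<times> {..<n})"
  interpret prob_space ?P
    by (rule prob_space_PiM) (use real_dist_normal_dist in \<open>simp add: real_distribution_def\<close>)
  have "{..j} \<times> {..<n} \<subseteq> {..<p} \<times> {..<n}" if "j < p" for j using that by auto
  note [measurable] = borel_measurable_resid[OF this]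
  define E where "E = {z\<in>space ?P. \<forall>j\<in>{..<p}. resid n z j > 0}"
  have E [measurable]: "E \<in> sets ?P" unfolding E_def 
    by (rule sets.sets_Collect_finite_All) (auto intro!: borel_measurable_less)
  have Gp: "Gamma ((real n - 1 - real j) / 2) > 0" if "j < p" for j
    using that p by (intro Gamma_real_pos) auto
  have "emeasure ?P E = (\<integral>\<^sup>+z. indicator E z \<partial>?P)" by simp
  also have "\<dots> = (\<integral>\<^sup>+z. ennreal (\<Prod>j<p. resid n z j powr 0 * exp (- 0 * total_var n z j / 2)) \<partial>?P)"
  proof (rule nn_integral_cong)
    fix z assume z: "z \<in> space ?P"
    have "(\<Prod>j<p. resid n z j powr 0 * exp (- 0 * total_var n z j / 2)) = (if z \<in> E then 1 else 0)"
      using z resid_nonneg[of n z] by (auto simp: E_def less_le)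
    thus "indicator E z = ennreal (\<Prod>j<p. resid n z j powr 0 * exp (- 0 * total_var n z j / 2))"
      by (simp add: indicator_def)
  qed
  also have "\<dots> = 1" using p by (subst det_moment_Laplace) (auto simp: Gp less_imp_neq[OF Gp, symmetric])
  finally have "AE z in ?P. z \<in> E" using E by (simp add: AE_iff_emeasure_eq_1 emeasure_eq_measure E_def)
  thus ?thesis
  proof eventually_elim
    fix z assume "z \<in> E"
    hence r: "resid n z j > 0" if "j < p" for j using that by (auto simp: E_def)
    have "0 < total_var n z j" if "j < p" for j using r[OF that] resid_le_total_var[of n z j] by linarith
    hence "0 < (\<Sum>j<p. total_var n z j)" using p by (intro sum_pos) auto
    thus "lr_stat n p z > 0" using p r by (auto simp: lr_stat_def intro!: mult_pos_pos prod_pos)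
  qed
qed

lemma nn_integral_lr_stat_powr:
  assumes p: "0 < p" "p < n" and s: "\<And>j. j < p \<Longrightarrow> (real n - 1 - real j) / 2 + s > 0"
  shows "(\<integral>\<^sup>+z. ennreal (lr_stat n p z powr s) \<partial>gauss_PiM ({..<p} \<times> {..<n})) = ennreal (lr_moment n p s)"
proof -
  let ?P = "gauss_PiM ({..<p} \<times> {..<n})"
  have "{..j} \<times> {..<n} \<subseteq> {..<p} \<times> {..<n}" if "j < p" for j using that by auto
  note [measurable] = borel_measurable_resid[OF this] borel_measurable_total_var[OF this]
  define H where "H z = (\<Prod>j<p. resid n z j powr s)" for z
  define X where "X z = (\<Sum>j<p. total_var n z j) / 2" for z
  have [measurable]: "H \<in> borel_measurable ?P" "X \<in> borel_measurable ?P"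
    unfolding H_def X_def by (intro borel_measurable_prod borel_measurable_divide borel_measurable_sum; simp)+
  have H0: "H z \<ge> 0" and X0: "X z \<ge> 0" for z
    by (auto simp: H_def X_def intro!: prod_nonneg sum_nonneg total_var_nonneg)
  define N where "N = density ?P (\<lambda>z. ennreal (H z))"
  have [measurable_cong]: "sets N = sets ?P" by (simp add: N_def)
  define g where "g j = Gamma ((real n - 1 - real j) / 2 + s) / Gamma ((real n - 1 - real j) / 2)" for j :: nat
  have g: "g j > 0" if "j < p" for j
    using that p s[OF that] by (auto simp: g_def intro!: divide_pos_pos Gamma_real_pos)
  define C where "C = (\<Prod>j<p. 2 powr s * g j)"
  have C: "C \<ge> 0" unfolding C_def by (intro prod_nonneg ballI mult_nonneg_nonneg) (auto intro: less_imp_le g)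
  define b where "b = real p * (real n - 1) / 2"
  \<comment> \<open>Tilting by the \<open>s\<close>-th power of the determinant raises the shape of
    the trace from \<open>b\<close> to \<open>a\<close>; the exponent \<open>- (real p * s)\<close>
    then leads back to \<open>b\<close>, so \<open>Gamma b\<close> lands in the numerator.\<close>
  define a where "a = b + real p * s"
  have b: "b > 0" using p by (auto simp: b_def)
  have "a = real p * ((real n - 1) / 2 + s)" by (simp add: a_def b_def field_simps)
  hence a: "a > 0" using p s[of 0] by simp
  have lap: "(\<integral>\<^sup>+z. ennreal (X z powr (- (real p * s))) \<partial>N) = ennreal (C * Gamma (a + - (real p * s)) / Gamma a)"
  proof (rule nn_integral_powr_if_Laplace)
    fix t :: real assume t: "t \<ge> 0"
    have "(\<integral>\<^sup>+z. ennreal (exp (- t * X z)) \<partial>N) = (\<integral>\<^sup>+z. ennreal (\<Prod>j<p. resid n z j powr s * exp (- t * total_var n z j / 2)) \<partial>?P)"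
      unfolding N_def
    proof (subst nn_integral_density)
      have "exp (- t * X z) = (\<Prod>j<p. exp (- t * total_var n z j / 2))" for z
        by (simp add: X_def exp_sum[symmetric] sum_distrib_left sum_divide_distrib sum_negf)
      thus "(\<integral>\<^sup>+z. ennreal (H z) * ennreal (exp (- t * X z)) \<partial>?P) = 
          (\<integral>\<^sup>+z. ennreal (\<Prod>j<p. resid n z j powr s * exp (- t * total_var n z j / 2)) \<partial>?P)"
        using H0 by (intro nn_integral_cong) (simp add: H_def prod.distrib ennreal_mult')
    qed auto
    also have "\<dots> = ennreal (\<Prod>j<p. (1 + t) powr (- (real n - 1) / 2 - s) * (2 powr s * g j))"
      unfolding g_def using p s t by (subst det_moment_Laplace) (auto simp: mult_ac)
    also have "(\<Prod>j<p. (1 + t) powr (- (real n - 1) / 2 - s) * (2 powr s * g j)) = C * (1 + t) powr (- a)"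
    proof -
      have "((1 + t) powr (- (real n - 1) / 2 - s)) ^ p = (1 + t) powr ((- (real n - 1) / 2 - s) * real p)"
        using t by (subst powr_power) (auto simp: mult.commute)
      also have "(- (real n - 1) / 2 - s) * real p = - a" by (simp add: a_def b_def field_simps)
      finally show ?thesis by (simp only: prod.distrib prod_constant card_lessThan C_def mult_ac)
    qed
    finally show "(\<integral>\<^sup>+z. ennreal (exp (- t * X z)) \<partial>N) = ennreal (C * (1 + t) powr (- a))" .
  qed (use X0 C a b in \<open>auto simp: a_def\<close>)
  have "(\<integral>\<^sup>+z. ennreal (lr_stat n p z powr s) \<partial>?P) = (\<integral>\<^sup>+z. ennreal ((2 / real p) powr (- (real p * s))) * ennreal (X z powr (- (real p * s))) \<partial>N)"
    unfolding N_def
  proof (subst nn_integral_density)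
    have "lr_stat n p z powr s = H z * ((2 / real p) powr (- (real p * s)) * X z powr (- (real p * s)))" for z
    proof -
      have "lr_stat n p z powr s = (\<Prod>j<p. resid n z j) powr s * ((\<Sum>j<p. total_var n z j) / real p) powr (- (real p * s))"
        unfolding lr_stat_def by (subst powr_mult) (auto simp: powr_powr prod_nonneg resid_nonneg)
      also have "(\<Prod>j<p. resid n z j) powr s = H z"
        unfolding H_def by (rule prod_powr_distrib)
      also have "(\<Sum>j<p. total_var n z j) / real p = 2 / real p * X z" by (simp add: X_def)
      also have "(2 / real p * X z) powr (- (real p * s)) = (2 / real p) powr (- (real p * s)) * X z powr (- (real p * s))"
        using p X0 by (subst powr_mult) auto
      finally show ?thesis .
    qed
    thus "(\<integral>\<^sup>+z. ennreal (lr_stat n p z powr s) \<partial>?P) =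
       (\<integral>\<^sup>+z. ennreal (H z) * (ennreal ((2 / real p) powr (- (real p * s))) * ennreal (X z powr (- (real p * s)))) \<partial>?P)"
      using H0 by (intro nn_integral_cong) (simp only: ennreal_mult' powr_ge_zero)
  qed auto
  also have "\<dots> = ennreal ((2 / real p) powr (- (real p * s))) * ennreal (C * Gamma (a + - (real p * s)) / Gamma a)"
    unfolding lap[symmetric] by (rule nn_integral_cmult) measurable
  also have "\<dots> = ennreal ((2 / real p) powr (- (real p * s)) * (C * Gamma (a + - (real p * s)) / Gamma a))"
    by (rule ennreal_mult'[symmetric]) simp
  also have "(2 / real p) powr (- (real p * s)) * (C * Gamma (a + - (real p * s)) / Gamma a) = lr_moment n p s"
  proof -
    have "C = 2 powr (real p * s) * (\<Prod>j<p. g j)"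
    proof -
      have "(2 powr s) ^ p = 2 powr (s * real p)" by (subst powr_power) (auto simp: mult.commute)
      thus ?thesis by (simp add: C_def prod.distrib mult_ac)
    qed
    moreover have "(2 / real p) powr (- (real p * s)) = real p powr (real p * s) * 2 powr (- (real p * s))"
      using p by (simp add: powr_divide powr_minus field_simps)
    moreover have "a + - (real p * s) = b" by (simp add: a_def)
    ultimately have "(2 / real p) powr (- (real p * s)) * (C * Gamma (a + - (real p * s)) / Gamma a)
      = (2 powr (- (real p * s)) * 2 powr (real p * s)) * (real p powr (real p * s) * (\<Prod>j<p. g j) * (Gamma b / Gamma a))"
      by (simp only: divide_inverse mult_ac)
    also have "2 powr (- (real p * s)) * 2 powr (real p * s) = (1::real)" by (simp flip: powr_add)
    finally show ?thesis by (simp add: lr_moment_def g_def a_def b_def)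
  qed
  finally show ?thesis .
qed

section \<open>From multivariate normal samples to independent standard normal coordinates\<close>

text \<open>Evaluation at 1 suffices, because scalings are absorbed into the coefficients of the
  linear combination. The degenerate variance 0 is included since it occurs for the zero
  combination.\<close>

lemma (in prob_space) char_normal_rv:
  assumes "normal_rv M Y m v"
  shows "char (distr M borel (\<lambda>\<omega>. Y \<omega> - m)) 1 = of_real (exp (- v / 2))" and "random_variable borel Y"
proof -
  show Y [measurable]: "random_variable borel Y"
    using assms by (auto simp: normal_rv_def distributed_def split: if_splits)
  have c: "char (distr M borel (\<lambda>\<omega>. Y \<omega> - m)) 1 = (\<integral>\<omega>. iexp (Y \<omega> - m) \<partial>M)"
    by (simp add: char_def integral_distr)
  show "char (distr M borel (\<lambda>\<omega>. Y \<omega> - m)) 1 = of_real (exp (- v / 2))"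
  proof (cases "v = 0")
    case True
    have "AE \<omega> in M. Y \<omega> = m" using assms True by (simp add: normal_rv_def)
    hence "(\<integral>\<omega>. iexp (Y \<omega> - m) \<partial>M) = (\<integral>\<omega>. 1 \<partial>M)"
      by (intro integral_cong_AE) auto
    thus ?thesis using True c by (simp add: prob_space)
  next
    case False
    hence v: "v > 0" "distributed M lborel Y (normal_density m (sqrt v))" using assms by (auto simp: normal_rv_def)
    hence "distributed M lborel (\<lambda>\<omega>. (Y \<omega> - m) / sqrt v) std_normal_density"
      using normal_standard_normal_convert[of "sqrt v" Y m] by simp
    hence d: "distr M borel (\<lambda>\<omega>. (Y \<omega> - m) / sqrt v) = std_normal_distribution"
      by (simp add: distributed_def cong: distr_cong)
    have "(\<integral>\<omega>. iexp (Y \<omega> - m) \<partial>M) = (\<integral>\<omega>. iexp (sqrt v * ((Y \<omega> - m) / sqrt v)) \<partial>M)"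
    proof -
      have "sqrt v * ((Y \<omega> - m) / sqrt v) = Y \<omega> - m" for \<omega> using v(1) by simp
      thus ?thesis by (simp only:)
    qed
    also have "\<dots> = char (distr M borel (\<lambda>\<omega>. (Y \<omega> - m) / sqrt v)) (sqrt v)"
      unfolding char_def by (rule integral_distr[symmetric]) measurable
    also have "\<dots> = of_real (exp (- v / 2))" unfolding d char_std_normal_distribution using v by simp
    finally show ?thesis using c by simp
  qed
qed

text \<open>Independence of the observations factors the joint characteristic function of all
  entries, and each factor is that of one normal linear combination, which splits over coordinates
  because the covariance is a multiple of the identity.\<close>

lemma (in prob_space) distr_standardized_mvn:
  fixes X :: "nat \<Rightarrow> 'a \<Rightarrow> nat \<Rightarrow> real" and n p :: nat and lam :: real and mu :: "nat \<Rightarrow> real"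
  assumes lam: "lam > 0"
    and normal: "\<And>i. i < n \<Longrightarrow> mvn_rv M p (X i) mu (\<lambda>j k. if j = k then lam else 0)"
    and indep: "indep_vars (\<lambda>_. PiM {..<p} (\<lambda>_. borel)) (\<lambda>i \<omega>. restrict (X i \<omega>) {..<p}) {..<n}"
  defines "Z \<equiv> \<lambda>(j, i) \<omega>. (X i \<omega> j - mu j) / sqrt lam"
  shows "distr M (gauss_PiM ({..<p} \<times> {..<n})) (\<lambda>\<omega>. \<lambda>k\<in>{..<p} \<times> {..<n}. Z k \<omega>) = gauss_PiM ({..<p} \<times> {..<n})"
    and "\<And>i j. i < n \<Longrightarrow> j < p \<Longrightarrow> (\<lambda>\<omega>. X i \<omega> j) \<in> borel_measurable M"
proof -
  have norm: "normal_rv M (\<lambda>\<omega>. \<Sum>j<p. a j * X i \<omega> j) (\<Sum>j<p. a j * mu j) (lam * (\<Sum>j<p. (a j)\<^sup>2))" if "i < n" for a i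
  proof -
    have "(\<Sum>j<p. \<Sum>k<p. a j * (if j = k then lam else 0) * a k) = (\<Sum>j<p. \<Sum>k<p. if k = j then lam * (a j)\<^sup>2 else 0)"
      by (intro sum.cong) (auto simp: power2_eq_square)
    also have "\<dots> = lam * (\<Sum>j<p. (a j)\<^sup>2)" by (simp add: sum_distrib_left)
    finally show ?thesis using normal[OF that, unfolded mvn_rv_def, rule_format, of a] by (simp only:)
  qed
  show meas: "(\<lambda>\<omega>. X i \<omega> j) \<in> borel_measurable M" if "i < n" "j < p" for i j
  proof -
    \<comment> \<open>\<open>mvn_rv\<close> speaks of linear combinations only; the unit vector
      recovers a single coordinate.\<close>
    have "(\<Sum>l<p. (if l = j then 1 else 0) * X i \<omega> l) = (\<Sum>l<p. if l = j then X i \<omega> j else 0)" for \<omega>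
      by (intro sum.cong) auto
    hence "(\<Sum>l<p. (if l = j then 1 else 0) * X i \<omega> l) = X i \<omega> j" for \<omega> using that by simp
    thus ?thesis using char_normal_rv(2)[OF norm[OF that(1), of "\<lambda>l. if l = j then 1 else 0"]] by simp
  qed
  let ?I = "{..<p} \<times> {..<n}"
  show "distr M (gauss_PiM ?I) (\<lambda>\<omega>. \<lambda>k\<in>?I. Z k \<omega>) = gauss_PiM ?I"
  proof (rule distr_eq_PiM_if_char_eq_prod)
    show "random_variable borel (Z k)" if "k \<in> ?I" for k
      using that meas by (auto simp: Z_def intro!: borel_measurable_divide borel_measurable_diff)
    fix a :: "nat \<times> nat \<Rightarrow> real"
    define Y where "Y i \<omega> = (\<Sum>j<p. (a (j, i) / sqrt lam) * X i \<omega> j) - (\<Sum>j<p. (a (j, i) / sqrt lam) * mu j)" for i \<omega>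
    have "(\<Sum>k\<in>?I. a k * Z k \<omega>) = (\<Sum>j<p. \<Sum>i<n. a (j, i) * Z (j, i) \<omega>)" for \<omega>
      by (simp add: sum.cartesian_product split_def)
    also have "\<dots> \<omega> = (\<Sum>i<n. Y i \<omega>)" for \<omega>
      by (subst sum.swap) (simp add: Y_def Z_def sum_subtractf[symmetric] diff_divide_distrib algebra_simps)
    finally have sumY: "(\<Sum>k\<in>?I. a k * Z k \<omega>) = (\<Sum>i<n. Y i \<omega>)" for \<omega> .
    have indepY: "indep_vars (\<lambda>_. borel) Y {..<n}"
    proof -
      have "indep_vars (\<lambda>_. borel) (\<lambda>i \<omega>. (\<lambda>x. (\<Sum>j<p. (a (j, i) / sqrt lam) * x j) - (\<Sum>j<p. (a (j, i) / sqrt lam) * mu j)) (restrict (X i \<omega>) {..<p})) {..<n}"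
        by (rule indep_vars_compose2[OF indep]) 
          (intro borel_measurable_diff borel_measurable_sum borel_measurable_times borel_measurable_const measurable_component_singleton, auto)
      thus ?thesis by (simp add: Y_def[abs_def])
    qed
    have [measurable]: "Y i \<in> borel_measurable M" if "i < n" for i
      using indepY that by (auto simp: indep_vars_def)
    have charY: "char (distr M borel (Y i)) 1 = of_real (exp (- (\<Sum>j<p. (a (j, i))\<^sup>2) / 2))" if "i < n" for i
    proof -
      have "lam * (\<Sum>j<p. (a (j, i) / sqrt lam)\<^sup>2) = (\<Sum>j<p. (a (j, i))\<^sup>2)"
        using lam by (simp add: power_divide sum_divide_distrib[symmetric])
      thus ?thesis unfolding Y_def using char_normal_rv(1)[OF norm[OF that, of "\<lambda>j. a (j, i) / sqrt lam"]] by simp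
    qed
    have "(\<integral>\<omega>. iexp (\<Sum>k\<in>?I. a k * Z k \<omega>) \<partial>M) = char (distr M borel (\<lambda>\<omega>. \<Sum>i<n. Y i \<omega>)) 1"
      unfolding sumY by (simp add: char_def integral_distr)
    also have "\<dots> = (\<Prod>i<n. of_real (exp (- (\<Sum>j<p. (a (j, i))\<^sup>2) / 2)))"
      using char_distr_sum[OF indepY, of 1] charY by simp
    also have "\<dots> = of_real (\<Prod>i<n. \<Prod>j<p. exp (- (a (j, i))\<^sup>2 / 2))"
    proof -
      have "exp (- (\<Sum>j<p. (a (j, i))\<^sup>2) / 2) = (\<Prod>j<p. exp (- (a (j, i))\<^sup>2 / 2))" for i
        by (simp add: exp_sum[symmetric] sum_negf sum_divide_distrib)
      thus ?thesis by (simp only: of_real_prod)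
    qed
    also have "(\<Prod>i<n. \<Prod>j<p. exp (- (a (j, i))\<^sup>2 / 2)) = (\<Prod>k\<in>?I. exp (- (a k)\<^sup>2 / 2))"
      by (subst prod.swap) (simp add: prod.cartesian_product split_def)
    finally show "(\<integral>\<omega>. iexp (\<Sum>k\<in>?I. a k * Z k \<omega>) \<partial>M) = (\<Prod>k\<in>?I. char std_normal_distribution (a k))"
      by (simp add: char_std_normal_distribution)
  qed (auto simp: real_dist_normal_dist)
qed

subsection \<open>Asymptotics of the moments\<close>

text \<open>The series of \<open>1 / (x + k)\<^sup>2\<close> is squeezed between two telescoping
  series, with sums \<open>1 / x\<close> and \<open>1 / x + 1 / x\<^sup>2\<close>.\<close>

lemma trigamma_bounds:
  assumes x: "(x::real) > 0"
  shows "1 / x \<le> Polygamma 1 x" "Polygamma 1 x \<le> 1 / x + 1 / x\<^sup>2"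
proof -
  have tele1: "(\<lambda>k. 1 / (x + real k) - 1 / (x + real (Suc k))) sums (1 / (x + real 0) - 0)"
  proof (rule telescope_sums')
    show "(\<lambda>k. 1 / (x + real k)) \<longlonglongrightarrow> 0" by real_asymp
  qed
  have tele2: "(\<lambda>k. 1 / (x + real k)\<^sup>2 - 1 / (x + real (Suc k))\<^sup>2) sums (1 / (x + real 0)\<^sup>2 - 0)"
  proof (rule telescope_sums')
    show "(\<lambda>k. 1 / (x + real k)\<^sup>2) \<longlonglongrightarrow> 0" by real_asymp
  qed
  have S: "(\<lambda>k. inverse ((x + real k) ^ Suc 1)) sums Polygamma 1 x"
    using Polygamma_LIMSEQ[of x 1] x by simp
  have le: "1 / y - 1 / (y + 1) \<le> inverse (y ^ Suc 1)"
    "inverse (y ^ Suc 1) \<le> (1 / y - 1 / (y + 1)) + (1 / y\<^sup>2 - 1 / (y + 1)\<^sup>2)" if "y > 0" for y :: real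
  proof -
    have 1: "1 / y - 1 / (y + 1) = 1 / (y * (y + 1))" using that by (simp add: field_simps)
    show "1 / y - 1 / (y + 1) \<le> inverse (y ^ Suc 1)"
      unfolding 1 inverse_eq_divide using that by (intro divide_left_mono mult_pos_pos) (auto simp: algebra_simps)
    have "(1 / y - 1 / (y + 1)) + (1 / y\<^sup>2 - 1 / (y + 1)\<^sup>2) - inverse (y ^ Suc 1) = 1 / (y * (y + 1)\<^sup>2)"
      using that by (simp add: divide_simps power2_eq_square) (simp add: algebra_simps)
    moreover have "1 / (y * (y + 1)\<^sup>2) \<ge> 0" using that by simp
    ultimately show "inverse (y ^ Suc 1) \<le> (1 / y - 1 / (y + 1)) + (1 / y\<^sup>2 - 1 / (y + 1)\<^sup>2)" by linarith
  qed
  show "1 / x \<le> Polygamma 1 x"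
    using sums_le[OF _ tele1 S] le(1)[of "x + real _"] x by (simp add: add_ac)
  show "Polygamma 1 x \<le> 1 / x + 1 / x\<^sup>2"
    using sums_le[OF _ S sums_add[OF tele1 tele2]] le(2)[of "x + real _"] x by (simp add: add_ac)
qed

text \<open>\<open>u y\<close> is the error of the trapezoidal rule for the integral of
  \<open>1 / t\<close> over a unit interval. It is nonpositive by convexity, and comparison with the
  midpoint rule bounds it below by a telescoping term. The sum of these errors converges to
  \<open>Digamma x - ln x + 1 / (2 * x)\<close>.\<close>

lemma digamma_bounds:
  assumes x: "(x::real) > 0"
  shows "Digamma x \<le> ln x - 1 / (2 * x)" "ln x - 1 / (2 * x) - 1 / x\<^sup>2 \<le> Digamma x"
proof -
  define u where "u y = ln (y + 1) - ln y - (1 / y + 1 / (y + 1)) / 2" for y :: real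
  have u: "u y \<le> 0" "- (1 / y\<^sup>2 - 1 / (y + 1)\<^sup>2) \<le> u y" if y: "y > 0" for y
  proof -
    show "u y \<le> 0" using ln_inverse_approx_le[of y 1] y by (simp add: u_def inverse_eq_divide)
    have "2 / (2 * y + 1) - (1 / y + 1 / (y + 1)) / 2 + (1 / y\<^sup>2 - 1 / (y + 1)\<^sup>2)
       = (2 * (2 * y + 1)\<^sup>2 - y * (y + 1)) / (2 * y\<^sup>2 * (y + 1)\<^sup>2 * (2 * y + 1))"
      using y by (simp add: divide_simps power2_eq_square) (simp add: algebra_simps)
    moreover have "2 * (2 * y + 1)\<^sup>2 - y * (y + 1) \<ge> 0" using y by (simp add: power2_eq_square algebra_simps)
    ultimately have "2 / (2 * y + 1) - (1 / y + 1 / (y + 1)) / 2 + (1 / y\<^sup>2 - 1 / (y + 1)\<^sup>2) \<ge> 0" using y by simp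
    thus "- (1 / y\<^sup>2 - 1 / (y + 1)\<^sup>2) \<le> u y" using ln_inverse_approx_ge[of y "y + 1"] y
      by (simp add: u_def)
  qed
  define U where "U m = (\<Sum>k<m. u (x + real k))" for m
  have sums: "- (1 / x\<^sup>2) \<le> U m" "U m \<le> 0" for m
  proof -
    show "U m \<le> 0" unfolding U_def using u(1) x by (intro sum_nonpos) auto
    have "(\<Sum>k<m. - (1 / (x + real k)\<^sup>2 - 1 / (x + real (Suc k))\<^sup>2)) \<le> U m"
      unfolding U_def using u(2)[of "x + real _"] x by (intro sum_mono) (auto simp: add_ac)
    also have "(\<Sum>k<m. - (1 / (x + real k)\<^sup>2 - 1 / (x + real (Suc k))\<^sup>2)) = - (1 / (x + real 0)\<^sup>2 - 1 / (x + real m)\<^sup>2)"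
      unfolding sum_negf by (subst sum_lessThan_telescope') simp
    finally show "- (1 / x\<^sup>2) \<le> U m" by (smt (verit) add.right_neutral of_nat_0 zero_le_divide_1_iff zero_le_power2)
  qed
  have U_eq: "U m = ln (x + real m) - ln x - (\<Sum>k<m. inverse (x + real k)) + (1 / x - 1 / (x + real m)) / 2" for m
    by (induction m) (simp_all add: U_def u_def field_simps)
  have "(\<lambda>m. (ln (real m) - (\<Sum>k<m. inverse (x + real k))) + (ln (x + real m) - ln (real m) - 1 / (2 * (x + real m)))) \<longlonglongrightarrow> Digamma x + 0"
  proof (rule tendsto_add)
    show "(\<lambda>m. ln (real m) - (\<Sum>k<m. inverse (x + real k))) \<longlonglongrightarrow> Digamma x"
      using Digamma_LIMSEQ[of x] x by simp
    show "(\<lambda>m. ln (x + real m) - ln (real m) - 1 / (2 * (x + real m))) \<longlonglongrightarrow> 0" by real_asymp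
  qed
  moreover have "(ln (real m) - (\<Sum>k<m. inverse (x + real k))) + (ln (x + real m) - ln (real m) - 1 / (2 * (x + real m)))
      = U m + (ln x - 1 / (2 * x))" for m
    by (simp add: U_eq diff_divide_distrib)
  ultimately have lim: "(\<lambda>m. U m + (ln x - 1 / (2 * x))) \<longlonglongrightarrow> Digamma x" by simp
  show "Digamma x \<le> ln x - 1 / (2 * x)"
    by (rule LIMSEQ_le_const2[OF lim]) (use sums in auto)
  show "ln x - 1 / (2 * x) - 1 / x\<^sup>2 \<le> Digamma x"
  proof (rule LIMSEQ_le_const[OF lim], intro exI[of _ 0] allI impI)
    show "ln x - 1 / (2 * x) - 1 / x\<^sup>2 \<le> U m + (ln x - 1 / (2 * x))" for m
      using sums(1)[of m] by linarith
  qed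
qed

text \<open>Second-order Taylor formula with both derivatives replaced by their approximations. The
  restriction on \<open>h\<close> keeps the intermediate point above \<open>x / 2\<close>. The term
  \<open>\<bar>h\<bar>\<close> of the bound comes from the digamma error, the other two from the
  trigamma error and the displacement of the intermediate point.\<close>

lemma ln_Gamma_diff_expansion:
  fixes x h :: real
  assumes x: "x > 0" and h: "\<bar>h\<bar> \<le> x / 2"
  shows "\<bar>ln_Gamma (x + h) - ln_Gamma x - (h * ln x - h / (2 * x) + h\<^sup>2 / (2 * x))\<bar> \<le> (\<bar>h\<bar> + 2 * h\<^sup>2 + \<bar>h\<bar> ^ 3) / x\<^sup>2"
proof (cases "h = 0")
  case False
  define D where "D m = (if m = 0 then ln_Gamma else Polygamma (m - 1) :: real \<Rightarrow> real)" for m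
  have "\<exists>t. (if x + h < x then x + h < t \<and> t < x else x < t \<and> t < x + h) \<and>
    ln_Gamma (x + h) = (\<Sum>m<2. D m x / fact m * (x + h - x) ^ m) + D 2 t / fact 2 * (x + h - x)\<^sup>2"
  proof (rule Taylor[where a = "x - \<bar>h\<bar>" and b = "x + \<bar>h\<bar>"])
    show "\<forall>m t. m < 2 \<and> x - \<bar>h\<bar> \<le> t \<and> t \<le> x + \<bar>h\<bar> \<longrightarrow> (D m has_real_derivative D (Suc m) t) (at t)"
    proof (intro allI impI)
      fix m :: nat and t assume mt: "m < 2 \<and> x - \<bar>h\<bar> \<le> t \<and> t \<le> x + \<bar>h\<bar>"
      hence t: "t > 0" using x h by linarith
      hence "t \<notin> \<int>\<^sub>\<le>\<^sub>0" by (auto elim!: nonpos_Ints_cases)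
      thus "(D m has_real_derivative D (Suc m) t) (at t)"
        using t mt by (cases m) (auto simp: D_def intro!: has_field_derivative_ln_Gamma_real has_field_derivative_Polygamma)
    qed
  qed (use False in \<open>auto simp: D_def\<close>)
  then obtain t where t': "if x + h < x then x + h < t \<and> t < x else x < t \<and> t < x + h"
    and eq': "ln_Gamma (x + h) = (\<Sum>m<2. D m x / fact m * (x + h - x) ^ m) + D 2 t / fact 2 * (x + h - x)\<^sup>2" by blast
  have t: "\<bar>t - x\<bar> \<le> \<bar>h\<bar>" using t' by (auto split: if_splits)
  have eq: "ln_Gamma (x + h) = ln_Gamma x + Digamma x * h + Polygamma 1 t / 2 * h\<^sup>2"
    using eq' by (simp add: D_def numeral_2_eq_2)
  have t2: "t \<ge> x / 2" using t h by linarith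
  hence t0: "t > 0" using x by linarith
  have inv: "1 / t \<le> 2 / x" using t2 x t0 by (simp add: field_simps)
  have d1: "\<bar>1 / t - 1 / x\<bar> \<le> 2 * \<bar>h\<bar> / x\<^sup>2"
  proof -
    have "\<bar>1 / t - 1 / x\<bar> = \<bar>t - x\<bar> * (1 / t) * (1 / x)"
      using t0 x by (simp add: diff_frac_eq abs_mult abs_minus_commute)
    also have "\<dots> \<le> \<bar>h\<bar> * (2 / x) * (1 / x)"
      using t inv x t0 by (intro mult_mono mult_nonneg_nonneg) auto
    finally show ?thesis by (simp add: power2_eq_square mult.commute)
  qed
  have d2: "1 / t\<^sup>2 \<le> 4 / x\<^sup>2"
    using power_mono[OF inv, of 2] t0 by (simp add: power_divide)
  have P: "\<bar>Polygamma 1 t - 1 / x\<bar> \<le> 2 * \<bar>h\<bar> / x\<^sup>2 + 4 / x\<^sup>2"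
    using trigamma_bounds[OF t0] d1 d2 by linarith
  have G: "\<bar>Digamma x - (ln x - 1 / (2 * x))\<bar> \<le> 1 / x\<^sup>2" using digamma_bounds[OF x] by linarith
  have "ln_Gamma (x + h) - ln_Gamma x - (h * ln x - h / (2 * x) + h\<^sup>2 / (2 * x))
     = h * (Digamma x - (ln x - 1 / (2 * x))) + h\<^sup>2 / 2 * (Polygamma 1 t - 1 / x)"
    unfolding eq by (simp add: algebra_simps diff_divide_distrib)
  also have "\<bar>\<dots>\<bar> \<le> \<bar>h\<bar> * (1 / x\<^sup>2) + h\<^sup>2 / 2 * (2 * \<bar>h\<bar> / x\<^sup>2 + 4 / x\<^sup>2)"
  proof (rule order_trans[OF abs_triangle_ineq], rule add_mono)
    show "\<bar>h * (Digamma x - (ln x - 1 / (2 * x)))\<bar> \<le> \<bar>h\<bar> * (1 / x\<^sup>2)"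
      unfolding abs_mult by (rule mult_left_mono[OF G]) simp
    show "\<bar>h\<^sup>2 / 2 * (Polygamma 1 t - 1 / x)\<bar> \<le> h\<^sup>2 / 2 * (2 * \<bar>h\<bar> / x\<^sup>2 + 4 / x\<^sup>2)"
      by (subst abs_mult, subst abs_of_nonneg, simp, rule mult_left_mono[OF P], simp)
  qed
  also have "\<dots> = (\<bar>h\<bar> + 2 * h\<^sup>2 + \<bar>h\<bar> ^ 3) / x\<^sup>2"
    using x by (simp add: field_simps power2_eq_square power3_eq_cube)
  finally show ?thesis .
qed simp

text \<open>The increments of \<open>stirling\<close> match the digamma approximation \<open>ln k - 1 / k\<close> up to \<open>1 / k\<^sup>2\<close>;
  telescoping them produces \<open>sph_mu\<close> exactly.\<close>
definition stirling :: "real \<Rightarrow> real" where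
  "stirling x = (x - 1/2) * ln x - x"

text \<open>Trapezoidal and midpoint bounds for \<open>ln k - ln (k - 1)\<close>. From
  \<open>k = 2\<close> on, \<open>2 * (k - 1)\<close> is at least \<open>k\<close>, which allows
  \<open>1 / k\<^sup>2\<close> as common bound.\<close>

lemma ln_diff_bounds:
  assumes k: "(k::real) \<ge> 2"
  shows "\<bar>ln k - ln (k - 1) - 1 / k\<bar> \<le> 1 / k\<^sup>2" "\<bar>stirling k - stirling (k - 1) - (ln k - 1 / k)\<bar> \<le> 1 / k\<^sup>2"
proof -
  define d where "d = ln k - ln (k - 1)"
  have lo: "2 / (2 * k - 1) \<le> d" using ln_inverse_approx_ge[of "k - 1" k] k by (simp add: d_def)
  have hi: "d \<le> (2 * k - 1) / (2 * k * (k - 1))"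
  proof -
    have "d \<le> (1 / (k - 1) + 1 / k) / 2" using ln_inverse_approx_le[of "k - 1" 1] k by (simp add: d_def inverse_eq_divide)
    also have "\<dots> = (2 * k - 1) / (2 * k * (k - 1))" using k by (simp add: field_simps)
    finally show ?thesis .
  qed
  have a1: "1 / k \<le> 2 / (2 * k - 1)" using k by (simp add: field_simps)
  have a2: "(2 * k - 1) / (2 * k * (k - 1)) - 1 / k = 1 / (2 * k * (k - 1))" using k by (simp add: field_simps)
  have a3: "1 / (2 * k * (k - 1)) \<le> 1 / k\<^sup>2"
    using k by (intro divide_left_mono) (auto simp: power2_eq_square algebra_simps)
  show "\<bar>ln k - ln (k - 1) - 1 / k\<bar> \<le> 1 / k\<^sup>2"
    using lo hi a1 a2 a3 unfolding d_def[symmetric] by (smt (verit) zero_le_power2 divide_nonneg_nonneg)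
  have eq: "stirling k - stirling (k - 1) - (ln k - 1 / k) = (k - 3/2) * d - 1 + 1 / k"
    by (simp add: stirling_def d_def field_simps)
  have "(k - 3/2) * (2 / (2 * k - 1)) - 1 + 1 / k = - (1 / (k * (2 * k - 1)))"
    using k by (simp add: divide_simps)
  moreover have "1 / (k * (2 * k - 1)) \<le> 1 / k\<^sup>2"
    using k by (intro divide_left_mono) (auto simp: power2_eq_square algebra_simps)
  moreover have "(k - 3/2) * (2 / (2 * k - 1)) \<le> (k - 3/2) * d" using lo k by (intro mult_left_mono) auto
  ultimately have b1: "- (1 / k\<^sup>2) \<le> (k - 3/2) * d - 1 + 1 / k" by linarith
  have "(k - 3/2) * ((2 * k - 1) / (2 * k * (k - 1))) - 1 + 1 / k = - (1 / (4 * k * (k - 1)))"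
    using k by (simp add: divide_simps) (simp add: algebra_simps)
  moreover have "1 / (4 * k * (k - 1)) \<ge> 0" using k by simp
  moreover have "(k - 3/2) * d \<le> (k - 3/2) * ((2 * k - 1) / (2 * k * (k - 1)))" using hi k by (intro mult_left_mono) auto
  moreover have "1 / k\<^sup>2 \<ge> 0" by simp
  ultimately have b2: "(k - 3/2) * d - 1 + 1 / k \<le> 1 / k\<^sup>2" by linarith
  show "\<bar>stirling k - stirling (k - 1) - (ln k - 1 / k)\<bar> \<le> 1 / k\<^sup>2"
    unfolding eq using b1 b2 by linarith
qed

text \<open>Both coefficients are written as increments, so that the sum over the degrees of freedom
  telescopes. The 11 is 4 + 4 + 1 from the Taylor error at \<open>k / 2\<close>, using
  \<open>\<bar>s\<bar> \<le> 1 / 2\<close>, plus 1 for each of the two replacements by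
  increments.\<close>

lemma ln_Gamma_half_diff:
  fixes k s :: real
  assumes k: "k \<ge> 2" and s: "\<bar>s\<bar> \<le> 1 / 2"
  shows "\<bar>ln_Gamma (k / 2 + s) - ln_Gamma (k / 2) - (s * (stirling k - stirling (k - 1) - ln 2) + s\<^sup>2 * (ln k - ln (k - 1)))\<bar> \<le> 11 * \<bar>s\<bar> / k\<^sup>2"
proof -
  have s2: "s\<^sup>2 \<le> \<bar>s\<bar> / 2" using mult_left_mono[OF s, of "\<bar>s\<bar>"] by (simp add: power2_eq_square)
  have s3: "\<bar>s\<bar> ^ 3 \<le> \<bar>s\<bar> / 4"
  proof -
    have "\<bar>s\<bar> ^ 3 = \<bar>s\<bar> * s\<^sup>2" by (simp add: power3_eq_cube power2_eq_square)
    also have "\<dots> \<le> \<bar>s\<bar> * (1 / 4)" using s2 s by (intro mult_left_mono) auto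
    finally show ?thesis by simp
  qed
  have "\<bar>ln_Gamma (k / 2 + s) - ln_Gamma (k / 2) - (s * ln (k / 2) - s / (2 * (k / 2)) + s\<^sup>2 / (2 * (k / 2)))\<bar>
     \<le> (\<bar>s\<bar> + 2 * s\<^sup>2 + \<bar>s\<bar> ^ 3) / (k / 2)\<^sup>2"
    using k s by (intro ln_Gamma_diff_expansion) auto
  also have "\<dots> = (4 * \<bar>s\<bar> + 8 * s\<^sup>2 + 4 * \<bar>s\<bar> ^ 3) / k\<^sup>2" by (simp add: power_divide field_simps)
  also have "\<dots> \<le> 9 * \<bar>s\<bar> / k\<^sup>2" using s2 s3 by (intro divide_right_mono) auto
  finally have 1: "\<bar>ln_Gamma (k / 2 + s) - ln_Gamma (k / 2) - (s * (ln k - ln 2) - s / k + s\<^sup>2 / k)\<bar> \<le> 9 * \<bar>s\<bar> / k\<^sup>2"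
    using k by (simp add: ln_div)
  have 2: "\<bar>s * (stirling k - stirling (k - 1) - (ln k - 1 / k))\<bar> \<le> \<bar>s\<bar> * (1 / k\<^sup>2)"
    unfolding abs_mult by (intro mult_left_mono ln_diff_bounds k) auto
  have "\<bar>s\<^sup>2 * (ln k - ln (k - 1) - 1 / k)\<bar> \<le> s\<^sup>2 * (1 / k\<^sup>2)"
    unfolding abs_mult abs_power2 by (intro mult_left_mono ln_diff_bounds k) auto
  also have "\<dots> \<le> \<bar>s\<bar> * (1 / k\<^sup>2)" using s2 by (intro mult_right_mono) auto
  finally have 3: "\<bar>s\<^sup>2 * (ln k - ln (k - 1) - 1 / k)\<bar> \<le> \<bar>s\<bar> * (1 / k\<^sup>2)" .
  have "ln_Gamma (k / 2 + s) - ln_Gamma (k / 2) - (s * (stirling k - stirling (k - 1) - ln 2) + s\<^sup>2 * (ln k - ln (k - 1)))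
    = (ln_Gamma (k / 2 + s) - ln_Gamma (k / 2) - (s * (ln k - ln 2) - s / k + s\<^sup>2 / k))
      - s * (stirling k - stirling (k - 1) - (ln k - 1 / k)) - s\<^sup>2 * (ln k - ln (k - 1) - 1 / k)"
    by (simp add: algebra_simps)
  moreover have "9 * \<bar>s\<bar> / k\<^sup>2 + \<bar>s\<bar> * (1 / k\<^sup>2) + \<bar>s\<bar> * (1 / k\<^sup>2) = 11 * \<bar>s\<bar> / k\<^sup>2" by (simp add: field_simps)
  ultimately show ?thesis using 1 2 3 by linarith
qed

text \<open>After telescoping the column terms and expanding the trace term once, everything matches
  except \<open>s / m\<close>. The constant 21 is 11 for the columns, 9 for the trace and 1 for this
  leftover.\<close>

lemma ln_lr_moment_expansion:
  fixes n p :: nat and s :: real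
  assumes p: "0 < p" "p + 1 < n" and s: "\<bar>s\<bar> \<le> 1 / 2"
  shows "lr_moment n p s > 0"
    and "\<bar>ln (lr_moment n p s) - s * sph_mu n p - s\<^sup>2 * sph_sigma2 n p / 2\<bar> \<le> 21 * \<bar>s\<bar> / (real n - 1 - real p)"
proof -
  define m where "m = real n - 1"
  define q where "q = m - real p"
  have mq: "q \<ge> 1" "m \<ge> 2" "q < m" "real p \<ge> 1" "real p \<le> m" "real p = m - q" using p by (auto simp: m_def q_def)
  have k: "m - real j \<ge> 2" if "j < p" for j using that p by (simp add: m_def)
  have k2: "(m - real j) / 2 \<ge> 1" if "j < p" for j using k[OF that] by simp
  have s2: "- (1 / 2) \<le> s" using s by (simp add: abs_le_iff)
  have G: "Gamma ((m - real j) / 2 + s) > 0" "Gamma ((m - real j) / 2) > 0" if "j < p" for j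
  proof -
    have "(m - real j) / 2 + s > 0" using k2[OF that] s2 by linarith
    moreover have "(m - real j) / 2 > 0" using k2[OF that] by linarith
    ultimately show "Gamma ((m - real j) / 2 + s) > 0" "Gamma ((m - real j) / 2) > 0" by (auto intro: Gamma_real_pos)
  qed
  have Gn: "Gamma ((m - real j) / 2 + s) \<noteq> 0" "Gamma ((m - real j) / 2) \<noteq> 0" if "j < p" for j
    using less_imp_neq[OF G(1)[OF that]] less_imp_neq[OF G(2)[OF that]] by auto
  define b where "b = real p * m / 2"
  have b: "b > 0" "b + real p * s > 0"
  proof -
    show "b > 0" using mq by (simp add: b_def)
    have "b + real p * s = real p * (m / 2 + s)" by (simp add: b_def algebra_simps)
    moreover have "m / 2 + s > 0" using mq s by linarith
    ultimately show "b + real p * s > 0" using mq by simp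
  qed
  have M: "lr_moment n p s = real p powr (real p * s) * (\<Prod>j<p. Gamma ((m - real j) / 2 + s) / Gamma ((m - real j) / 2)) * (Gamma b / Gamma (b + real p * s))"
    by (simp add: lr_moment_def m_def b_def)
  have pos: "(\<Prod>j<p. Gamma ((m - real j) / 2 + s) / Gamma ((m - real j) / 2)) > 0" "Gamma b / Gamma (b + real p * s) > 0"
    using G by (auto intro!: prod_pos divide_pos_pos) (use b in \<open>auto intro!: divide_pos_pos Gamma_real_pos\<close>)
  show "lr_moment n p s > 0" unfolding M using pos mq by (intro mult_pos_pos) auto
  have lnG: "ln (Gamma x) = ln_Gamma x" if "x > 0" for x :: real
    using that by (simp add: ln_Gamma_real_pos)
  have ln_prod_eq: "ln (\<Prod>j<p. Gamma ((m - real j) / 2 + s) / Gamma ((m - real j) / 2))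
     = (\<Sum>j<p. ln_Gamma ((m - real j) / 2 + s) - ln_Gamma ((m - real j) / 2))"
  proof (subst ln_prod)
    have "(m - real j) / 2 + s > 0" if "j < p" for j using k2[OF that] s2 by linarith
    moreover have "(m - real j) / 2 > 0" if "j < p" for j using k2[OF that] by linarith
    ultimately show "(\<Sum>j<p. ln (Gamma ((m - real j) / 2 + s) / Gamma ((m - real j) / 2))) = (\<Sum>j<p. ln_Gamma ((m - real j) / 2 + s) - ln_Gamma ((m - real j) / 2))"
      by (intro sum.cong refl) (simp add: ln_div lnG Gn)
  qed (use Gn in auto)
  have rp: "real p > 0" using p by simp
  have p1: "real p powr (real p * s) > 0" using rp by simp
  have p2: "real p powr (real p * s) * (\<Prod>j<p. Gamma ((m - real j) / 2 + s) / Gamma ((m - real j) / 2)) > 0"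
    using p1 pos(1) by (rule mult_pos_pos)
  have "Gamma b \<noteq> 0" "Gamma (b + real p * s) \<noteq> 0"
    using less_imp_neq[OF Gamma_real_pos[OF b(1)]] less_imp_neq[OF Gamma_real_pos[OF b(2)]] by auto
  hence lnr: "ln (Gamma b / Gamma (b + real p * s)) = ln_Gamma b - ln_Gamma (b + real p * s)"
    using b by (simp add: ln_div lnG)
  have lnM: "ln (lr_moment n p s) = real p * s * ln (real p) + (\<Sum>j<p. ln_Gamma ((m - real j) / 2 + s) - ln_Gamma ((m - real j) / 2))
     - (ln_Gamma (b + real p * s) - ln_Gamma b)"
    unfolding M ln_mult_pos[OF p2 pos(2)] ln_mult_pos[OF p1 pos(1)] lnr ln_prod_eq using rp by (simp add: ln_powr)
  define A where "A j = s * (stirling (m - real j) - stirling (m - real j - 1) - ln 2) + s\<^sup>2 * (ln (m - real j) - ln (m - real j - 1))" for j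
  have sumA: "(\<Sum>j<p. A j) = s * (stirling m - stirling q - real p * ln 2) + s\<^sup>2 * (ln m - ln q)"
  proof -
    have t: "(\<Sum>j<p. f (m - real j) - f (m - real j - 1)) = f m - f q" for f :: "real \<Rightarrow> real"
      using sum_lessThan_telescope'[of "\<lambda>j. f (m - real j)" p] by (simp add: q_def algebra_simps)
    have "(\<Sum>j<p. A j) = s * ((\<Sum>j<p. stirling (m - real j) - stirling (m - real j - 1)) - real p * ln 2)
       + s\<^sup>2 * (\<Sum>j<p. ln (m - real j) - ln (m - real j - 1))"
      by (simp add: A_def sum.distrib sum_distrib_left sum_subtractf algebra_simps)
    thus ?thesis by (simp only: t)
  qed
  have E1: "\<bar>(\<Sum>j<p. ln_Gamma ((m - real j) / 2 + s) - ln_Gamma ((m - real j) / 2)) - (\<Sum>j<p. A j)\<bar> \<le> 11 * \<bar>s\<bar> / q"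
  proof -
    have "\<bar>(\<Sum>j<p. ln_Gamma ((m - real j) / 2 + s) - ln_Gamma ((m - real j) / 2)) - (\<Sum>j<p. A j)\<bar>
      \<le> (\<Sum>j<p. \<bar>ln_Gamma ((m - real j) / 2 + s) - ln_Gamma ((m - real j) / 2) - A j\<bar>)"
      unfolding sum_subtractf[symmetric] by (rule sum_abs)
    also have "\<dots> \<le> (\<Sum>j<p. 11 * \<bar>s\<bar> * (1 / (m - real (Suc j)) - 1 / (m - real j)))"
    proof (rule sum_mono)
      fix j assume "j \<in> {..<p}"
      hence kj: "m - real j \<ge> 2" using k by auto
      have "\<bar>ln_Gamma ((m - real j) / 2 + s) - ln_Gamma ((m - real j) / 2) - A j\<bar> \<le> 11 * \<bar>s\<bar> / (m - real j)\<^sup>2"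
        unfolding A_def by (rule ln_Gamma_half_diff[OF kj s])
      also have "\<dots> = 11 * \<bar>s\<bar> * (1 / (m - real j)\<^sup>2)" by simp
      \<comment> \<open>Telescoping downwards: the last summand ends at \<open>q\<close>, the
        distance of \<open>p\<close> from \<open>n - 1\<close>, which is where the denominator of
        the final error comes from.\<close>
      also have "1 / (m - real j)\<^sup>2 \<le> 1 / (m - real (Suc j)) - 1 / (m - real j)"
      proof -
        define x where "x = m - real j"
        have "1 / (x - 1) - 1 / x = 1 / ((x - 1) * x)" using kj by (simp add: x_def field_simps)
        moreover have "1 / x\<^sup>2 \<le> 1 / ((x - 1) * x)" using kj
          by (intro divide_left_mono) (auto simp: x_def[symmetric] power2_eq_square intro!: mult_pos_pos)
        ultimately show ?thesis by (simp add: x_def algebra_simps)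
      qed
      finally show "\<bar>ln_Gamma ((m - real j) / 2 + s) - ln_Gamma ((m - real j) / 2) - A j\<bar> \<le> 11 * \<bar>s\<bar> * (1 / (m - real (Suc j)) - 1 / (m - real j))"
        by (simp add: mult_left_mono)
    qed
    also have "\<dots> = 11 * \<bar>s\<bar> * (1 / q - 1 / m)"
      unfolding sum_distrib_left[symmetric] by (subst sum_lessThan_telescope) (simp add: q_def)
    also have "\<dots> \<le> 11 * \<bar>s\<bar> * (1 / q)" using mq by (intro mult_left_mono) auto
    finally show ?thesis by simp
  qed
  have lnb: "ln b = ln (real p) + ln m - ln 2" using mq by (simp add: b_def ln_mult_pos ln_div)
  have E2: "\<bar>ln_Gamma (b + real p * s) - ln_Gamma b - (real p * s * ln b - s / m + real p * s\<^sup>2 / m)\<bar> \<le> 9 * \<bar>s\<bar> / q"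
  proof -
    define P where "P = real p"
    have P: "P \<ge> 1" "P \<le> m" using mq by (auto simp: P_def)
    \<comment> \<open>The increment \<open>P * s\<close> of the trace's Gamma argument may be large,
      but so is \<open>b = P * m / 2\<close>; with \<open>2 \<le> m\<close> the bound on
      \<open>s\<close> makes the expansion applicable.\<close>
    have hb: "\<bar>P * s\<bar> \<le> b / 2"
    proof -
      have "P * \<bar>s\<bar> \<le> P * (m / 4)" using mq s P by (intro mult_left_mono) auto
      thus ?thesis using P by (simp add: abs_mult b_def P_def)
    qed
    have eq: "P * s / (2 * b) = s / m" "(P * s)\<^sup>2 / (2 * b) = P * s\<^sup>2 / m"
      using P mq by (simp_all add: b_def P_def power2_eq_square field_simps)
    have "\<bar>ln_Gamma (b + P * s) - ln_Gamma b - (P * s * ln b - s / m + P * s\<^sup>2 / m)\<bar> \<le> (\<bar>P * s\<bar> + 2 * (P * s)\<^sup>2 + \<bar>P * s\<bar> ^ 3) / b\<^sup>2"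
      using ln_Gamma_diff_expansion[OF b(1) hb] unfolding eq .
    also have "\<dots> = 4 * \<bar>s\<bar> * ((1 / P + 2 * \<bar>s\<bar> + P * s\<^sup>2) / m\<^sup>2)"
    proof -
      have "\<bar>P * s\<bar> + 2 * (P * s)\<^sup>2 + \<bar>P * s\<bar> ^ 3 = P\<^sup>2 * (\<bar>s\<bar> * (1 / P + 2 * \<bar>s\<bar> + P * s\<^sup>2))"
        using P by (simp add: abs_mult power2_eq_square power3_eq_cube algebra_simps)
      moreover have "b\<^sup>2 = P\<^sup>2 * (m\<^sup>2 / 4)" by (simp add: b_def P_def power_divide power_mult_distrib)
      ultimately have "(\<bar>P * s\<bar> + 2 * (P * s)\<^sup>2 + \<bar>P * s\<bar> ^ 3) / b\<^sup>2
         = P\<^sup>2 * (\<bar>s\<bar> * (1 / P + 2 * \<bar>s\<bar> + P * s\<^sup>2)) / (P\<^sup>2 * (m\<^sup>2 / 4))" by (simp only:)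
      also have "\<dots> = \<bar>s\<bar> * (1 / P + 2 * \<bar>s\<bar> + P * s\<^sup>2) / (m\<^sup>2 / 4)"
        using P by (intro mult_divide_mult_cancel_left) auto
      finally show ?thesis by simp
    qed
    also have "\<dots> \<le> 4 * \<bar>s\<bar> * ((1 + 1 + m / 4) / m\<^sup>2)"
    proof (intro mult_left_mono divide_right_mono add_mono)
      show "1 / P \<le> 1" using P by simp
      have "s\<^sup>2 \<le> 1 / 4" using power_mono[OF s, of 2] by (simp add: power_divide)
      hence "P * s\<^sup>2 \<le> m * (1 / 4)" using P mq by (intro mult_mono) auto
      thus "P * s\<^sup>2 \<le> m / 4" by simp
    qed (use s in auto)
    also have "\<dots> \<le> 4 * \<bar>s\<bar> * (9 / 4 * (1 / q))"
    proof (intro mult_left_mono)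
      have "(1 + 1 + m / 4) / m\<^sup>2 \<le> (m + m / 4) / m\<^sup>2" using mq by (intro divide_right_mono) auto
      also have "\<dots> = (5 / 4) * (1 / m)" using mq by (simp add: power2_eq_square field_simps)
      also have "\<dots> \<le> (9 / 4) * (1 / q)" using mq by (intro mult_mono divide_left_mono) auto
      finally show "(1 + 1 + m / 4) / m\<^sup>2 \<le> 9 / 4 * (1 / q)" .
    qed auto
    finally show ?thesis by (simp add: P_def)
  qed
  have E3: "\<bar>s / m\<bar> \<le> \<bar>s\<bar> / q" using mq by (simp add: abs_divide) (intro divide_left_mono, auto)
  have ln1: "ln (1 - real p / (real n - 1)) = ln q - ln m"
  proof -
    have "1 - real p / m = q / m" using mq(2) by (simp add: q_def field_simps)
    thus ?thesis using mq(1,2) by (simp add: m_def[symmetric] ln_div)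
  qed
  have rn: "real n = m + 1" by (simp add: m_def)
  \<comment> \<open>The two \<open>stirling\<close> values leave the coefficient
    \<open>q - 1/2 = n - p - 3/2\<close> of the logarithm; \<open>real p * ln m\<close> comes from
    the trace.\<close>
  have mu: "sph_mu n p = stirling m - stirling q - real p * ln m"
    unfolding sph_mu_def ln1 unfolding rn mq(6) by (simp add: stirling_def field_simps)
  have sg: "sph_sigma2 n p = 2 * (ln m - ln q - real p / m)"
    unfolding sph_sigma2_def ln1 unfolding rn by (simp add: algebra_simps)
  have main: "real p * s * ln (real p) + (\<Sum>j<p. A j) - (real p * s * ln b - s / m + real p * s\<^sup>2 / m) - s * sph_mu n p - s\<^sup>2 * sph_sigma2 n p / 2 = s / m"
    unfolding sumA lnb mu sg by (simp add: algebra_simps diff_divide_distrib add_divide_distrib)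
  have tri: "\<bar>a + S - g - u - v\<bar> \<le> e1 + e2 + e3"
    if "a + A' - B - u - v = w" "\<bar>S - A'\<bar> \<le> e1" "\<bar>g - B\<bar> \<le> e2" "\<bar>w\<bar> \<le> e3" for a S A' B g u v w e1 e2 e3 :: real
    using that by linarith
  have "\<bar>ln (lr_moment n p s) - s * sph_mu n p - s\<^sup>2 * sph_sigma2 n p / 2\<bar> \<le> 11 * \<bar>s\<bar> / q + 9 * \<bar>s\<bar> / q + \<bar>s\<bar> / q"
    unfolding lnM by (rule tri[OF main E1 E2 E3])
  also have "\<dots> = 21 * \<bar>s\<bar> / q" by (simp add: field_simps)
  finally show "\<bar>ln (lr_moment n p s) - s * sph_mu n p - s\<^sup>2 * sph_sigma2 n p / 2\<bar> \<le> 21 * \<bar>s\<bar> / (real n - 1 - real p)"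
    by (simp add: q_def m_def)
qed

section \<open>Lower bounds for the variance\<close>

text \<open>The first bound is the second-order estimate of \<open>ln (1 - x)\<close> and keeps the
  variance away from 0. The second one makes it large when \<open>n - 1 - p\<close> is small
  compared with \<open>n\<close>.\<close>

lemma sph_sigma2_lower:
  fixes n p :: nat
  assumes p: "p + 1 < n"
  shows "(real p / (real n - 1))\<^sup>2 \<le> sph_sigma2 n p"
    and "2 * (ln (real n - 1) - ln (real n - 1 - real p)) - 2 \<le> sph_sigma2 n p"
proof -
  define x where "x = real p / (real n - 1)"
  have x: "0 \<le> x" "x < 1" using p by (auto simp: x_def)
  define g where "g t = ln (1 - t) + t + t\<^sup>2 / 2" for t :: real
  have "g x \<le> g 0"
  proof (rule DERIV_nonpos_imp_nonincreasing[OF x(1)])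
    fix t assume t: "0 \<le> t" "t \<le> x"
    hence t1: "t < 1" using x by linarith
    have "(g has_real_derivative - 1 / (1 - t) + 1 + t) (at t)"
      unfolding g_def using t1 by (auto intro!: derivative_eq_intros)
    moreover have "- 1 / (1 - t) + 1 + t = - (t\<^sup>2 / (1 - t))" using t1 by (simp add: field_simps power2_eq_square)
    moreover have "t\<^sup>2 / (1 - t) \<ge> 0" using t1 by simp
    ultimately show "\<exists>d. (g has_real_derivative d) (at t) \<and> d \<le> 0" by (metis neg_le_0_iff_le)
  qed
  thus "(real p / (real n - 1))\<^sup>2 \<le> sph_sigma2 n p"
    unfolding sph_sigma2_def x_def[symmetric] by (simp add: g_def)
  have "1 - x = (real n - 1 - real p) / (real n - 1)" using p by (simp add: x_def field_simps)
  hence "ln (1 - x) = ln (real n - 1 - real p) - ln (real n - 1)" using p by (simp add: ln_div)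
  thus "2 * (ln (real n - 1) - ln (real n - 1 - real p)) - 2 \<le> sph_sigma2 n p"
    unfolding sph_sigma2_def x_def[symmetric] using x by simp
qed

text \<open>The two regimes of \<open>n - 1 - p\<close> need different estimates, and a given
  sequence may alternate between them; the sum of the two bounds dominates in either case.\<close>

lemma sph_sigma_gap_tendsto:
  fixes p :: "nat \<Rightarrow> nat" and y :: real
  assumes n_gt: "\<forall>n\<ge>3. p n + 1 < n"
    and ratio: "(\<lambda>n. real (p n) / real n) \<longlonglongrightarrow> y" and y: "0 < y"
  shows "\<forall>\<^sub>F n in sequentially. y / 2 \<le> sqrt (sph_sigma2 n (p n))"
    and "(\<lambda>n. 1 / (sqrt (sph_sigma2 n (p n)) * (real n - 1 - real (p n)))) \<longlonglongrightarrow> 0"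
proof -
  have "\<forall>\<^sub>F n in sequentially. y / 2 < real (p n) / real n"
    using ratio y by (intro order_tendstoD) auto
  thus ev: "\<forall>\<^sub>F n in sequentially. y / 2 \<le> sqrt (sph_sigma2 n (p n))"
    using eventually_ge_at_top[of 3]
  proof eventually_elim
    case (elim n)
    have "y / 2 < real (p n) / real n" by fact
    also have "\<dots> \<le> real (p n) / (real n - 1)" using elim by (intro divide_left_mono) auto
    also have "\<dots> = sqrt ((real (p n) / (real n - 1))\<^sup>2)" using elim by simp
    also have "\<dots> \<le> sqrt (sph_sigma2 n (p n))"
      using sph_sigma2_lower(1)[of "p n" n] n_gt elim by (intro real_sqrt_le_mono) auto
    finally show ?case by simp
  qed
  have "(\<lambda>n. 2 / y * (1 / sqrt (real n - 1)) + 1 / sqrt (ln (real n - 1) - 2)) \<longlonglongrightarrow> 2 / y * 0 + 0"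
    by (intro tendsto_add tendsto_mult tendsto_const) real_asymp+
  hence lim: "(\<lambda>n. 2 / y * (1 / sqrt (real n - 1)) + 1 / sqrt (ln (real n - 1) - 2)) \<longlonglongrightarrow> 0" by simp
  have ev2: "\<forall>\<^sub>F n in sequentially. ln (real n - 1) > 2" by real_asymp
  show "(\<lambda>n. 1 / (sqrt (sph_sigma2 n (p n)) * (real n - 1 - real (p n)))) \<longlonglongrightarrow> 0"
  proof (rule Lim_null_comparison[OF _ lim])
    show "\<forall>\<^sub>F n in sequentially. norm (1 / (sqrt (sph_sigma2 n (p n)) * (real n - 1 - real (p n))))
       \<le> 2 / y * (1 / sqrt (real n - 1)) + 1 / sqrt (ln (real n - 1) - 2)"
      using ev ev2 eventually_ge_at_top[of 3]
    proof eventually_elim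
      case (elim n)
      define \<sigma> where "\<sigma> = sqrt (sph_sigma2 n (p n))"
      define m where "m = real n - 1"
      define q where "q = m - real (p n)"
      have pn: "p n + 1 < n" using n_gt elim by auto
      have q: "q \<ge> 1" "m \<ge> 2" using pn elim by (auto simp: q_def m_def)
      have \<sigma>: "\<sigma> \<ge> y / 2" "\<sigma> > 0" using elim(1) y unfolding \<sigma>_def by linarith+
      have n0: "0 \<le> 2 / y * (1 / sqrt m)" "0 \<le> 1 / sqrt (ln m - 2)" using y elim q by (auto simp: m_def)
      have "1 / (\<sigma> * q) \<le> 2 / y * (1 / sqrt m) + 1 / sqrt (ln m - 2)"
      \<comment> \<open>Below the threshold \<open>sqrt m\<close> one has
        \<open>ln q \<le> ln m / 2\<close>, so half of the logarithm survives in the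
        variance.\<close>
      proof (cases "q \<ge> sqrt m")
        case True
        have "1 / (\<sigma> * q) \<le> 1 / (y / 2 * sqrt m)"
          using \<sigma> True y q by (intro divide_left_mono mult_mono mult_pos_pos) auto
        also have "\<dots> = 2 / y * (1 / sqrt m)" by simp
        finally show ?thesis using n0 by linarith
      next
        case False
        have "ln q \<le> ln (sqrt m)" using False q by simp
        also have "\<dots> = ln m / 2" using q by (simp add: ln_sqrt)
        finally have "ln m - 2 \<le> sph_sigma2 n (p n)"
          using sph_sigma2_lower(2)[OF pn] by (simp add: m_def q_def)
        hence "sqrt (ln m - 2) \<le> \<sigma>" unfolding \<sigma>_def by (rule real_sqrt_le_mono)
        hence "sqrt (ln m - 2) \<le> \<sigma> * q" using q \<sigma> by (smt (verit) mult_le_cancel_left1)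
        moreover have "0 < sqrt (ln m - 2)" using elim by (simp add: m_def)
        ultimately have "1 / (\<sigma> * q) \<le> 1 / sqrt (ln m - 2)" using q \<sigma> by (intro divide_left_mono mult_pos_pos) auto
        thus ?thesis using n0 by linarith
      qed
      moreover have "1 / (\<sigma> * q) \<ge> 0" using \<sigma> q by simp
      ultimately show ?case by (simp add: \<sigma>_def m_def q_def)
    qed
  qed
qed

subsection \<open>The limit law\<close>

lemma mgf_standardized_lr_stat:
  fixes n p :: nat and t :: real
  assumes p: "0 < p" "p + 1 < n" and \<sigma>: "0 < \<sigma>" and s: "\<bar>t / \<sigma>\<bar> \<le> 1 / 2"
  shows "(\<integral>\<^sup>+z. ennreal (exp (t * ((ln (lr_stat n p z) - \<mu>) / \<sigma>))) \<partial>gauss_PiM ({..<p} \<times> {..<n}))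
     = ennreal (exp (ln (lr_moment n p (t / \<sigma>)) - t / \<sigma> * \<mu>))"
proof -
  define s where "s = t / \<sigma>"
  note [measurable] = borel_measurable_lr_stat[of n p]
  have "p < n" using p by simp
  have "(\<integral>\<^sup>+z. ennreal (exp (t * ((ln (lr_stat n p z) - \<mu>) / \<sigma>))) \<partial>gauss_PiM ({..<p} \<times> {..<n}))
    = (\<integral>\<^sup>+z. ennreal (exp (- s * \<mu>)) * ennreal (lr_stat n p z powr s) \<partial>gauss_PiM ({..<p} \<times> {..<n}))"
  proof (rule nn_integral_cong_AE)
    \<comment> \<open>Positivity matters here: at the value 0, \<open>powr\<close> gives 0 whereas
      an exponential never vanishes.\<close>
    show "AE z in gauss_PiM ({..<p} \<times> {..<n}). ennreal (exp (t * ((ln (lr_stat n p z) - \<mu>) / \<sigma>)))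
       = ennreal (exp (- s * \<mu>)) * ennreal (lr_stat n p z powr s)"
      using AE_lr_stat_pos[OF p(1) \<open>p < n\<close>]
    proof eventually_elim
      case (elim z)
      have "t * ((ln (lr_stat n p z) - \<mu>) / \<sigma>) = - s * \<mu> + s * ln (lr_stat n p z)"
        by (simp add: s_def diff_divide_distrib algebra_simps)
      hence "exp (t * ((ln (lr_stat n p z) - \<mu>) / \<sigma>)) = exp (- s * \<mu>) * exp (s * ln (lr_stat n p z))"
        by (simp only: exp_add)
      also have "exp (s * ln (lr_stat n p z)) = lr_stat n p z powr s" using elim by (simp add: powr_def)
      finally show ?case by (simp only: ennreal_mult' exp_ge_zero)
    qed
  qed
  also have "\<dots> = ennreal (exp (- s * \<mu>)) * (\<integral>\<^sup>+z. ennreal (lr_stat n p z powr s) \<partial>gauss_PiM ({..<p} \<times> {..<n}))"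
    by (rule nn_integral_cmult) measurable
  also have "(\<integral>\<^sup>+z. ennreal (lr_stat n p z powr s) \<partial>gauss_PiM ({..<p} \<times> {..<n})) = ennreal (lr_moment n p s)"
  proof (rule nn_integral_lr_stat_powr[OF p(1) \<open>p < n\<close>])
    fix j assume "j < p"
    hence "(real n - 1 - real j) / 2 \<ge> 1" using p by simp
    moreover have "- (1 / 2) \<le> s" using s unfolding s_def abs_le_iff by linarith
    ultimately show "(real n - 1 - real j) / 2 + s > 0" by linarith
  qed
  also have "ennreal (exp (- s * \<mu>)) * ennreal (lr_moment n p s) = ennreal (exp (- s * \<mu>) * lr_moment n p s)"
    by (rule ennreal_mult'[symmetric]) simp
  also have "exp (- s * \<mu>) * lr_moment n p s = exp (ln (lr_moment n p s) - s * \<mu>)"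
    using ln_lr_moment_expansion(1)[OF p s] by (simp add: s_def exp_diff exp_minus field_simps)
  finally show ?thesis by (simp add: s_def)
qed

lemma (in prob_space) distr_sphericity_V:
  fixes X :: "nat \<Rightarrow> 'a \<Rightarrow> nat \<Rightarrow> real" and n p :: nat and lam :: real and mu :: "nat \<Rightarrow> real"
  assumes n: "0 < n" and lam: "lam > 0"
    and normal: "\<And>i. i < n \<Longrightarrow> mvn_rv M p (X i) mu (\<lambda>j k. if j = k then lam else 0)"
    and indep: "indep_vars (\<lambda>_. PiM {..<p} (\<lambda>_. borel)) (\<lambda>i \<omega>. restrict (X i \<omega>) {..<p}) {..<n}"
    and h: "h \<in> borel_measurable borel"
  shows "distr M borel (\<lambda>\<omega>. h (sphericity_V n p (\<lambda>i. X i \<omega>)))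
    = distr (gauss_PiM ({..<p} \<times> {..<n})) borel (\<lambda>z. h (lr_stat n p z))"
proof -
  let ?I = "{..<p} \<times> {..<n}"
  define Z where "Z = (\<lambda>(j, i) \<omega>. (X i \<omega> j - mu j) / sqrt lam)"
  define T where "T \<omega> = (\<lambda>k\<in>?I. Z k \<omega>)" for \<omega>
  have law: "distr M (gauss_PiM ?I) T = gauss_PiM ?I"
    unfolding T_def Z_def by (rule distr_standardized_mvn(1)[OF lam normal indep])
  have mX: "(\<lambda>\<omega>. X i \<omega> j) \<in> borel_measurable M" if "i < n" "j < p" for i j
    by (rule distr_standardized_mvn(2)[OF lam normal indep that])
  have T: "T \<in> measurable M (gauss_PiM ?I)"
    unfolding T_def Z_def using mX by (intro measurable_restrict) (auto intro!: borel_measurable_divide borel_measurable_diff)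
  have "sphericity_V n p (\<lambda>i. X i \<omega>) = lr_stat n p (T \<omega>)" for \<omega>
    unfolding lr_stat_def
    by (rule sphericity_V_affine[where m = mu and c = "sqrt lam"]) (use n lam in \<open>auto simp: T_def Z_def\<close>)
  hence "distr M borel (\<lambda>\<omega>. h (sphericity_V n p (\<lambda>i. X i \<omega>))) = distr M borel ((\<lambda>z. h (lr_stat n p z)) \<circ> T)"
    by (simp add: o_def)
  also have "\<dots> = distr (distr M (gauss_PiM ?I) T) borel (\<lambda>z. h (lr_stat n p z))"
    by (rule distr_distr[symmetric]) (use T h borel_measurable_lr_stat in \<open>auto intro: measurable_compose\<close>)
  finally show ?thesis unfolding law .
qed

theorem theorem1:
  fixes p :: "nat \<Rightarrow> nat" and y :: real
    and M :: "nat \<Rightarrow> 'a measure"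
    and X :: "nat \<Rightarrow> nat \<Rightarrow> 'a \<Rightarrow> nat \<Rightarrow> real"
    and mu :: "nat \<Rightarrow> nat \<Rightarrow> real" and lam :: "nat \<Rightarrow> real"
  assumes p_pos: "\<forall>n. 0 < p n"
    and n_gt: "\<forall>n\<ge>3. p n + 1 < n"
    and ratio: "(\<lambda>n. real (p n) / real n) \<longlonglongrightarrow> y"
    and y_range: "0 < y" "y \<le> 1"
    and prob: "\<forall>n. prob_space (M n)"
    and lam_pos: "\<forall>n. 0 < lam n"
    and normal: "\<forall>n. \<forall>i<n. mvn_rv (M n) (p n) (X n i) (mu n)
                               (\<lambda>j k. if j = k then lam n else 0)"
    and indep: "\<forall>n. prob_space.indep_vars (M n) (\<lambda>_. PiM {..<p n} (\<lambda>_. borel))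
                      (\<lambda>i \<omega>. restrict (X n i \<omega>) {..<p n}) {..<n}"
  shows "weak_conv_m
           (\<lambda>n. distr (M n) borel
              (\<lambda>\<omega>. (ln (sphericity_V n (p n) (\<lambda>i. X n i \<omega>)) - sph_mu n (p n))
                    / sqrt (sph_sigma2 n (p n))))
           std_normal_distribution"
proof -
  define \<sigma> where "\<sigma> n = sqrt (sph_sigma2 n (p n))" for n
  define h where "h n v = (ln v - sph_mu n (p n)) / \<sigma> n" for n v
  define \<nu> where "\<nu> n = distr (M n) borel (\<lambda>\<omega>. h n (sphericity_V n (p n) (\<lambda>i. X n i \<omega>)))" for n
  have [measurable]: "h n \<in> borel_measurable borel" for n unfolding h_def by measurable
  have G: "prob_space (gauss_PiM ({..<p n} \<times> {..<n}))" for n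
    by (rule prob_space_PiM) (use real_dist_normal_dist in \<open>simp add: real_distribution_def\<close>)
  have hm: "(\<lambda>z. h n (lr_stat n (p n) z)) \<in> borel_measurable (gauss_PiM ({..<p n} \<times> {..<n}))" for n
    by (rule measurable_compose[OF borel_measurable_lr_stat]) measurable
  have \<nu>: "\<nu> n = distr (gauss_PiM ({..<p n} \<times> {..<n})) borel (\<lambda>z. h n (lr_stat n (p n) z))" if "n > 0" for n
  proof -
    interpret prob_space "M n" using prob by blast
    show ?thesis unfolding \<nu>_def
      using that lam_pos normal indep by (intro distr_sphericity_V[where lam = "lam n" and mu = "mu n"]) auto
  qed
  \<comment> \<open>The identification of \<open>\<nu> n\<close> with a law under the Gaussian
    product holds for positive \<open>n\<close>, while the convergence criterion wants a real
    distribution at every index; hence the shift.\<close>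
  have "weak_conv_m (\<lambda>n. \<nu> (n + 3)) std_normal_distribution"
  proof (rule weak_conv_m_std_normal_if_mgf)
    show "real_distribution (\<nu> (n + 3))" for n
    proof -
      interpret prob_space "gauss_PiM ({..<p (n + 3)} \<times> {..<n + 3})" by (rule G)
      show ?thesis by (subst \<nu>, simp) (rule real_distribution_distr[OF hm])
    qed
    \<comment> \<open>Eventually \<open>\<sigma> n\<close> is at least \<open>y / 2\<close>, so
      \<open>\<bar>t\<bar> < y / 4\<close> gives
      \<open>\<bar>t / \<sigma> n\<bar> \<le> 1 / 2\<close>, the range of the moment
      expansion.\<close>
    show "y / 4 > 0" using y_range by simp
    fix t :: real assume t: "\<bar>t\<bar> < y / 4"
    note gap = sph_sigma_gap_tendsto[OF n_gt ratio y_range(1), folded \<sigma>_def]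
    define L where "L n = ln (lr_moment n (p n) (t / \<sigma> n)) - t / \<sigma> n * sph_mu n (p n)" for n
    have evL: "\<forall>\<^sub>F n in sequentially. (\<integral>\<^sup>+x. ennreal (exp (t * x)) \<partial>\<nu> n) = ennreal (exp (L n))
        \<and> norm (L n - t\<^sup>2 / 2) \<le> 21 * \<bar>t\<bar> * (1 / (\<sigma> n * (real n - 1 - real (p n))))"
      using gap(1) eventually_ge_at_top[of 3]
    proof eventually_elim
      case (elim n)
      have pn: "0 < p n" "p n + 1 < n" using p_pos n_gt elim by auto
      have \<sigma>n: "\<sigma> n > 0" using elim(1) y_range by linarith
      have s: "\<bar>t / \<sigma> n\<bar> \<le> 1 / 2"
      proof -
        have "\<bar>t\<bar> \<le> \<sigma> n / 2" using t elim(1) by linarith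
        thus ?thesis using \<sigma>n by (simp add: abs_divide field_simps)
      qed
      have n0: "n > 0" using elim by simp
      have "(\<integral>\<^sup>+x. ennreal (exp (t * x)) \<partial>\<nu> n)
          = (\<integral>\<^sup>+z. ennreal (exp (t * h n (lr_stat n (p n) z))) \<partial>gauss_PiM ({..<p n} \<times> {..<n}))"
        unfolding \<nu>[OF n0] by (rule nn_integral_distr) (use hm in auto)
      also have "\<dots> = ennreal (exp (L n))"
        unfolding h_def L_def by (rule mgf_standardized_lr_stat[OF pn \<sigma>n s])
      finally have 1: "(\<integral>\<^sup>+x. ennreal (exp (t * x)) \<partial>\<nu> n) = ennreal (exp (L n))" .
      have "sph_sigma2 n (p n) > 0" using \<sigma>n by (simp add: \<sigma>_def)
      hence "(t / \<sigma> n)\<^sup>2 * sph_sigma2 n (p n) / 2 = t\<^sup>2 / 2" by (simp add: \<sigma>_def power_divide)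
      hence "norm (L n - t\<^sup>2 / 2) \<le> 21 * \<bar>t / \<sigma> n\<bar> / (real n - 1 - real (p n))"
        using ln_lr_moment_expansion(2)[OF pn s] by (simp add: L_def)
      also have "\<dots> = 21 * \<bar>t\<bar> * (1 / (\<sigma> n * (real n - 1 - real (p n))))" using \<sigma>n by (simp add: abs_divide)
      finally show ?case using 1 by simp
    qed
    have evL1: "\<forall>\<^sub>F n in sequentially. ennreal (exp (L n)) = (\<integral>\<^sup>+x. ennreal (exp (t * x)) \<partial>\<nu> n)"
      and evL2: "\<forall>\<^sub>F n in sequentially. norm (L n - t\<^sup>2 / 2) \<le> 21 * \<bar>t\<bar> * (1 / (\<sigma> n * (real n - 1 - real (p n))))"
      using evL unfolding eventually_conj_iff by (simp_all only: eq_commute)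
    have "(\<lambda>n. 21 * \<bar>t\<bar> * (1 / (\<sigma> n * (real n - 1 - real (p n))))) \<longlonglongrightarrow> 21 * \<bar>t\<bar> * 0"
      by (intro tendsto_mult tendsto_const gap(2))
    hence "(\<lambda>n. 21 * \<bar>t\<bar> * (1 / (\<sigma> n * (real n - 1 - real (p n))))) \<longlonglongrightarrow> 0" by (simp only: mult_zero_right)
    with evL2 have "(\<lambda>n. L n - t\<^sup>2 / 2) \<longlonglongrightarrow> 0" by (rule Lim_null_comparison)
    hence "L \<longlonglongrightarrow> t\<^sup>2 / 2" by (rule LIM_zero_cancel)
    hence "(\<lambda>n. ennreal (exp (L n))) \<longlonglongrightarrow> ennreal (exp (t\<^sup>2 / 2))"
      by (intro tendsto_ennrealI tendsto_exp)
    hence "(\<lambda>n. \<integral>\<^sup>+x. ennreal (exp (t * x)) \<partial>\<nu> n) \<longlonglongrightarrow> ennreal (exp (t\<^sup>2 / 2))"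
      using evL1 by (rule Lim_transform_eventually)
    thus "(\<lambda>n. \<integral>\<^sup>+x. ennreal (exp (t * x)) \<partial>\<nu> (n + 3)) \<longlonglongrightarrow> ennreal (exp (t\<^sup>2 / 2))"
      by (rule LIMSEQ_ignore_initial_segment)
  qed
  hence "weak_conv_m \<nu> std_normal_distribution"
    unfolding weak_conv_m_def weak_conv_def by (auto intro: LIMSEQ_offset)
  thus ?thesis by (simp add: \<nu>_def[abs_def] h_def \<sigma>_def)
qed

end
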